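(* Let $\mathcal{M}$ be a Riemannian manifold, and let $\mathcal{C}\subset\mathcal{M}$ be a compact set that is uniquely geodesically convex. Let $d:\mathcal{M}\times\mathcal{M}\to\mathbb{R}^+$ be a distance function for which there exist $0<\ell_{\mathcal{M}}\le L_{\mathcal{M}}$ such that $$\ell_{\mathcal{M}}\|\operatorname{Exp}_x^{-1}(y)\|_x\le d(x,y)\le L_{\mathcal{M}}\|\operatorname{Exp}_x^{-1}(y)\|_x\qquad\text{for all }(x,y)\in\mathcal{M}^2.$$ Assume that $\mathcal{C}$ is a Riemannian $\alpha$-strongly convex set. Then $\mathcal{C}$ is a geodesically $(\alpha\,\ell_{\mathcal{M}}/L_{\mathcal{M}}^2)$-strongly convex set w.r.t. $d$.
   Context: Geodesics are smooth curves $\gamma:[0,1]\to\mathcal{M}$ with zero covariant acceleration. A distance function on $\mathcal{M}$ is a function $\mathcal{M}\times\mathcal{M}\to\mathbb{R}^+$ satisfying positivity, symmetry and the triangle inequality; it may differ from the Riemannian distance, which is written $\|\operatorname{Exp}_x^{-1}(y)\|_x$. A closed set $\mathcal{C}\subseteq\mathcal{M}$ is (geodesically) convex if for any $x,y\in\mathcal{C}$ there is a distance-minimizing geodesic from $x$ to $y$ contained in $\mathcal{C}$; it is uniquely geodesic if for any $x,y\in\mathcal{C}$ there is only one geodesic between $x$ and $y$ contained in $\mathcal{C}$; uniquely geodesically convex means both. For $x\in\mathcal{C}$, $\operatorname{Exp}_x^{-1}:\mathcal{C}\to\mathcal{C}_x$ denotes the inverse of the exponential map at $x$ restricted to $\mathcal{C}_x=\{v\in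 T_x\mathcal{M}: t\mapsto\operatorname{Exp}_x(tv),\ t\in[0,1],\text{ is minimizing and }\operatorname{Exp}_x(v)\in\mathcal{C}\}$. Euclidean strong convexity: for $\alpha>0$, a compact convex set $K$ in a finite-dimensional inner product space is $\alpha$-strongly convex w.r.t. the induced norm $\|\cdot\|$ if for all $p,q\in K$, $t\in[0,1]$ and all $z$ with $\|z\|=1$, $(1-t)p+tq+\alpha t(1-t)\|p-q\|^2z\in K$. Riemannian $\alpha$-strong convexity: a uniquely geodesic set $\mathcal{C}$ is a Riemannian $\alpha$-strongly convex set if for every $x\in\mathcal{C}$ the set $\operatorname{Exp}_x^{-1}(\mathcal{C})=\{\operatorname{Exp}_x^{-1}(z): z\in\mathcal{C}\}\subset T_x\mathcal{M}$ is $\alpha$-strongly convex w.r.t. $\|\cdot\|_x$ in the Euclidean sense. Geodesic $\alpha$-strong convexity: a uniquely geodesic set $\mathcal{C}$ is geodesically $\alpha$-strongly convex w.r.t. $d$ if for every geodesic $\gamma$ joining $x,y\in\mathcal{C}$ and every $t\in[0,1]$, $\{z\in\mathcal{M}: d(\gamma(t),z)\le\alpha t(1-t)d^2(x,y)\}\subseteq\mathcal{C}$. *)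

theory Defs
  imports "HOL-Analysis.Analysis"
begin

section \<open>Smoothness\<close>

text \<open>
  Derivatives are taken within \<open>S\<close>, and the definition is only used for sets \<open>S\<close> on which these are
  unique: open sets of a Euclidean space, and relatively open subsets of the interval \<open>[0,1]\<close>
  (one-sided derivatives at the endpoints). In finite dimension, continuity of all iterated
  directional derivatives of differentiable maps is the usual \<open>C\<^sup>k\<close> condition.
\<close>

primrec Ck_on :: "nat \<Rightarrow> 'a::real_normed_vector set \<Rightarrow> ('a \<Rightarrow> 'b::real_normed_vector) \<Rightarrow> bool" where
  "Ck_on 0 S f \<longleftrightarrow> continuous_on S f"
| "Ck_on (Suc k) S f \<longleftrightarrow> (\<forall>x\<in>S. f differentiable (at x within S)) \<and>
     (\<forall>v. Ck_on k S (\<lambda>x. frechet_derivative f (at x within S) v))"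

definition smooth_on :: "'a::real_normed_vector set \<Rightarrow> ('a \<Rightarrow> 'b::real_normed_vector) \<Rightarrow> bool" where
  "smooth_on S f \<longleftrightarrow> (\<forall>k. Ck_on k S f)"

section \<open>Riemannian manifolds\<close>

text \<open>
  The manifold is the whole type \<open>'m\<close>, modelled on \<open>'e\<close>; a chart is a pair of its domain and its
  coordinate map. The tangent space \<open>T\<^sub>xM\<close> is \<open>'e\<close> itself: a tangent vector at \<open>x\<close> is given by its
  components in one preferred chart around \<open>x\<close> (\<open>chart_at M x\<close> below), and the components in any
  other chart are obtained from the derivative of the change of coordinates. The second record
  field is the inner product on \<open>T\<^sub>xM\<close>.
\<close>

type_synonym ('m, 'e) chart = "'m set \<times> ('m \<Rightarrow> 'e)"

record ('m, 'e) riemannian =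
  atlas :: "('m, 'e) chart set"
  rmetric :: "'m \<Rightarrow> 'e \<Rightarrow> 'e \<Rightarrow> real"

definition cdom :: "('m, 'e) chart \<Rightarrow> 'm set" where
  "cdom c = fst c"

definition cmap :: "('m, 'e) chart \<Rightarrow> 'm \<Rightarrow> 'e" where
  "cmap c = snd c"

definition cinv :: "('m, 'e) chart \<Rightarrow> 'e \<Rightarrow> 'm" where
  "cinv c = inv_into (cdom c) (cmap c)"

definition chart_at :: "('m, 'e) riemannian \<Rightarrow> 'm \<Rightarrow> ('m, 'e) chart" where
  "chart_at M x = (SOME c. c \<in> atlas M \<and> x \<in> cdom c)"

text \<open>Sends the components of a tangent vector at \<open>x\<close> in the chart \<open>c\<close> to its components in \<open>c'\<close>.\<close>

definition coord_change ::
  "('m, 'e::euclidean_space) chart \<Rightarrow> ('m, 'e) chart \<Rightarrow> 'm \<Rightarrow> 'e \<Rightarrow> 'e" where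
  "coord_change c c' x = frechet_derivative (cmap c' \<circ> cinv c) (at (cmap c x))"

text \<open>
  The metric tensor in the chart \<open>c\<close>, at the point with coordinates \<open>u\<close>, of the vectors with
  components \<open>a\<close> and \<open>b\<close> in \<open>c\<close>.
\<close>

definition metric_in ::
  "('m, 'e::euclidean_space) riemannian \<Rightarrow> ('m, 'e) chart \<Rightarrow> 'e \<Rightarrow> 'e \<Rightarrow> 'e \<Rightarrow> real" where
  "metric_in M c u a b =
     rmetric M (cinv c u)
       (coord_change c (chart_at M (cinv c u)) (cinv c u) a)
       (coord_change c (chart_at M (cinv c u)) (cinv c u) b)"

definition inner_product :: "('e::real_vector \<Rightarrow> 'e \<Rightarrow> real) \<Rightarrow> bool" where
  "inner_product B \<longleftrightarrow>
     bilinear B \<and> (\<forall>a b. B a b = B b a) \<and> (\<forall>a. a \<noteq> 0 \<longrightarrow> 0 < B a a)"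

definition riemannian_manifold ::
  "('m::{second_countable_topology, t2_space}, 'e::euclidean_space) riemannian \<Rightarrow> bool" where
  "riemannian_manifold M \<longleftrightarrow>
     (\<forall>c\<in>atlas M. open (cdom c) \<and> open (cmap c ` cdom c) \<and>
        homeomorphism (cdom c) (cmap c ` cdom c) (cmap c) (cinv c)) \<and>
     (\<Union>c\<in>atlas M. cdom c) = UNIV \<and>
     (\<forall>c\<in>atlas M. \<forall>c'\<in>atlas M. smooth_on (cmap c ` (cdom c \<inter> cdom c')) (cmap c' \<circ> cinv c)) \<and>
     (\<forall>x. inner_product (rmetric M x)) \<and>
     (\<forall>c\<in>atlas M. \<forall>a b. smooth_on (cmap c ` cdom c) (\<lambda>u. metric_in M c u a b))"

definition tnorm :: "('m, 'e) riemannian \<Rightarrow> 'm \<Rightarrow> 'e \<Rightarrow> real" where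
  "tnorm M x v = sqrt (rmetric M x v v)"

section \<open>Curves, length and Riemannian distance\<close>

text \<open>
  Curves are parametrized by \<open>[0,1]\<close>; the values of \<open>\<gamma> :: real \<Rightarrow> 'm\<close> outside this interval are
  irrelevant throughout.
\<close>

definition Ck_curve ::
  "nat \<Rightarrow> ('m::topological_space, 'e::euclidean_space) riemannian \<Rightarrow> (real \<Rightarrow> 'm) \<Rightarrow> bool" where
  "Ck_curve k M \<gamma> \<longleftrightarrow> continuous_on {0..1} \<gamma> \<and>
     (\<forall>c\<in>atlas M. Ck_on k {t \<in> {0..1}. \<gamma> t \<in> cdom c} (cmap c \<circ> \<gamma>))"

definition smooth_curve ::
  "('m::topological_space, 'e::euclidean_space) riemannian \<Rightarrow> (real \<Rightarrow> 'm) \<Rightarrow> bool" where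
  "smooth_curve M \<gamma> \<longleftrightarrow> (\<forall>k. Ck_curve k M \<gamma>)"

definition velocity_in ::
  "('m, 'e::euclidean_space) chart \<Rightarrow> (real \<Rightarrow> 'm) \<Rightarrow> real \<Rightarrow> 'e" where
  "velocity_in c \<gamma> t = vector_derivative (cmap c \<circ> \<gamma>) (at t within {0..1})"

definition velocity ::
  "('m, 'e::euclidean_space) riemannian \<Rightarrow> (real \<Rightarrow> 'm) \<Rightarrow> real \<Rightarrow> 'e" where
  "velocity M \<gamma> t = velocity_in (chart_at M (\<gamma> t)) \<gamma> t"

definition curve_length ::
  "('m, 'e::euclidean_space) riemannian \<Rightarrow> (real \<Rightarrow> 'm) \<Rightarrow> real" where
  "curve_length M \<gamma> = integral {0..1} (\<lambda>t. tnorm M (\<gamma> t) (velocity M \<gamma> t))"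

text \<open>Extended-valued, so that the distance between different components is \<open>\<infinity>\<close>.\<close>

definition riem_dist ::
  "('m::topological_space, 'e::euclidean_space) riemannian \<Rightarrow> 'm \<Rightarrow> 'm \<Rightarrow> ennreal" where
  "riem_dist M x y =
     (INF \<gamma>\<in>{\<gamma>. Ck_curve 1 M \<gamma> \<and> \<gamma> 0 = x \<and> \<gamma> 1 = y}. ennreal (curve_length M \<gamma>))"

section \<open>Geodesics and the exponential map\<close>

text \<open>
  The Levi-Civita connection in the chart \<open>c\<close>: \<open>christoffel M c u a b\<close> is the vector with components
  \<open>\<Gamma>\<^sup>k\<^sub>i\<^sub>j a\<^sup>i b\<^sup>j\<close> at the point with coordinates \<open>u\<close>, obtained from the Koszul formula for constant
  coordinate vector fields.
\<close>

definition christoffel ::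
  "('m, 'e::euclidean_space) riemannian \<Rightarrow> ('m, 'e) chart \<Rightarrow> 'e \<Rightarrow> 'e \<Rightarrow> 'e \<Rightarrow> 'e" where
  "christoffel M c u a b = (THE w. \<forall>z. metric_in M c u w z =
     (frechet_derivative (\<lambda>p. metric_in M c p b z) (at u) a
    + frechet_derivative (\<lambda>p. metric_in M c p a z) (at u) b
    - frechet_derivative (\<lambda>p. metric_in M c p a b) (at u) z) / 2)"

definition covariant_acceleration_in ::
  "('m, 'e::euclidean_space) riemannian \<Rightarrow> ('m, 'e) chart \<Rightarrow> (real \<Rightarrow> 'm) \<Rightarrow> real \<Rightarrow> 'e" where
  "covariant_acceleration_in M c \<gamma> t =
     vector_derivative (velocity_in c \<gamma>) (at t within {0..1})
     + christoffel M c (cmap c (\<gamma> t)) (velocity_in c \<gamma> t) (velocity_in c \<gamma> t)"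

definition geodesic ::
  "('m::topological_space, 'e::euclidean_space) riemannian \<Rightarrow> (real \<Rightarrow> 'm) \<Rightarrow> bool" where
  "geodesic M \<gamma> \<longleftrightarrow> smooth_curve M \<gamma> \<and>
     (\<forall>c\<in>atlas M. \<forall>t\<in>{0..1}. \<gamma> t \<in> cdom c \<longrightarrow> covariant_acceleration_in M c \<gamma> t = 0)"

definition minimizing_geodesic ::
  "('m::topological_space, 'e::euclidean_space) riemannian \<Rightarrow> (real \<Rightarrow> 'm) \<Rightarrow> bool" where
  "minimizing_geodesic M \<gamma> \<longleftrightarrow>
     geodesic M \<gamma> \<and> ennreal (curve_length M \<gamma>) = riem_dist M (\<gamma> 0) (\<gamma> 1)"

text \<open>No completeness is assumed, so \<open>Exp M x\<close> is meaningful only on \<open>exp_domain M x\<close>.\<close>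

definition exp_domain ::
  "('m::topological_space, 'e::euclidean_space) riemannian \<Rightarrow> 'm \<Rightarrow> 'e set" where
  "exp_domain M x = {v. \<exists>\<gamma>. geodesic M \<gamma> \<and> \<gamma> 0 = x \<and> velocity M \<gamma> 0 = v}"

definition Exp ::
  "('m::topological_space, 'e::euclidean_space) riemannian \<Rightarrow> 'm \<Rightarrow> 'e \<Rightarrow> 'm" where
  "Exp M x v = (THE y. \<exists>\<gamma>. geodesic M \<gamma> \<and> \<gamma> 0 = x \<and> velocity M \<gamma> 0 = v \<and> \<gamma> 1 = y)"

section \<open>Convexity\<close>

definition geodesic_in ::
  "('m::topological_space, 'e::euclidean_space) riemannian \<Rightarrow> 'm set \<Rightarrow> 'm \<Rightarrow> 'm \<Rightarrow> (real \<Rightarrow> 'm) \<Rightarrow> bool"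
where
  "geodesic_in M C x y \<gamma> \<longleftrightarrow> geodesic M \<gamma> \<and> \<gamma> 0 = x \<and> \<gamma> 1 = y \<and> \<gamma> ` {0..1} \<subseteq> C"

definition geodesically_convex ::
  "('m::topological_space, 'e::euclidean_space) riemannian \<Rightarrow> 'm set \<Rightarrow> bool" where
  "geodesically_convex M C \<longleftrightarrow> closed C \<and>
     (\<forall>x\<in>C. \<forall>y\<in>C. \<exists>\<gamma>. minimizing_geodesic M \<gamma> \<and> geodesic_in M C x y \<gamma>)"

definition uniquely_geodesic ::
  "('m::topological_space, 'e::euclidean_space) riemannian \<Rightarrow> 'm set \<Rightarrow> bool" where
  "uniquely_geodesic M C \<longleftrightarrow>
     (\<forall>x\<in>C. \<forall>y\<in>C. \<exists>\<gamma>. geodesic_in M C x y \<gamma> \<and>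
        (\<forall>\<gamma>'. geodesic_in M C x y \<gamma>' \<longrightarrow> (\<forall>t\<in>{0..1}. \<gamma>' t = \<gamma> t)))"

definition uniquely_geodesically_convex ::
  "('m::topological_space, 'e::euclidean_space) riemannian \<Rightarrow> 'm set \<Rightarrow> bool" where
  "uniquely_geodesically_convex M C \<longleftrightarrow> geodesically_convex M C \<and> uniquely_geodesic M C"

text \<open>The set \<open>C\<^sub>x\<close> of initial velocities of minimizing geodesics from \<open>x\<close> to points of \<open>C\<close>.\<close>

definition log_range ::
  "('m::topological_space, 'e::euclidean_space) riemannian \<Rightarrow> 'm set \<Rightarrow> 'm \<Rightarrow> 'e set" where
  "log_range M C x =
     {v \<in> exp_domain M x. minimizing_geodesic M (\<lambda>t. Exp M x (t *\<^sub>R v)) \<and> Exp M x v \<in> C}"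

definition Exp_inv ::
  "('m::topological_space, 'e::euclidean_space) riemannian \<Rightarrow> 'm set \<Rightarrow> 'm \<Rightarrow> 'm \<Rightarrow> 'e" where
  "Exp_inv M C x = inv_into (log_range M C x) (Exp M x)"

text \<open>
  Strong convexity in the space \<open>'e\<close> with the inner product \<open>B\<close>, which need not be the standard one.
  All inner products on \<open>'e\<close> induce the same topology, so \<open>compact\<close> does not depend on \<open>B\<close>.
\<close>

definition strongly_convex_set ::
  "('e::euclidean_space \<Rightarrow> 'e \<Rightarrow> real) \<Rightarrow> real \<Rightarrow> 'e set \<Rightarrow> bool" where
  "strongly_convex_set B \<alpha> K \<longleftrightarrow> 0 < \<alpha> \<and> compact K \<and> convex K \<and>
     (\<forall>p\<in>K. \<forall>q\<in>K. \<forall>t\<in>{0..1}. \<forall>z. sqrt (B z z) = 1 \<longrightarrow>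
        (1 - t) *\<^sub>R p + t *\<^sub>R q + (\<alpha> * t * (1 - t) * (sqrt (B (p - q) (p - q)))\<^sup>2) *\<^sub>R z \<in> K)"

definition riemannian_strongly_convex ::
  "('m::topological_space, 'e::euclidean_space) riemannian \<Rightarrow> real \<Rightarrow> 'm set \<Rightarrow> bool" where
  "riemannian_strongly_convex M \<alpha> C \<longleftrightarrow> uniquely_geodesic M C \<and>
     (\<forall>x\<in>C. strongly_convex_set (rmetric M x) \<alpha> (Exp_inv M C x ` C))"

text \<open>
  Only geodesics contained in \<open>C\<close> are considered: on a sphere, say, two points of \<open>C\<close> are also joined
  by geodesics that leave \<open>C\<close>.
\<close>

definition geodesically_strongly_convex ::
  "('m::topological_space, 'e::euclidean_space) riemannian \<Rightarrow> ('m \<Rightarrow> 'm \<Rightarrow> real) \<Rightarrow> real \<Rightarrow> 'm set \<Rightarrow> bool"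
where
  "geodesically_strongly_convex M d \<alpha> C \<longleftrightarrow> uniquely_geodesic M C \<and>
     (\<forall>x\<in>C. \<forall>y\<in>C. \<forall>\<gamma>. geodesic_in M C x y \<gamma> \<longrightarrow>
        (\<forall>t\<in>{0..1}. {z. d (\<gamma> t) z \<le> \<alpha> * t * (1 - t) * (d x y)\<^sup>2} \<subseteq> C))"

end

theory Submission
  imports Defs
begin

text \<open>
  Fix a geodesic \<open>\<gamma>\<close> in \<open>C\<close> from \<open>x\<close> to \<open>y\<close>, put \<open>w = \<gamma> t\<close> and let \<open>r = \<alpha> t (1 - t) \<delta>(x, y)\<^sup>2\<close>, where \<open>\<delta>\<close> is the
  Riemannian distance. By the bounds on \<open>d\<close>, every point to be shown in \<open>C\<close> has \<open>\<delta>(w, z) \<le> r\<close>. In \<open>T\<^sub>wM\<close> the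
  logarithms of \<open>x\<close> and \<open>y\<close> are \<open>- t \<gamma>'(t)\<close> and \<open>(1 - t) \<gamma>'(t)\<close>, so strong convexity at the convex
  combination \<open>0\<close> puts the tangent ball of radius \<open>r\<close> into the logarithm of \<open>C\<close>. The exponential map
  is continuous there (Gronwall in charts) and injective, so by invariance of domain it maps the open
  ball to an open subset of \<open>C\<close>. Hence points of \<open>C\<close> closer to \<open>w\<close> than \<open>r\<close> are interior, and a curve from
  \<open>w\<close> of length close to \<open>r\<close> cannot end outside the closed set \<open>C\<close>. Neither completeness nor the Gauss lemma
  is needed.
\<close>

section \<open>Calculus on the unit interval and in coordinates\<close>

text \<open>Centring at \<open>\<gamma> t\<close> rather than at an endpoint matters: a logarithm
  has tangent norm equal to Riemannian distance only as seen from its own base point, so a tangent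
  ball around that origin corresponds to the points of \<open>C\<close> at distance below its
  radius, with no loss from curvature. The factor \<open>l / L\<^sup>2\<close> arises because the
  upper bound on \<open>d\<close> enters squared, through \<open>d x y\<close>, and the lower bound
  once, through \<open>d (\<gamma> t) z\<close>.

  The main obstacle is analytic. \<open>Exp\<close> is a definite description over solutions of the
  geodesic equation and makes sense only where a solution reaches time 1, so uniqueness and
  continuity must come before any use of it. Every geodesic that occurs is supplied by convexity of
  \<open>C\<close> or by membership in \<open>exp_domain\<close>; hence the theory of the equation
  reduces to dependence on initial data, and uniqueness is its instance for a constant family. The
  dependence is a short-time estimate in one chart, and connectedness of the unit interval carries
  it to time 1.\<close>

lemma at_within_relopen:
  assumes "openin (top_of_set {0..1::real}) S" "t \<in> S"
  shows "at t within S = at t within {0..1}" "at t within S \<noteq> bot"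
proof -
  obtain U where U: "open U" "S = {0..1} \<inter> U"
    using assms(1) by (auto simp: openin_open)
  show 1: "at t within S = at t within {0..1}"
    by (rule at_within_nhd[of _ U]) (use U assms(2) in auto)
  have "t islimpt {0..1}"
    using U assms(2) by (simp add: islimpt_Icc)
  then show "at t within S \<noteq> bot"
    unfolding 1 by (simp add: trivial_limit_within)
qed

text \<open>A linear map on the reals is determined by its value at 1, so a nontrivial filter is
  enough. This covers the one-sided derivatives at the endpoints of the interval.\<close>

lemma real_derivative_unique_within:
  fixes f :: "real \<Rightarrow> 'b::real_normed_vector"
  assumes "(f has_derivative f') (at t within S)" "(f has_derivative f'') (at t within S)"
    and "at t within S \<noteq> bot"
  shows "f' = f''"
proof -
  have *: "g h = h *\<^sub>R g 1" if "(f has_derivative g) (at t within S)" for g h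
    using linear_scale[OF has_derivative_linear[OF that], of h 1] by simp
  have "(f has_vector_derivative f' 1) (at t within S)"
    "(f has_vector_derivative f'' 1) (at t within S)"
    using assms(1,2) unfolding has_vector_derivative_def
    by (simp_all flip: *[OF assms(1)] *[OF assms(2)])
  then have "f' 1 = f'' 1"
    using assms(3) vector_derivative_unique_within by blast
  then show ?thesis
    by (intro ext) (subst *[OF assms(1)], subst *[OF assms(2)], simp)
qed

lemma frechet_derivative_real_within:
  fixes f :: "real \<Rightarrow> 'b::real_normed_vector"
  assumes "(f has_derivative f') (at t within S)" "at t within S \<noteq> bot"
  shows "frechet_derivative f (at t within S) = f'"
  using assms real_derivative_unique_within frechet_derivative_works
  by (metis differentiable_def)

lemma frechet_derivative_cong:
  assumes "\<And>x. x \<in> S \<Longrightarrow> f x = g x" "x \<in> S"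
  shows "frechet_derivative f (at x within S) = frechet_derivative g (at x within S)"
proof -
  have "(f has_derivative D) (at x within S) \<longleftrightarrow> (g has_derivative D) (at x within S)" for D
    using assms has_derivative_transform[of x S f g D] has_derivative_transform[of x S g f D] by auto
  then show ?thesis
    unfolding frechet_derivative_def by simp
qed

lemma Ck_on_cong:
  "(\<And>x. x \<in> S \<Longrightarrow> f x = g x) \<Longrightarrow> Ck_on k S f \<longleftrightarrow> Ck_on k S g"
proof (induction k arbitrary: f g)
  case 0
  then show ?case by (simp cong: continuous_on_cong)
next
  case (Suc k)
  have "f differentiable (at x within S) \<longleftrightarrow> g differentiable (at x within S)" if "x \<in> S" for x
    unfolding differentiable_def
    using that Suc.prems has_derivative_transform[of x S f g] has_derivative_transform[of x S g f] by metis
  moreover have "Ck_on k S (\<lambda>x. frechet_derivative f (at x within S) v)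
      \<longleftrightarrow> Ck_on k S (\<lambda>x. frechet_derivative g (at x within S) v)" for v
    by (rule Suc.IH) (use frechet_derivative_cong[of S f g] Suc.prems in auto)
  ultimately show ?case by simp
qed

text \<open>Relative openness of \<open>S'\<close> makes derivatives within it unique, so the one
  selected by \<open>frechet_derivative\<close> is the one given by the chain rule. The factor
  \<open>b\<close> may be negative or zero, as reversed and constant curves will use.\<close>

lemma Ck_on_affine:
  fixes f :: "real \<Rightarrow> 'b::real_normed_vector"
  assumes "Ck_on k S f" "openin (top_of_set {0..1}) S'" "(\<lambda>s. a + b * s) ` S' \<subseteq> S"
  shows "Ck_on k S' (\<lambda>s. f (a + b * s))"
  using assms(1)
proof (induction k arbitrary: f)
  case 0
  then show ?case
    using assms(3) by (auto intro!: continuous_on_compose2[of S f] continuous_intros)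
next
  case (Suc k)
  have D: "((\<lambda>s. f (a + b * s)) has_derivative
      (\<lambda>h. frechet_derivative f (at (a + b * s) within S) (b * h))) (at s within S')" if "s \<in> S'" for s
  proof -
    have "a + b * s \<in> S" using that assms(3) by auto
    then have "(f has_derivative frechet_derivative f (at (a + b * s) within S)) (at (a + b * s) within S)"
      using Suc.prems frechet_derivative_works by auto
    then have "(f has_derivative frechet_derivative f (at (a + b * s) within S))
        (at (a + b * s) within (\<lambda>s. a + b * s) ` S')"
      using assms(3) has_derivative_subset by blast
    then show ?thesis
      by (rule has_derivative_in_compose[rotated]) (auto intro!: derivative_eq_intros)
  qed
  have E: "frechet_derivative (\<lambda>s. f (a + b * s)) (at s within S') v =
      frechet_derivative f (at (a + b * s) within S) (b * v)" if "s \<in> S'" for s v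
    using frechet_derivative_real_within[OF D[OF that]] at_within_relopen(2)[OF assms(2) that] by simp
  have "Ck_on k S' (\<lambda>s. frechet_derivative (\<lambda>s. f (a + b * s)) (at s within S') v)" for v
  proof -
    have "Ck_on k S' (\<lambda>s. frechet_derivative f (at (a + b * s) within S) (b * v))"
      using Suc.IH[of "\<lambda>t. frechet_derivative f (at t within S) (b * v)"] Suc.prems by simp
    then show ?thesis
      by (rule Ck_on_cong[THEN iffD1, rotated]) (simp add: E)
  qed
  then show ?case
    using D by (auto simp: differentiable_def)
qed

lemma affine_01:
  fixes a b s :: real
  assumes "a \<in> {0..1}" "a + b \<in> {0..1}" "s \<in> {0..1}"
  shows "a + b * s \<in> {0..1}"
proof -
  have "a + b * s = (1 - s) * a + s * (a + b)" by (simp add: algebra_simps)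
  then show ?thesis
    using convexD_alt[OF convex_real_interval(5)[of 0 1] assms(1,2), of s] assms(3) by auto
qed

text \<open>Each directional derivative is bounded on the compact ball; adding the bounds over the
  basis controls the operator norm, and convexity of the ball turns this into a Lipschitz
  constant.\<close>

lemma Ck_on_imp_Lipschitz_cball:
  fixes f :: "'a::euclidean_space \<Rightarrow> real"
  assumes "Ck_on (Suc 0) S f" "open S" "cball u0 \<rho> \<subseteq> S"
  obtains B where "B \<ge> 0" "\<And>x y. x \<in> cball u0 \<rho> \<Longrightarrow> y \<in> cball u0 \<rho> \<Longrightarrow> \<bar>f x - f y\<bar> \<le> B * norm (x - y)"
    "\<And>x. x \<in> cball u0 \<rho> \<Longrightarrow> \<bar>f x\<bar> \<le> B"
proof -
  define f' where "f' x = frechet_derivative f (at x)" for x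
  have at: "at x within S = at x" if "x \<in> S" for x
    using that assms(2) by (rule at_within_open)
  have D: "(f has_derivative f' x) (at x)" if "x \<in> S" for x
  proof -
    have "f differentiable (at x within S)" using assms(1) that by simp
    then show ?thesis
      unfolding f'_def at[OF that] using frechet_derivative_works by blast
  qed
  have C: "continuous_on S (\<lambda>x. f' x v)" for v
    using assms(1) at unfolding f'_def by (simp cong: continuous_on_cong)
  have "\<exists>B. \<forall>x\<in>cball u0 \<rho>. \<bar>f' x i\<bar> \<le> B" for i
  proof -
    have "compact ((\<lambda>x. f' x i) ` cball u0 \<rho>)"
      by (intro compact_continuous_image continuous_on_subset[OF C assms(3)]) simp
    from compact_imp_bounded[OF this] show ?thesis
      unfolding bounded_iff by auto
  qed
  then obtain B where B: "\<And>i x. x \<in> cball u0 \<rho> \<Longrightarrow> \<bar>f' x i\<bar> \<le> B i" by metis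
  have cont: "continuous_on (cball u0 \<rho>) f"
    by (meson D assms(3) continuous_at_imp_continuous_on has_derivative_continuous subsetD)
  have "compact (f ` cball u0 \<rho>)"
    by (intro compact_continuous_image cont) simp
  from compact_imp_bounded[OF this] obtain B' where B': "\<And>x. x \<in> cball u0 \<rho> \<Longrightarrow> \<bar>f x\<bar> \<le> B'"
    unfolding bounded_iff by (metis image_eqI real_norm_def)
  define BB where "BB = (\<Sum>i\<in>Basis. \<bar>B i\<bar>)"
  have on: "onorm (f' x) \<le> BB" if x: "x \<in> cball u0 \<rho>" for x
  proof (rule onorm_le)
    fix v
    have lin: "linear (f' x)"
      using D assms(3) x has_derivative_linear by blast
    have "norm (f' x v) = \<bar>\<Sum>i\<in>Basis. (v \<bullet> i) * f' x i\<bar>"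
      by (subst (1) euclidean_representation[symmetric, of v])
        (simp add: linear_sum[OF lin] linear_scale[OF lin])
    also have "\<dots> \<le> (\<Sum>i\<in>Basis. \<bar>v \<bullet> i\<bar> * \<bar>f' x i\<bar>)"
      by (rule order_trans[OF sum_abs]) (simp add: abs_mult)
    also have "\<dots> \<le> (\<Sum>i\<in>Basis. norm v * \<bar>B i\<bar>)"
      by (intro sum_mono mult_mono Basis_le_norm) (use B x in \<open>auto intro: order_trans[OF B[OF x]]\<close>)
    also have "\<dots> = BB * norm v"
      unfolding BB_def by (simp add: sum_distrib_left mult.commute)
    finally show "norm (f' x v) \<le> BB * norm v" .
  qed
  have "\<bar>f x - f y\<bar> \<le> BB * norm (x - y)" if "x \<in> cball u0 \<rho>" "y \<in> cball u0 \<rho>" for x y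
    using differentiable_bound[of "cball u0 \<rho>" f f' BB x y] that on D assms(3)
    by (metis convex_cball has_derivative_at_withinI real_norm_def subsetD)
  moreover have "BB \<ge> 0" unfolding BB_def by (simp add: sum_nonneg)
  moreover have "BB * norm (x - y) \<le> max BB B' * norm (x - y)" for x y :: 'a
    by (intro mult_right_mono) auto
  ultimately show ?thesis
    using that[of "max BB B'"] B' by (metis max.coboundedI1 max.coboundedI2 order_trans)
qed

text \<open>For the squared phase-space distance \<open>E\<close>, Cauchy-Schwarz gives a derivative
  of size at most \<open>(1 + 3 * K) * E\<close>: 1 from pairing positions with velocities,
  \<open>K\<close> from the mixed term, \<open>2 * K\<close> from the squared velocity term.
  Weighting \<open>E\<close> by a decaying or a growing exponential gives monotone functions, so the
  estimate also runs backwards in time. Squares keep \<open>E\<close> differentiable where the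
  solutions meet.\<close>

lemma gronwall_second_order:
  fixes u1 v1 w1 u2 v2 w2 :: "real \<Rightarrow> 'e::real_inner"
  assumes u: "\<And>t. t \<in> {p..q} \<Longrightarrow> (u1 has_vector_derivative v1 t) (at t within {p..q})"
      "\<And>t. t \<in> {p..q} \<Longrightarrow> (u2 has_vector_derivative v2 t) (at t within {p..q})"
    and v: "\<And>t. t \<in> {p..q} \<Longrightarrow> (v1 has_vector_derivative w1 t) (at t within {p..q})"
      "\<And>t. t \<in> {p..q} \<Longrightarrow> (v2 has_vector_derivative w2 t) (at t within {p..q})"
    and w: "\<And>t. t \<in> {p..q} \<Longrightarrow> norm (w1 t - w2 t) \<le> K * (norm (u1 t - u2 t) + norm (v1 t - v2 t))"
    and K: "K \<ge> 0" and t: "t1 \<in> {p..q}" "t2 \<in> {p..q}"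
  shows "(norm (u1 t2 - u2 t2))\<^sup>2 + (norm (v1 t2 - v2 t2))\<^sup>2
    \<le> exp ((1 + 3 * K) * \<bar>t2 - t1\<bar>) * ((norm (u1 t1 - u2 t1))\<^sup>2 + (norm (v1 t1 - v2 t1))\<^sup>2)"
proof -
  define E where "E t = (norm (u1 t - u2 t))\<^sup>2 + (norm (v1 t - v2 t))\<^sup>2" for t
  define E' where "E' t = 2 * ((u1 t - u2 t) \<bullet> (v1 t - v2 t)) + 2 * ((v1 t - v2 t) \<bullet> (w1 t - w2 t))" for t
  define L where "L = 1 + 3 * K"
  have dE: "(E has_real_derivative E' t) (at t within {p..q})" if "t \<in> {p..q}" for t
    unfolding E_def E'_def power2_norm_eq_inner has_real_derivative_iff_has_vector_derivative
      has_vector_derivative_def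
    by (rule derivative_eq_intros u[OF that, unfolded has_vector_derivative_def]
          v[OF that, unfolded has_vector_derivative_def] refl)+
      (auto simp: fun_eq_iff algebra_simps inner_commute)
  have E'b: "\<bar>E' t\<bar> \<le> L * E t" if t: "t \<in> {p..q}" for t
  proof -
    define x where "x = norm (u1 t - u2 t)"
    define y where "y = norm (v1 t - v2 t)"
    have xy: "x \<ge> 0" "y \<ge> 0" unfolding x_def y_def by auto
    have "\<bar>E' t\<bar> \<le> 2 * \<bar>(u1 t - u2 t) \<bullet> (v1 t - v2 t)\<bar> + 2 * \<bar>(v1 t - v2 t) \<bullet> (w1 t - w2 t)\<bar>"
      unfolding E'_def by linarith
    also have "\<dots> \<le> 2 * (x * y) + 2 * (y * (K * (x + y)))"
    proof -
      have "\<bar>(u1 t - u2 t) \<bullet> (v1 t - v2 t)\<bar> \<le> x * y"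
        unfolding x_def y_def by (rule Cauchy_Schwarz_ineq2)
      moreover have "\<bar>(v1 t - v2 t) \<bullet> (w1 t - w2 t)\<bar> \<le> y * norm (w1 t - w2 t)"
        unfolding y_def by (rule Cauchy_Schwarz_ineq2)
      moreover have "y * norm (w1 t - w2 t) \<le> y * (K * (x + y))"
        using w[OF t] xy by (intro mult_left_mono) (auto simp: x_def y_def)
      ultimately show ?thesis by linarith
    qed
    also have "\<dots> \<le> L * E t"
    proof -
      have a: "2 * (x * y) \<le> x\<^sup>2 + y\<^sup>2" using sum_squares_bound[of x y] by simp
      have "K * (2 * (x * y)) \<le> K * (x\<^sup>2 + y\<^sup>2)" "0 \<le> K * x\<^sup>2" using a K by (auto intro: mult_left_mono)
      then show ?thesis
        unfolding L_def E_def x_def[symmetric] y_def[symmetric] using a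
        by (simp add: algebra_simps power2_eq_square)
    qed
    finally show ?thesis .
  qed
  \<comment> \<open>Derivatives are taken within the closed interval; the mean value theorem uses
    them at interior points, where they are two-sided.\<close>
  have mono: "F b - F a \<le> 0" if ab: "p \<le> a" "a \<le> b" "b \<le> q"
    and dF: "\<And>t. t \<in> {p..q} \<Longrightarrow> (F has_real_derivative F' t) (at t within {p..q})"
    and F': "\<And>t. t \<in> {p..q} \<Longrightarrow> F' t \<le> 0" for F F' :: "real \<Rightarrow> real" and a b
  proof -
    have "\<exists>x\<in>{a..b}. F b - F a = (b - a) * F' x"
    proof (cases "a < b")
      case True
      have cont: "continuous_on {a..b} F"
        using dF ab by (intro continuous_on_subset[OF DERIV_continuous_on[of "{p..q}"]]) auto
      have "(F has_derivative (*) (F' x)) (at x)" if "a < x" "x < b" for x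
        using dF[of x] ab that at_within_interior[of x "{p..q}"]
        by (auto simp: has_field_derivative_def)
      from mvt[OF True cont this] obtain x where "a < x" "x < b" "F b - F a = F' x * (b - a)"
        by blast
      then show ?thesis by (auto intro!: bexI[of _ x] simp: mult.commute)
    qed (use ab in auto)
    then show ?thesis
      using F' ab by (smt (verit) atLeastAtMost_iff mult_nonneg_nonpos)
  qed
  have up: "E b \<le> exp (L * (b - a)) * E a" if ab: "p \<le> a" "a \<le> b" "b \<le> q" for a b
  proof -
    have "E b * exp (- L * b) - E a * exp (- L * a) \<le> 0"
    proof (rule mono[OF ab])
      fix t assume t: "t \<in> {p..q}"
      show "((\<lambda>t. E t * exp (- L * t)) has_real_derivative (E' t - L * E t) * exp (- L * t)) (at t within {p..q})"
        by (rule derivative_eq_intros dE[OF t] refl)+ (simp add: algebra_simps)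
      show "(E' t - L * E t) * exp (- L * t) \<le> 0"
        using E'b[OF t] by (intro mult_nonpos_nonneg) auto
    qed
    then have "E b * exp (- L * b) * exp (L * b) \<le> E a * exp (- L * a) * exp (L * b)"
      by (intro mult_right_mono) auto
    then show ?thesis by (simp add: mult.assoc exp_add[symmetric] algebra_simps)
  qed
  have down: "E a \<le> exp (L * (b - a)) * E b" if ab: "p \<le> a" "a \<le> b" "b \<le> q" for a b
  proof -
    have "- (E b * exp (L * b)) - (- (E a * exp (L * a))) \<le> 0"
    proof (rule mono[OF ab])
      fix t assume t: "t \<in> {p..q}"
      show "((\<lambda>t. - (E t * exp (L * t))) has_real_derivative - ((E' t + L * E t) * exp (L * t))) (at t within {p..q})"
        by (rule derivative_eq_intros dE[OF t] refl)+ (simp add: algebra_simps)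
      show "- ((E' t + L * E t) * exp (L * t)) \<le> 0"
        using E'b[OF t] by (simp add: abs_le_iff)
    qed
    then have "E a * exp (L * a) * exp (- L * a) \<le> E b * exp (L * b) * exp (- L * a)"
      by (intro mult_right_mono) auto
    then show ?thesis by (simp add: mult.assoc exp_add[symmetric] algebra_simps)
  qed
  show ?thesis
    unfolding E_def[symmetric] L_def[symmetric]
    using up[of t1 t2] down[of t2 t1] t by (cases "t1 \<le> t2") auto
qed

section \<open>Metric and connection in a chart\<close>

lemma bilinear_basis_expansion:
  fixes B :: "'e::euclidean_space \<Rightarrow> 'e \<Rightarrow> real"
  assumes "bilinear B"
  shows "B a b = (\<Sum>i\<in>Basis. \<Sum>j\<in>Basis. (a \<bullet> i) * (b \<bullet> j) * B i j)"
proof -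
  have l: "linear (\<lambda>a. B a b)" "linear (B a)" for a b
    using assms by (auto simp: bilinear_def)
  have "B a b = B (\<Sum>i\<in>Basis. (a \<bullet> i) *\<^sub>R i) (\<Sum>j\<in>Basis. (b \<bullet> j) *\<^sub>R j)"
    by (simp only: euclidean_representation)
  also have "\<dots> = (\<Sum>i\<in>Basis. (a \<bullet> i) * B i (\<Sum>j\<in>Basis. (b \<bullet> j) *\<^sub>R j))"
    by (subst linear_sum[OF l(1)]) (simp add: linear_scale[OF l(1)] del: euclidean_representation)
  also have "\<dots> = (\<Sum>i\<in>Basis. \<Sum>j\<in>Basis. (a \<bullet> i) * (b \<bullet> j) * B i j)"
    by (intro sum.cong refl) (simp add: linear_sum[OF l(2)] linear_scale[OF l(2)] sum_distrib_left mult.assoc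
        del: euclidean_representation)
  finally show ?thesis .
qed

lemma basis_sum_bound2:
  fixes a b :: "'e::euclidean_space" and T :: "'e \<Rightarrow> 'e \<Rightarrow> real" and \<beta> :: real
  assumes "\<And>i j. i \<in> Basis \<Longrightarrow> j \<in> Basis \<Longrightarrow> \<bar>T i j\<bar> \<le> \<beta>" "\<beta> \<ge> 0"
  shows "\<bar>\<Sum>i\<in>Basis. \<Sum>j\<in>Basis. (a \<bullet> i) * (b \<bullet> j) * T i j\<bar> \<le> DIM('e)^2 * \<beta> * norm a * norm b"
proof -
  have "\<bar>\<Sum>i\<in>Basis. \<Sum>j\<in>Basis. (a \<bullet> i) * (b \<bullet> j) * T i j\<bar>
      \<le> (\<Sum>i\<in>(Basis::'e set). \<Sum>j\<in>(Basis::'e set). norm a * norm b * \<beta>)"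
    by (rule order_trans[OF sum_abs sum_mono] order_trans[OF sum_abs sum_mono])+
      (unfold abs_mult, intro mult_mono Basis_le_norm assms, auto)
  then show ?thesis by (simp add: power2_eq_square mult_ac)
qed

lemma basis_sum_bound3:
  fixes a b v :: "'e::euclidean_space" and T :: "'e \<Rightarrow> 'e \<Rightarrow> 'e \<Rightarrow> real" and \<beta> :: real
  assumes "\<And>i j k. i \<in> Basis \<Longrightarrow> j \<in> Basis \<Longrightarrow> k \<in> Basis \<Longrightarrow> \<bar>T i j k\<bar> \<le> \<beta>" "\<beta> \<ge> 0"
  shows "\<bar>\<Sum>i\<in>Basis. \<Sum>j\<in>Basis. (a \<bullet> i) * (b \<bullet> j) * (\<Sum>k\<in>Basis. (v \<bullet> k) * T i j k)\<bar>
    \<le> DIM('e)^2 * (DIM('e) * \<beta> * norm v) * norm a * norm b"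
proof (rule basis_sum_bound2)
  fix i j :: 'e assume ij: "i \<in> Basis" "j \<in> Basis"
  have "\<bar>\<Sum>k\<in>Basis. (v \<bullet> k) * T i j k\<bar> \<le> (\<Sum>k\<in>(Basis::'e set). norm v * \<beta>)"
    by (rule order_trans[OF sum_abs sum_mono])
      (unfold abs_mult, intro mult_mono Basis_le_norm assms ij, auto)
  then show "\<bar>\<Sum>k\<in>Basis. (v \<bullet> k) * T i j k\<bar> \<le> DIM('e) * \<beta> * norm v" by (simp add: mult_ac)
qed (use assms(2) in auto)

text \<open>The minimum over the compact unit sphere is positive and extends by homogeneity.\<close>

lemma inner_product_lower_bound:
  fixes B :: "'e::euclidean_space \<Rightarrow> 'e \<Rightarrow> real"
  assumes "inner_product B"
  obtains m where "m > 0" "\<And>a. m * (norm a)\<^sup>2 \<le> B a a"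
proof -
  have bil: "bilinear B" and pos: "\<And>a. a \<noteq> 0 \<Longrightarrow> 0 < B a a"
    using assms by (auto simp: inner_product_def)
  have "continuous_on (sphere 0 1) (\<lambda>a. B a a)"
    unfolding bilinear_basis_expansion[OF bil, of a a for a] by (intro continuous_intros)
  moreover have "sphere (0::'e) 1 \<noteq> {}" by simp
  ultimately obtain a0 where a0: "a0 \<in> sphere 0 1" "\<And>a. a \<in> sphere 0 1 \<Longrightarrow> B a0 a0 \<le> B a a"
    using continuous_attains_inf[OF compact_sphere, of 0 1 "\<lambda>a. B a a"] by blast
  have "B a0 a0 * (norm a)\<^sup>2 \<le> B a a" for a
  proof (cases "a = 0")
    case True
    then show ?thesis using bilinear_lzero[OF bil] by simp
  next
    case False
    define e where "e = a /\<^sub>R norm a"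
    have e: "e \<in> sphere 0 1" "a = norm a *\<^sub>R e" using False by (auto simp: e_def)
    have "B a a = B (norm a *\<^sub>R e) (norm a *\<^sub>R e)"
      by (rule arg_cong2[where f=B]) (rule e(2))+
    also have "\<dots> = (norm a)\<^sup>2 * B e e"
      by (simp add: bilinear_lmul[OF bil] bilinear_rmul[OF bil] power2_eq_square)
    finally have "B a a = (norm a)\<^sup>2 * B e e" .
    then show ?thesis using mult_right_mono[OF a0(2)[OF e(1)], of "(norm a)\<^sup>2"] by (simp add: mult.commute)
  qed
  moreover have "B a0 a0 > 0" by (rule pos) (use a0(1) in auto)
  ultimately show ?thesis using that by blast
qed

text \<open>Positivity makes the map from \<open>w\<close> to its products with the basis injective,
  hence surjective in finite dimension. This is what gives the definite description in
  \<open>christoffel\<close> a meaning.\<close>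

lemma inner_product_Riesz:
  fixes B :: "'e::euclidean_space \<Rightarrow> 'e \<Rightarrow> real"
  assumes "inner_product B" "linear \<phi>"
  shows "\<exists>!w. \<forall>z. B w z = \<phi> z"
proof -
  have bil: "bilinear B" and pos: "\<And>a. a \<noteq> 0 \<Longrightarrow> 0 < B a a"
    using assms by (auto simp: inner_product_def)
  have l: "linear (\<lambda>a. B a b)" "linear (B a)" for a b
    using bil by (auto simp: bilinear_def)
  define F where "F w = (\<Sum>i\<in>Basis. B w i *\<^sub>R i)" for w
  have Fi: "F w \<bullet> i = B w i" if "i \<in> Basis" for w i
    unfolding F_def using that by (simp add: inner_sum_left_Basis)
  have linF: "linear F"
    by (rule linearI; rule euclidean_eqI)
      (simp_all add: Fi inner_add_left linear_add[OF l(1)] linear_scale[OF l(1)])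
  have ext: "B w = \<psi>" if "linear \<psi>" "\<And>i. i \<in> Basis \<Longrightarrow> B w i = \<psi> i" for w \<psi>
    by (rule linear_eq_on_span[of "B w" \<psi> Basis, THEN ext]) (use that l in auto)
  have inj: "w = 0" if "F w = 0" for w
  proof -
    have "B w = (\<lambda>_. 0)"
      by (rule ext) (use Fi[of _ w] that in \<open>auto intro: linear_zero\<close>)
    then show ?thesis using pos[of w] by (metis less_irrefl)
  qed
  then have "inj F" using linear_injective_0[OF linF] by blast
  then obtain w where w: "F w = (\<Sum>i\<in>Basis. \<phi> i *\<^sub>R i)"
    using linear_injective_imp_surjective[OF linF] by (metis surj_def)
  have "B w = \<phi>"
    by (rule ext[OF assms(2)]) (metis Fi w inner_sum_left_Basis)
  moreover have "w' = w" if "\<forall>z. B w' z = \<phi> z" for w'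
  proof -
    have "B (w' - w) z = 0" for z
      using that \<open>B w = \<phi>\<close> linear_diff[OF l(1)] by simp
    then show ?thesis using pos[of "w' - w"] by (metis less_irrefl right_minus_eq)
  qed
  ultimately show ?thesis by blast
qed

section \<open>Charts, changes of coordinates and the metric in a chart\<close>

locale riemannian_mfd =
  fixes M :: "('m::{second_countable_topology, t2_space}, 'e::euclidean_space) riemannian"
  assumes riemannian_manifold: "riemannian_manifold M"
begin

lemma open_cdom: "c \<in> atlas M \<Longrightarrow> open (cdom c)"
  and open_cmap_image: "c \<in> atlas M \<Longrightarrow> open (cmap c ` cdom c)"
  and chart_homeomorphism: "c \<in> atlas M \<Longrightarrow> homeomorphism (cdom c) (cmap c ` cdom c) (cmap c) (cinv c)"
  and transition_smooth: "c \<in> atlas M \<Longrightarrow> c' \<in> atlas M \<Longrightarrow>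
    Ck_on k (cmap c ` (cdom c \<inter> cdom c')) (cmap c' \<circ> cinv c)"
  and metric_in_smooth: "c \<in> atlas M \<Longrightarrow> Ck_on k (cmap c ` cdom c) (\<lambda>u. metric_in M c u a b)"
  and inner_product_rmetric: "inner_product (rmetric M x)"
  using riemannian_manifold unfolding riemannian_manifold_def smooth_on_def by blast+

lemma chart_at: "chart_at M x \<in> atlas M" "x \<in> cdom (chart_at M x)"
proof -
  have "\<exists>c. c \<in> atlas M \<and> x \<in> cdom c"
    using riemannian_manifold unfolding riemannian_manifold_def by blast
  from someI_ex[OF this] show "chart_at M x \<in> atlas M" "x \<in> cdom (chart_at M x)"
    unfolding chart_at_def by auto
qed

context
  fixes c assumes c: "c \<in> atlas M"
begin

lemma cinv_cmap: "x \<in> cdom c \<Longrightarrow> cinv c (cmap c x) = x"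
  and cmap_cinv: "u \<in> cmap c ` cdom c \<Longrightarrow> cmap c (cinv c u) = u"
  and cinv_in: "u \<in> cmap c ` cdom c \<Longrightarrow> cinv c u \<in> cdom c"
  and continuous_cmap: "continuous_on (cdom c) (cmap c)"
  and continuous_cinv: "continuous_on (cmap c ` cdom c) (cinv c)"
  using chart_homeomorphism[OF c] by (auto simp: homeomorphism_def)

lemma tendsto_cmap:
  assumes "(X \<longlongrightarrow> x) F" "x \<in> cdom c"
  shows "((\<lambda>i. cmap c (X i)) \<longlongrightarrow> cmap c x) F"
  using continuous_cmap open_cdom[OF c] assms
  by (metis continuous_on_eq_continuous_at isCont_tendsto_compose)

lemma tendsto_cinv:
  assumes "(X \<longlongrightarrow> u) F" "u \<in> cmap c ` cdom c"
  shows "((\<lambda>i. cinv c (X i)) \<longlongrightarrow> cinv c u) F"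
  using continuous_cinv open_cmap_image[OF c] assms
  by (metis continuous_on_eq_continuous_at isCont_tendsto_compose)

lemma open_chart_preimage:
  assumes "open U"
  shows "open {x \<in> cdom c. cmap c x \<in> U}"
  using continuous_open_preimage[OF continuous_cmap open_cdom[OF c] assms]
  by (simp add: vimage_def Int_def)

lemma open_cmap_Int: "open U \<Longrightarrow> open (cmap c ` (cdom c \<inter> U))"
proof -
  assume U: "open U"
  have "cmap c ` (cdom c \<inter> U) = cmap c ` cdom c \<inter> cinv c -` U"
    using cinv_cmap cinv_in cmap_cinv by (auto simp: image_iff)
  then show ?thesis
    using continuous_open_preimage[OF continuous_cinv open_cmap_image[OF c] U] by simp
qed

lemma transition_derivative:
  assumes c': "c' \<in> atlas M" and x: "x \<in> cdom c" "x \<in> cdom c'"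
  shows "(cmap c' \<circ> cinv c has_derivative coord_change c c' x) (at (cmap c x))"
proof -
  let ?S = "cmap c ` (cdom c \<inter> cdom c')"
  have S: "open ?S" "cmap c x \<in> ?S" using open_cmap_Int[OF open_cdom[OF c']] x by auto
  have "(cmap c' \<circ> cinv c) differentiable (at (cmap c x) within ?S)"
    using transition_smooth[OF c c', of "Suc 0"] S(2) by (simp only: Ck_on.simps)
  then show ?thesis
    unfolding coord_change_def at_within_open[OF S(2,1)] using frechet_derivative_works by blast
qed

lemma coord_change_linear:
  assumes c': "c' \<in> atlas M" and x: "x \<in> cdom c" "x \<in> cdom c'"
  shows "linear (coord_change c c' x)"
  using transition_derivative[OF assms] has_derivative_linear by blast

text \<open>Smoothness of the transition map gives continuity of its derivative in each fixed
  direction; linearity and a basis expansion upgrade this to joint continuity in base point and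
  vector.\<close>

lemma tendsto_coord_change:
  assumes c': "c' \<in> atlas M" and x: "x \<in> cdom c" "x \<in> cdom c'"
    and X: "(X \<longlongrightarrow> x) F" and V: "(V \<longlongrightarrow> v) F"
  shows "((\<lambda>i. coord_change c c' (X i) (V i)) \<longlongrightarrow> coord_change c c' x v) F"
proof -
  let ?S = "cmap c ` (cdom c \<inter> cdom c')"
  have S: "open ?S" "cmap c x \<in> ?S" using open_cmap_Int[OF open_cdom[OF c']] x by auto
  have expand: "coord_change c c' y w = (\<Sum>b\<in>Basis. (w \<bullet> b) *\<^sub>R coord_change c c' y b)"
    if "y \<in> cdom c" "y \<in> cdom c'" for y w
    using linear_sum[OF coord_change_linear[OF c' that], of "\<lambda>b. (w \<bullet> b) *\<^sub>R b" Basis]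
      linear_scale[OF coord_change_linear[OF c' that]]
    by (simp add: euclidean_representation)
  have "((\<lambda>i. coord_change c c' (X i) b) \<longlongrightarrow> coord_change c c' x b) F" for b
  proof -
    have "continuous_on ?S (\<lambda>p. frechet_derivative (cmap c' \<circ> cinv c) (at p within ?S) b)"
      using transition_smooth[OF c c', of "Suc 0"] by simp
    moreover have "frechet_derivative (cmap c' \<circ> cinv c) (at p within ?S) b =
        frechet_derivative (cmap c' \<circ> cinv c) (at p) b" if "p \<in> ?S" for p
      using at_within_open[OF that S(1)] by metis
    ultimately have "continuous_on ?S (\<lambda>p. frechet_derivative (cmap c' \<circ> cinv c) (at p) b)"
      by (simp cong: continuous_on_cong)
    then have "isCont (\<lambda>p. frechet_derivative (cmap c' \<circ> cinv c) (at p) b) (cmap c x)"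
      using S continuous_on_eq_continuous_at by blast
    then show ?thesis
      unfolding coord_change_def by (rule isCont_tendsto_compose) (rule tendsto_cmap[OF X x(1)])
  qed
  then have "((\<lambda>i. \<Sum>b\<in>Basis. (V i \<bullet> b) *\<^sub>R coord_change c c' (X i) b) \<longlongrightarrow>
      (\<Sum>b\<in>Basis. (v \<bullet> b) *\<^sub>R coord_change c c' x b)) F"
    by (intro tendsto_intros V)
  moreover have "\<forall>\<^sub>F i in F. X i \<in> cdom c \<inter> cdom c'"
    by (rule topological_tendstoD[OF X]) (simp_all add: open_Int open_cdom[OF c] open_cdom[OF c'] x)
  then have "\<forall>\<^sub>F i in F. (\<Sum>b\<in>Basis. (V i \<bullet> b) *\<^sub>R coord_change c c' (X i) b) = coord_change c c' (X i) (V i)"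
    by eventually_elim (rule expand[symmetric], auto)
  ultimately show ?thesis
    unfolding expand[OF x, of v] by (rule Lim_transform_eventually)
qed

end

lemma coord_change_inverse:
  assumes c: "c \<in> atlas M" and c': "c' \<in> atlas M" and x: "x \<in> cdom c" "x \<in> cdom c'"
  shows "coord_change c' c x (coord_change c c' x v) = v"
proof -
  let ?S = "cmap c ` (cdom c \<inter> cdom c')"
  have S: "open ?S" "cmap c x \<in> ?S" using open_cmap_Int[OF c open_cdom[OF c']] x by auto
  have "(cmap c \<circ> cinv c' has_derivative coord_change c' c x) (at ((cmap c' \<circ> cinv c) (cmap c x)))"
    using transition_derivative[OF c' c x(2,1)] cinv_cmap[OF c x(1)] by simp
  from diff_chain_at[OF transition_derivative[OF c c' x] this]
  have "((cmap c \<circ> cinv c') \<circ> (cmap c' \<circ> cinv c) has_derivative coord_change c' c x \<circ> coord_change c c' x)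
      (at (cmap c x))" .
  then have "(id has_derivative coord_change c' c x \<circ> coord_change c c' x) (at (cmap c x))"
    by (rule has_derivative_transform_within_open[OF _ S])
      (auto simp: cinv_cmap[OF c] cinv_cmap[OF c'])
  then have "coord_change c' c x \<circ> coord_change c c' x = id"
    using has_derivative_unique[OF _ has_derivative_id] by (metis id_def)
  then show ?thesis by (metis comp_apply id_apply)
qed

lemma metric_in_commute: "metric_in M c u a b = metric_in M c u b a"
  using inner_product_rmetric unfolding metric_in_def inner_product_def by blast

text \<open>\<open>metric_in\<close> is \<open>rmetric\<close> pulled back along the change to the
  preferred chart. Positivity survives because that change has an inverse, namely the change
  back.\<close>

lemma inner_product_metric_in:
  assumes c: "c \<in> atlas M" and u: "u \<in> cmap c ` cdom c"
  shows "inner_product (metric_in M c u)"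
proof -
  define x where "x = cinv c u"
  define A where "A = coord_change c (chart_at M x) x"
  have x: "x \<in> cdom c" "x \<in> cdom (chart_at M x)"
    using cinv_in[OF c u] chart_at by (auto simp: x_def)
  have A: "linear A" unfolding A_def by (rule coord_change_linear[OF c chart_at(1) x])
  have inj: "A a \<noteq> 0" if "a \<noteq> 0" for a
    using coord_change_inverse[OF c chart_at(1) x, of a] linear_0[OF coord_change_linear[OF chart_at(1) c x(2,1)]] that
    unfolding A_def by metis
  have B: "bilinear (rmetric M x)" "\<And>a. a \<noteq> 0 \<Longrightarrow> 0 < rmetric M x a a"
    using inner_product_rmetric[of x] by (auto simp: inner_product_def)
  have eq: "metric_in M c u = (\<lambda>a b. rmetric M x (A a) (A b))"
    unfolding metric_in_def x_def A_def by simp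
  have "bilinear (metric_in M c u)"
    unfolding eq bilinear_def
    using linear_compose[OF A, of "\<lambda>a. rmetric M x a b" for b] linear_compose[OF A, of "rmetric M x a" for a]
      B(1)[unfolded bilinear_def] by (simp add: comp_def)
  then show ?thesis
    unfolding inner_product_def
  proof (intro conjI allI impI)
    show "metric_in M c u a b = metric_in M c u b a" for a b by (rule metric_in_commute)
    show "0 < metric_in M c u a a" if "a \<noteq> 0" for a
      using that by (simp add: eq B(2) inj)
  qed
qed

lemma bilinear_metric_in:
  "c \<in> atlas M \<Longrightarrow> u \<in> cmap c ` cdom c \<Longrightarrow> bilinear (metric_in M c u)"
  using inner_product_metric_in by (auto simp: inner_product_def)

section \<open>Derivatives of the metric, Koszul form and Christoffel symbols\<close>

definition dmetric :: "('m, 'e) chart \<Rightarrow> 'e \<Rightarrow> 'e \<Rightarrow> 'e \<Rightarrow> 'e \<Rightarrow> real" where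
  "dmetric c u a b = frechet_derivative (\<lambda>p. metric_in M c p a b) (at u)"

text \<open>The Christoffel symbol of the first kind. It is linear in the derivatives of the metric,
  so its bounds follow directly from smoothness, whereas \<open>christoffel\<close> involves the
  inverse of the metric.\<close>

definition koszul :: "('m, 'e) chart \<Rightarrow> 'e \<Rightarrow> 'e \<Rightarrow> 'e \<Rightarrow> 'e \<Rightarrow> real" where
  "koszul c u a b z = (dmetric c u b z a + dmetric c u a z b - dmetric c u a b z) / 2"

context
  fixes c assumes c: "c \<in> atlas M"
begin

lemma metric_in_has_derivative:
  assumes u: "u \<in> cmap c ` cdom c"
  shows "((\<lambda>p. metric_in M c p a b) has_derivative dmetric c u a b) (at u)"
proof -
  have "(\<lambda>p. metric_in M c p a b) differentiable (at u within cmap c ` cdom c)"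
    using metric_in_smooth[OF c, of "Suc 0" a b] u by (simp only: Ck_on.simps)
  then show ?thesis
    unfolding dmetric_def at_within_open[OF u open_cmap_image[OF c]] using frechet_derivative_works by blast
qed

lemma linear_dmetric: "u \<in> cmap c ` cdom c \<Longrightarrow> linear (dmetric c u a b)"
  using metric_in_has_derivative has_derivative_linear by blast

text \<open>Bilinearity in \<open>a\<close> and \<open>b\<close> is not visible in a derivative
  taken for fixed \<open>a\<close> and \<open>b\<close>; it is inherited by differentiating the
  basis expansion, whose coefficients do not depend on the base point.\<close>

lemma dmetric_expand:
  assumes u: "u \<in> cmap c ` cdom c"
  shows "dmetric c u a b v = (\<Sum>i\<in>Basis. \<Sum>j\<in>Basis. (a \<bullet> i) * (b \<bullet> j) * dmetric c u i j v)"
proof -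
  have "((\<lambda>p. \<Sum>i\<in>Basis. \<Sum>j\<in>Basis. (a \<bullet> i) * (b \<bullet> j) * metric_in M c p i j) has_derivative
      (\<lambda>v. \<Sum>i\<in>Basis. \<Sum>j\<in>Basis. (a \<bullet> i) * (b \<bullet> j) * dmetric c u i j v)) (at u)"
    by (intro has_derivative_sum has_derivative_mult_right metric_in_has_derivative[OF u])
  then have "((\<lambda>p. metric_in M c p a b) has_derivative
      (\<lambda>v. \<Sum>i\<in>Basis. \<Sum>j\<in>Basis. (a \<bullet> i) * (b \<bullet> j) * dmetric c u i j v)) (at u)"
    by (rule has_derivative_transform_within_open[OF _ open_cmap_image[OF c] u])
      (rule bilinear_basis_expansion[OF bilinear_metric_in[OF c], symmetric])
  from has_derivative_unique[OF metric_in_has_derivative[OF u] this] show ?thesis by metis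
qed

lemma dmetric_expand3:
  assumes u: "u \<in> cmap c ` cdom c"
  shows "dmetric c u a b v =
    (\<Sum>i\<in>Basis. \<Sum>j\<in>Basis. (a \<bullet> i) * (b \<bullet> j) * (\<Sum>k\<in>Basis. (v \<bullet> k) * dmetric c u i j k))"
proof -
  have "dmetric c u i j v = (\<Sum>k\<in>Basis. (v \<bullet> k) * dmetric c u i j k)" for i j
    using linear_sum[OF linear_dmetric[OF u], of i j "\<lambda>b. (v \<bullet> b) *\<^sub>R b" Basis]
      linear_scale[OF linear_dmetric[OF u]]
    by (simp add: euclidean_representation)
  then show ?thesis by (subst dmetric_expand[OF u]) simp
qed

lemma dmetric_commute: "dmetric c u a b = dmetric c u b a"
  unfolding dmetric_def using metric_in_commute by metis

lemma dmetric_add_left: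
    "u \<in> cmap c ` cdom c \<Longrightarrow> dmetric c u (a + a') b v = dmetric c u a b v + dmetric c u a' b v"
  and dmetric_scale_left: "u \<in> cmap c ` cdom c \<Longrightarrow> dmetric c u (r *\<^sub>R a) b v = r * dmetric c u a b v"
proof -
  assume u: "u \<in> cmap c ` cdom c"
  note * = dmetric_expand[OF u, of a b v] dmetric_expand[OF u, of a' b v]
  show "dmetric c u (a + a') b v = dmetric c u a b v + dmetric c u a' b v"
    by (subst *, subst *(2), subst dmetric_expand[OF u]) (simp add: algebra_simps sum.distrib)
next
  assume u: "u \<in> cmap c ` cdom c"
  show "dmetric c u (r *\<^sub>R a) b v = r * dmetric c u a b v"
    by (subst dmetric_expand[OF u, of a b v], subst dmetric_expand[OF u]) (simp add: algebra_simps sum_distrib_left)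
qed

lemma koszul_add:
  assumes u: "u \<in> cmap c ` cdom c"
  shows "koszul c u (a + a') b z = koszul c u a b z + koszul c u a' b z"
    "koszul c u a (b + b') z = koszul c u a b z + koszul c u a b' z"
    "koszul c u a b (z + z') = koszul c u a b z + koszul c u a b z'"
    "koszul c u a b (r *\<^sub>R z) = r * koszul c u a b z"
    "koszul c u (r *\<^sub>R a) b z = r * koszul c u a b z"
    "koszul c u a (r *\<^sub>R b) z = r * koszul c u a b z"
proof -
  note l = dmetric_add_left[OF u] dmetric_scale_left[OF u]
  have r: "dmetric c u a (b + b') v = dmetric c u a b v + dmetric c u a b' v"
    "dmetric c u a (r *\<^sub>R b) v = r * dmetric c u a b v" for a b b' v r
    using l dmetric_commute by metis+
  note s = linear_add[OF linear_dmetric[OF u]] linear_scale[OF linear_dmetric[OF u]]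
  show "koszul c u (a + a') b z = koszul c u a b z + koszul c u a' b z"
    "koszul c u a (b + b') z = koszul c u a b z + koszul c u a b' z"
    "koszul c u a b (z + z') = koszul c u a b z + koszul c u a b z'"
    "koszul c u a b (r *\<^sub>R z) = r * koszul c u a b z"
    "koszul c u (r *\<^sub>R a) b z = r * koszul c u a b z"
    "koszul c u a (r *\<^sub>R b) z = r * koszul c u a b z"
    unfolding koszul_def by (simp_all add: l r s field_simps)
qed

lemma metric_in_christoffel_iff:
  assumes u: "u \<in> cmap c ` cdom c"
  shows "w = christoffel M c u a b \<longleftrightarrow> (\<forall>z. metric_in M c u w z = koszul c u a b z)"
proof -
  have "linear (koszul c u a b)"
    by (rule linearI) (simp_all add: koszul_add[OF u])
  from inner_product_Riesz[OF inner_product_metric_in[OF c u] this]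
  have ex: "\<exists>!w. \<forall>z. metric_in M c u w z = koszul c u a b z" .
  have "christoffel M c u a b = (THE w. \<forall>z. metric_in M c u w z = koszul c u a b z)"
    unfolding christoffel_def koszul_def dmetric_def by simp
  then show ?thesis using theI'[OF ex] ex by metis
qed

text \<open>The quadratic homogeneity that makes affine reparametrizations of geodesics
  geodesics.\<close>

lemma christoffel_scale:
  assumes u: "u \<in> cmap c ` cdom c"
  shows "christoffel M c u (r *\<^sub>R a) (r *\<^sub>R a) = r\<^sup>2 *\<^sub>R christoffel M c u a a"
proof -
  have "metric_in M c u (christoffel M c u a a) z = koszul c u a a z" for z
    using metric_in_christoffel_iff[OF u] by blast
  then have "r\<^sup>2 *\<^sub>R christoffel M c u a a = christoffel M c u (r *\<^sub>R a) (r *\<^sub>R a)"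
    using bilinear_metric_in[OF c u]
    by (subst metric_in_christoffel_iff[OF u])
      (simp add: koszul_add[OF u] bilinear_lmul power2_eq_square)
  then show ?thesis by simp
qed

text \<open>Collects on one coordinate ball what the local estimate for the geodesic equation uses.
  Coefficients are estimated on a larger ball first; the radius then shrinks until the metric varies
  by at most half of its lower bound at the centre.\<close>

lemma chart_estimates:
  assumes u0: "u0 \<in> cmap c ` cdom c"
  obtains \<rho> m B where "\<rho> > 0" "m > 0" "B \<ge> 0" "cball u0 \<rho> \<subseteq> cmap c ` cdom c"
    "\<And>u a. u \<in> cball u0 \<rho> \<Longrightarrow> m * (norm a)\<^sup>2 \<le> metric_in M c u a a"
    "\<And>u u' a b. u \<in> cball u0 \<rho> \<Longrightarrow> u' \<in> cball u0 \<rho> \<Longrightarrow>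
      \<bar>metric_in M c u a b - metric_in M c u' a b\<bar> \<le> B * norm (u - u') * norm a * norm b"
    "\<And>u u' a b z. u \<in> cball u0 \<rho> \<Longrightarrow> u' \<in> cball u0 \<rho> \<Longrightarrow>
      \<bar>koszul c u a b z - koszul c u' a b z\<bar> \<le> B * norm (u - u') * norm a * norm b * norm z"
    "\<And>u a b z. u \<in> cball u0 \<rho> \<Longrightarrow> \<bar>koszul c u a b z\<bar> \<le> B * norm a * norm b * norm z"
proof -
  let ?im = "cmap c ` cdom c"
  obtain \<rho>0 where \<rho>0: "\<rho>0 > 0" "cball u0 \<rho>0 \<subseteq> ?im"
    using open_contains_cball[of ?im] open_cmap_image[OF c] u0 by blast
  obtain m where m: "m > 0" "\<And>a. m * (norm a)\<^sup>2 \<le> metric_in M c u0 a a"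
    by (rule inner_product_lower_bound[OF inner_product_metric_in[OF c u0]]) (rule that)
  have "\<exists>B\<ge>0. \<forall>u\<in>cball u0 \<rho>0. \<forall>u'\<in>cball u0 \<rho>0. \<bar>metric_in M c u i j - metric_in M c u' i j\<bar> \<le> B * norm (u - u')" for i j
    by (rule Ck_on_imp_Lipschitz_cball[OF metric_in_smooth[OF c, of "Suc 0" i j] open_cmap_image[OF c] \<rho>0(2)]) blast
  then obtain B1 where B1: "\<And>i j. B1 i j \<ge> 0" "\<And>u u' i j. u \<in> cball u0 \<rho>0 \<Longrightarrow> u' \<in> cball u0 \<rho>0 \<Longrightarrow>
      \<bar>metric_in M c u i j - metric_in M c u' i j\<bar> \<le> B1 i j * norm (u - u')"
    by metis
  have Cd: "Ck_on (Suc 0) ?im (\<lambda>p. dmetric c p i j k)" for i j k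
  proof -
    have "Ck_on (Suc 0) ?im (\<lambda>p. frechet_derivative (\<lambda>p. metric_in M c p i j) (at p within ?im) k)"
      using metric_in_smooth[OF c, of "Suc (Suc 0)" i j] by (simp only: Ck_on.simps) blast
    then show ?thesis
      by (rule Ck_on_cong[THEN iffD1, rotated])
        (metis at_within_open dmetric_def open_cmap_image[OF c])
  qed
  have "\<exists>B\<ge>0. (\<forall>u\<in>cball u0 \<rho>0. \<forall>u'\<in>cball u0 \<rho>0. \<bar>dmetric c u i j k - dmetric c u' i j k\<bar> \<le> B * norm (u - u'))
     \<and> (\<forall>u\<in>cball u0 \<rho>0. \<bar>dmetric c u i j k\<bar> \<le> B)" for i j k
    by (rule Ck_on_imp_Lipschitz_cball[OF Cd open_cmap_image[OF c] \<rho>0(2)]) blast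
  then obtain B2 where B2: "\<And>i j k. B2 i j k \<ge> 0" "\<And>u u' i j k. u \<in> cball u0 \<rho>0 \<Longrightarrow> u' \<in> cball u0 \<rho>0 \<Longrightarrow>
      \<bar>dmetric c u i j k - dmetric c u' i j k\<bar> \<le> B2 i j k * norm (u - u')"
     "\<And>u i j k. u \<in> cball u0 \<rho>0 \<Longrightarrow> \<bar>dmetric c u i j k\<bar> \<le> B2 i j k"
    by metis
  define S where "S = (\<Sum>i\<in>Basis. \<Sum>j\<in>Basis. B1 i j) + (\<Sum>i\<in>Basis. \<Sum>j\<in>Basis. \<Sum>k\<in>Basis. B2 i j k)"
  have S0: "S \<ge> 0" unfolding S_def by (intro add_nonneg_nonneg sum_nonneg B1 B2)
  have S1: "B1 i j \<le> S" if "i \<in> Basis" "j \<in> Basis" for i j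
  proof -
    have "B1 i j \<le> (\<Sum>j\<in>Basis. B1 i j)" by (rule member_le_sum) (use that B1 in auto)
    also have "\<dots> \<le> (\<Sum>i\<in>Basis. \<Sum>j\<in>Basis. B1 i j)"
      by (rule member_le_sum[of i Basis "\<lambda>i. \<Sum>j\<in>Basis. B1 i j"]) (use that B1 in \<open>auto intro: sum_nonneg\<close>)
    also have "\<dots> \<le> S" unfolding S_def using B2(1) by (simp add: sum_nonneg)
    finally show ?thesis .
  qed
  have S2: "B2 i j k \<le> S" if "i \<in> Basis" "j \<in> Basis" "k \<in> Basis" for i j k
  proof -
    have "B2 i j k \<le> (\<Sum>k\<in>Basis. B2 i j k)" by (rule member_le_sum) (use that B2 in auto)
    also have "\<dots> \<le> (\<Sum>j\<in>Basis. \<Sum>k\<in>Basis. B2 i j k)"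
      by (rule member_le_sum[of j Basis "\<lambda>j. \<Sum>k\<in>Basis. B2 i j k"]) (use that B2 in \<open>auto intro: sum_nonneg\<close>)
    also have "\<dots> \<le> (\<Sum>i\<in>Basis. \<Sum>j\<in>Basis. \<Sum>k\<in>Basis. B2 i j k)"
      by (rule member_le_sum[of i Basis "\<lambda>i. \<Sum>j\<in>Basis. \<Sum>k\<in>Basis. B2 i j k"]) (use that B2 in \<open>auto intro!: sum_nonneg\<close>)
    also have "\<dots> \<le> S" unfolding S_def using B1(1) by (simp add: sum_nonneg)
    finally show ?thesis .
  qed
  define N where "N = real DIM('e)"
  have N: "N \<ge> 1" unfolding N_def using DIM_positive[where 'a='e] by (simp add: Suc_leI)
  \<comment> \<open>Two factors \<open>N\<close> come from the sums over the two vector slots, the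
    third from the direction of differentiation. As \<open>N \<ge> 1\<close>, \<open>D\<close> also
    dominates the two-index bound for the metric itself.\<close>
  define D where "D = N ^ 2 * (N * S)"
  have D0: "D \<ge> 0" unfolding D_def using S0 N by auto
  have g: "\<bar>metric_in M c u a b - metric_in M c u' a b\<bar> \<le> D * norm (u - u') * norm a * norm b"
    if u: "u \<in> cball u0 \<rho>0" "u' \<in> cball u0 \<rho>0" for u u' a b
  proof -
    have "u \<in> ?im" "u' \<in> ?im" using u \<rho>0 by auto
    then have "metric_in M c u a b - metric_in M c u' a b =
       (\<Sum>i\<in>Basis. \<Sum>j\<in>Basis. (a \<bullet> i) * (b \<bullet> j) * (metric_in M c u i j - metric_in M c u' i j))"
      by (subst (1 2) bilinear_basis_expansion[OF bilinear_metric_in[OF c]])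
        (simp_all add: sum_subtractf right_diff_distrib)
    also have "\<bar>\<dots>\<bar> \<le> DIM('e)^2 * (S * norm (u - u')) * norm a * norm b"
    proof (rule basis_sum_bound2)
      fix i j :: 'e assume "i \<in> Basis" "j \<in> Basis"
      then show "\<bar>metric_in M c u i j - metric_in M c u' i j\<bar> \<le> S * norm (u - u')"
        using B1(2)[OF u] S1 by (meson mult_right_mono norm_ge_zero order_trans)
    qed (use S0 in auto)
    also have "\<dots> \<le> D * norm (u - u') * norm a * norm b"
    proof -
      have "N ^ 2 * (S * norm (u - u')) \<le> D * norm (u - u')"
        using mult_right_mono[OF N, of "N ^ 2 * (S * norm (u - u'))"] S0 N
        unfolding D_def by (simp add: mult_ac)
      then show ?thesis unfolding N_def by (intro mult_right_mono) auto
    qed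
    finally show ?thesis .
  qed
  have d: "\<bar>dmetric c u a b v - dmetric c u' a b v\<bar> \<le> D * norm (u - u') * norm a * norm b * norm v"
    if u: "u \<in> cball u0 \<rho>0" "u' \<in> cball u0 \<rho>0" for u u' a b v
  proof -
    have "u \<in> ?im" "u' \<in> ?im" using u \<rho>0 by auto
    then have "dmetric c u a b v - dmetric c u' a b v =
       (\<Sum>i\<in>Basis. \<Sum>j\<in>Basis. (a \<bullet> i) * (b \<bullet> j) * (\<Sum>k\<in>Basis. (v \<bullet> k) * (dmetric c u i j k - dmetric c u' i j k)))"
      by (subst (1 2) dmetric_expand3)
        (simp_all add: sum_subtractf right_diff_distrib)
    also have "\<bar>\<dots>\<bar> \<le> DIM('e)^2 * (DIM('e) * (S * norm (u - u')) * norm v) * norm a * norm b"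
    proof (rule basis_sum_bound3)
      fix i j k :: 'e assume "i \<in> Basis" "j \<in> Basis" "k \<in> Basis"
      then show "\<bar>dmetric c u i j k - dmetric c u' i j k\<bar> \<le> S * norm (u - u')"
        using B2(2)[OF u] S2 by (meson mult_right_mono norm_ge_zero order_trans)
    qed (use S0 in auto)
    finally show ?thesis unfolding D_def N_def by (simp add: mult_ac)
  qed
  have db: "\<bar>dmetric c u a b v\<bar> \<le> D * norm a * norm b * norm v"
    if u: "u \<in> cball u0 \<rho>0" for u a b v
  proof -
    have "u \<in> ?im" using u \<rho>0 by auto
    then have "dmetric c u a b v =
       (\<Sum>i\<in>Basis. \<Sum>j\<in>Basis. (a \<bullet> i) * (b \<bullet> j) * (\<Sum>k\<in>Basis. (v \<bullet> k) * dmetric c u i j k))"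
      by (rule dmetric_expand3)
    also have "\<bar>\<dots>\<bar> \<le> DIM('e)^2 * (DIM('e) * S * norm v) * norm a * norm b"
      by (rule basis_sum_bound3[OF order_trans[OF B2(3)[OF u] S2] S0])
    finally show ?thesis unfolding D_def N_def by (simp add: mult_ac)
  qed
  \<comment> \<open>The aim is \<open>D * \<rho> \<le> m / 2\<close>; adding 1 to \<open>D\<close>
    keeps the quotient meaningful when \<open>D\<close> is zero.\<close>
  define \<rho> where "\<rho> = min \<rho>0 (m / (2 * (D + 1)))"
  have \<rho>: "\<rho> > 0" "\<rho> \<le> \<rho>0" "D * \<rho> \<le> m / 2"
  proof -
    have "D * \<rho> \<le> D * (m / (2 * (D + 1)))" unfolding \<rho>_def by (intro mult_left_mono D0) auto
    also have "\<dots> \<le> m / 2" using D0 m by (simp add: field_simps)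
    finally show "D * \<rho> \<le> m / 2" .
  qed (use \<rho>0 m D0 in \<open>auto simp: \<rho>_def\<close>)
  have sub: "u \<in> cball u0 \<rho>0" if "u \<in> cball u0 \<rho>" for u using that \<rho> by auto
  \<comment> \<open>The Koszul form is half of a sum of three terms of size \<open>R\<close>; 3/2 is
    rounded up to 2, whence the constant \<open>2 * D\<close> below.\<close>
  have avg: "\<bar>(x + y - z) / 2\<bar> \<le> 2 * R" if "\<bar>x\<bar> \<le> R" "\<bar>y\<bar> \<le> R" "\<bar>z\<bar> \<le> R" for x y z R :: real
    using that by (auto simp: abs_le_iff)
  show ?thesis
  proof (rule that[of \<rho> "m / 2" "2 * D"])
    show "\<rho> > 0" "m / 2 > 0" "2 * D \<ge> 0" using \<rho> m D0 by auto
    show "cball u0 \<rho> \<subseteq> ?im" using sub \<rho>0 by blast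
    fix u assume u: "u \<in> cball u0 \<rho>"
    show "m / 2 * (norm a)\<^sup>2 \<le> metric_in M c u a a" for a
    proof -
      have "\<bar>metric_in M c u0 a a - metric_in M c u a a\<bar> \<le> D * norm (u0 - u) * norm a * norm a"
        by (rule g) (use sub[OF u] \<rho>0 in auto)
      also have "\<dots> \<le> D * \<rho> * norm a * norm a"
        by (intro mult_right_mono mult_left_mono D0) (use u in \<open>auto simp: dist_norm\<close>)
      also have "\<dots> \<le> m / 2 * norm a * norm a"
        by (intro mult_right_mono \<rho>) auto
      finally show ?thesis using m(2)[of a] unfolding power2_eq_square mult.assoc by linarith
    qed
    show "\<bar>koszul c u a b z\<bar> \<le> 2 * D * norm a * norm b * norm z" for a b z
    proof -
      define R where "R = D * (norm a * (norm b * norm z))"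
      have "\<bar>dmetric c u b z a\<bar> \<le> R" "\<bar>dmetric c u a z b\<bar> \<le> R" "\<bar>dmetric c u a b z\<bar> \<le> R"
        using db[OF sub[OF u], of b z a] db[OF sub[OF u], of a z b] db[OF sub[OF u], of a b z]
        unfolding R_def by (simp_all add: mult_ac)
      from avg[OF this] show ?thesis unfolding koszul_def by (simp add: R_def mult_ac)
    qed
    fix u' assume u': "u' \<in> cball u0 \<rho>"
    show "\<bar>metric_in M c u a b - metric_in M c u' a b\<bar> \<le> 2 * D * norm (u - u') * norm a * norm b" for a b
    proof -
      have "0 \<le> D * norm (u - u') * norm a * norm b" using D0 by simp
      then show ?thesis using g[OF sub[OF u] sub[OF u'], of a b] by linarith
    qed
    show "\<bar>koszul c u a b z - koszul c u' a b z\<bar> \<le> 2 * D * norm (u - u') * norm a * norm b * norm z" for a b z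
    proof -
      define R where "R = D * (norm (u - u') * (norm a * (norm b * norm z)))"
      have R: "\<bar>dmetric c u b z a - dmetric c u' b z a\<bar> \<le> R"
        "\<bar>dmetric c u a z b - dmetric c u' a z b\<bar> \<le> R"
        "\<bar>dmetric c u a b z - dmetric c u' a b z\<bar> \<le> R"
        using d[OF sub[OF u] sub[OF u'], of b z a] d[OF sub[OF u] sub[OF u'], of a z b]
          d[OF sub[OF u] sub[OF u'], of a b z] unfolding R_def by (simp_all add: mult_ac)
      have "koszul c u a b z - koszul c u' a b z = ((dmetric c u b z a - dmetric c u' b z a) +
          (dmetric c u a z b - dmetric c u' a z b) - (dmetric c u a b z - dmetric c u' a b z)) / 2"
        unfolding koszul_def by (simp add: field_simps)
      with avg[OF R] show ?thesis by (simp add: R_def mult_ac)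
    qed
  qed
qed

end

end

section \<open>Curves, speed and length\<close>

lemma vector_derivative_within_cong:
  assumes "\<And>x. x \<in> S \<Longrightarrow> f x = g x" "t \<in> S"
  shows "vector_derivative f (at t within S) = vector_derivative g (at t within S)"
proof -
  have "(f has_vector_derivative D) (at t within S) \<longleftrightarrow> (g has_vector_derivative D) (at t within S)" for D
    unfolding has_vector_derivative_def
    using assms has_derivative_transform[of t S f g] has_derivative_transform[of t S g f] by auto
  then show ?thesis unfolding vector_derivative_def by simp
qed

lemma within_01_not_bot: "t \<in> {0..1::real} \<Longrightarrow> at t within {0..1} \<noteq> bot"
  using at_within_relopen(2)[of "{0..1}" t] by simp

context riemannian_mfd
begin

lemma Ck_curve_continuous: "Ck_curve k M \<gamma> \<Longrightarrow> continuous_on {0..1} \<gamma>"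
  by (simp add: Ck_curve_def)

lemma openin_curve_dom:
  assumes "c \<in> atlas M" "continuous_on {0..1::real} \<gamma>"
  shows "openin (top_of_set {0..1}) {t \<in> {0..1}. \<gamma> t \<in> cdom c}"
proof -
  have "openin (top_of_set {0..1}) ({0..1} \<inter> \<gamma> -` cdom c)"
    by (rule continuous_openin_preimage_gen[OF assms(2) open_cdom[OF assms(1)]])
  moreover have "{0..1} \<inter> \<gamma> -` cdom c = {t \<in> {0..1}. \<gamma> t \<in> cdom c}" by auto
  ultimately show ?thesis by simp
qed

section \<open>Velocity of a curve in a chart\<close>

context
  fixes c \<gamma> assumes c: "c \<in> atlas M" and \<gamma>: "Ck_curve (Suc 0) M \<gamma>"
begin

text \<open>Reconciles two conventions: \<open>Ck_curve\<close> differentiates within the times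
  spent in the chart domain, \<open>velocity_in\<close> within the whole unit interval.\<close>

lemma within_curve_dom:
  assumes "t \<in> {0..1}" "\<gamma> t \<in> cdom c"
  shows "at t within {t \<in> {0..1}. \<gamma> t \<in> cdom c} = at t within {0..1}"
  by (rule at_within_relopen(1)[OF openin_curve_dom[OF c Ck_curve_continuous[OF \<gamma>]]]) (use assms in auto)

lemma coord_has_vector_derivative:
  assumes "t \<in> {0..1}" "\<gamma> t \<in> cdom c"
  shows "((cmap c \<circ> \<gamma>) has_vector_derivative velocity_in c \<gamma> t) (at t within {0..1})"
proof -
  have "(cmap c \<circ> \<gamma>) differentiable (at t within {t \<in> {0..1}. \<gamma> t \<in> cdom c})"
    using \<gamma> c assms unfolding Ck_curve_def Ck_on.simps by blast
  then show ?thesis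
    unfolding within_curve_dom[OF assms] velocity_in_def using vector_derivative_works by blast
qed

lemma frechet_derivative_curve:
  assumes "t \<in> {0..1}" "\<gamma> t \<in> cdom c"
  shows "frechet_derivative (cmap c \<circ> \<gamma>) (at t within {t \<in> {0..1}. \<gamma> t \<in> cdom c}) v = v *\<^sub>R velocity_in c \<gamma> t"
  unfolding within_curve_dom[OF assms]
  using frechet_derivative_real_within[OF coord_has_vector_derivative[OF assms, unfolded has_vector_derivative_def]
      within_01_not_bot[OF assms(1)]] by simp

lemma Ck_on_velocity_in:
  assumes "Ck_curve (Suc k) M \<gamma>"
  shows "Ck_on k {t \<in> {0..1}. \<gamma> t \<in> cdom c} (velocity_in c \<gamma>)"
proof -
  have "Ck_on k {t \<in> {0..1}. \<gamma> t \<in> cdom c}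
      (\<lambda>t. frechet_derivative (cmap c \<circ> \<gamma>) (at t within {t \<in> {0..1}. \<gamma> t \<in> cdom c}) 1)"
    using assms c unfolding Ck_curve_def Ck_on.simps by blast
  then show ?thesis
    by (rule Ck_on_cong[THEN iffD1, rotated])
      (auto simp: frechet_derivative_curve simp del: atLeastAtMost_iff)
qed

lemma tendsto_velocity_in:
  assumes "t \<in> {0..1}" "\<gamma> t \<in> cdom c"
  shows "(velocity_in c \<gamma> \<longlongrightarrow> velocity_in c \<gamma> t) (at t within {0..1})"
proof -
  have "continuous_on {t \<in> {0..1}. \<gamma> t \<in> cdom c} (velocity_in c \<gamma>)"
    using Ck_on_velocity_in[OF \<gamma>] by simp
  then show ?thesis
    using assms within_curve_dom[OF assms] unfolding continuous_on_def by auto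
qed

lemma velocity_in_has_vector_derivative:
  assumes "Ck_curve (Suc (Suc 0)) M \<gamma>" "t \<in> {0..1}" "\<gamma> t \<in> cdom c"
  shows "(velocity_in c \<gamma> has_vector_derivative vector_derivative (velocity_in c \<gamma>) (at t within {0..1}))
    (at t within {0..1})"
proof -
  have "velocity_in c \<gamma> differentiable (at t within {t \<in> {0..1}. \<gamma> t \<in> cdom c})"
    using Ck_on_velocity_in[OF assms(1)] assms(2,3) unfolding Ck_on.simps by blast
  then show ?thesis
    unfolding within_curve_dom[OF assms(2,3)] using vector_derivative_works by blast
qed

lemma velocity_in_change:
  assumes c': "c' \<in> atlas M" and t: "t \<in> {0..1}" "\<gamma> t \<in> cdom c" "\<gamma> t \<in> cdom c'"
  shows "velocity_in c' \<gamma> t = coord_change c c' (\<gamma> t) (velocity_in c \<gamma> t)"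
proof -
  let ?S = "{t \<in> {0..1}. \<gamma> t \<in> cdom c}"
  have "((cmap c \<circ> \<gamma>) has_derivative (\<lambda>h. h *\<^sub>R velocity_in c \<gamma> t)) (at t within ?S)"
    using coord_has_vector_derivative[OF t(1,2)]
    unfolding has_vector_derivative_def within_curve_dom[OF t(1,2)] .
  moreover have "(cmap c' \<circ> cinv c has_derivative coord_change c c' (\<gamma> t))
      (at ((cmap c \<circ> \<gamma>) t) within (cmap c \<circ> \<gamma>) ` ?S)"
    using transition_derivative[OF c c' t(2,3)] has_derivative_at_withinI by fastforce
  ultimately have "((cmap c' \<circ> cinv c) \<circ> (cmap c \<circ> \<gamma>) has_derivative
      coord_change c c' (\<gamma> t) \<circ> (\<lambda>h. h *\<^sub>R velocity_in c \<gamma> t)) (at t within ?S)"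
    by (rule diff_chain_within)
  then have "(cmap c' \<circ> \<gamma> has_derivative
      coord_change c c' (\<gamma> t) \<circ> (\<lambda>h. h *\<^sub>R velocity_in c \<gamma> t)) (at t within ?S)"
    by (rule has_derivative_transform[rotated 2]) (use t in \<open>auto simp: cinv_cmap[OF c]\<close>)
  then have "(cmap c' \<circ> \<gamma> has_vector_derivative coord_change c c' (\<gamma> t) (velocity_in c \<gamma> t)) (at t within {0..1})"
    unfolding within_curve_dom[OF t(1,2)] has_vector_derivative_def
    by (simp add: comp_def linear_scale[OF coord_change_linear[OF c c' t(2,3)]])
  then show ?thesis
    unfolding velocity_in_def[of c'] using vector_derivative_within[OF within_01_not_bot[OF t(1)]] by blast
qed

end

section \<open>Speed and length\<close>

definition speed :: "(real \<Rightarrow> 'm) \<Rightarrow> real \<Rightarrow> real" where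
  "speed \<gamma> t = tnorm M (\<gamma> t) (velocity M \<gamma> t)"

lemma rmetric_nonneg: "0 \<le> rmetric M x v v"
  using inner_product_rmetric[of x] bilinear_lzero[of "rmetric M x" v] unfolding inner_product_def
  by (cases "v = 0") (auto intro: less_imp_le)

lemma metric_in_nonneg: "0 \<le> metric_in M c u a a"
  unfolding metric_in_def by (rule rmetric_nonneg)

lemma speed_nonneg: "0 \<le> speed \<gamma> t"
  unfolding speed_def tnorm_def using rmetric_nonneg by simp

text \<open>Velocity and metric change by the same \<open>coord_change\<close>, so the preferred
  chart in the definition of speed can be traded for any chart.\<close>

lemma speed_chart:
  assumes c: "c \<in> atlas M" and \<gamma>: "Ck_curve (Suc 0) M \<gamma>" and t: "t \<in> {0..1}" "\<gamma> t \<in> cdom c"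
  shows "speed \<gamma> t = sqrt (metric_in M c (cmap c (\<gamma> t)) (velocity_in c \<gamma> t) (velocity_in c \<gamma> t))"
  unfolding speed_def tnorm_def velocity_def metric_in_def cinv_cmap[OF c t(2)]
    velocity_in_change[OF c \<gamma> chart_at(1) t chart_at(2)] ..

text \<open>Smoothness of the metric is given for fixed vectors. The basis expansion turns it into
  joint convergence, valid once the base points have entered the chart image.\<close>

lemma tendsto_metric_in:
  assumes c: "c \<in> atlas M" and u: "u \<in> cmap c ` cdom c"
    and lim: "(U \<longlongrightarrow> u) F" "(A \<longlongrightarrow> a) F" "(B \<longlongrightarrow> b) F"
  shows "((\<lambda>i. metric_in M c (U i) (A i) (B i)) \<longlongrightarrow> metric_in M c u a b) F"
proof -
  note ex = bilinear_basis_expansion[OF bilinear_metric_in[OF c]]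
  have "((\<lambda>i. metric_in M c (U i) p q) \<longlongrightarrow> metric_in M c u p q) F" for p q
    using metric_in_has_derivative[OF c u, of p q, THEN has_derivative_continuous] lim(1)
    by (rule isCont_tendsto_compose)
  then have "((\<lambda>i. \<Sum>p\<in>Basis. \<Sum>q\<in>Basis. (A i \<bullet> p) * (B i \<bullet> q) * metric_in M c (U i) p q) \<longlongrightarrow>
      (\<Sum>p\<in>Basis. \<Sum>q\<in>Basis. (a \<bullet> p) * (b \<bullet> q) * metric_in M c u p q)) F"
    by (intro tendsto_intros lim)
  moreover have "\<forall>\<^sub>F i in F. U i \<in> cmap c ` cdom c"
    by (rule topological_tendstoD[OF lim(1) open_cmap_image[OF c] u])
  then have "\<forall>\<^sub>F i in F. (\<Sum>p\<in>Basis. \<Sum>q\<in>Basis. (A i \<bullet> p) * (B i \<bullet> q) * metric_in M c (U i) p q)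
      = metric_in M c (U i) (A i) (B i)"
    by eventually_elim (rule ex[symmetric])
  ultimately show ?thesis
    unfolding ex[OF u, of a b] by (rule Lim_transform_eventually)
qed

text \<open>The preferred chart may jump along the curve, so \<open>velocity\<close> itself can be
  discontinuous. Near each time the speed is rewritten in one fixed chart.\<close>

lemma continuous_on_speed:
  assumes \<gamma>: "Ck_curve (Suc 0) M \<gamma>"
  shows "continuous_on {0..1} (speed \<gamma>)"
  unfolding continuous_on_def
proof
  fix t :: real assume t: "t \<in> {0..1}"
  let ?c = "chart_at M (\<gamma> t)"
  note c = chart_at(1)[of "\<gamma> t"] chart_at(2)[of "\<gamma> t"]
  have lim: "(\<gamma> \<longlongrightarrow> \<gamma> t) (at t within {0..1})"
    using Ck_curve_continuous[OF \<gamma>] t unfolding continuous_on_def by blast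
  have 1: "((\<lambda>s. sqrt (metric_in M ?c (cmap ?c (\<gamma> s)) (velocity_in ?c \<gamma> s) (velocity_in ?c \<gamma> s))) \<longlongrightarrow> 
      sqrt (metric_in M ?c (cmap ?c (\<gamma> t)) (velocity_in ?c \<gamma> t) (velocity_in ?c \<gamma> t))) (at t within {0..1})"
    by (intro tendsto_real_sqrt tendsto_metric_in c tendsto_cmap lim tendsto_velocity_in \<gamma> t imageI)
  have "\<forall>\<^sub>F s in at t within {0..1}. \<gamma> s \<in> cdom ?c"
    by (rule topological_tendstoD[OF lim open_cdom[OF c(1)] c(2)])
  moreover have "\<forall>\<^sub>F s in at t within {0..1}. s \<in> {0..1}"
    by (auto simp: eventually_at_filter)
  ultimately have "\<forall>\<^sub>F s in at t within {0..1}.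
      sqrt (metric_in M ?c (cmap ?c (\<gamma> s)) (velocity_in ?c \<gamma> s) (velocity_in ?c \<gamma> s)) = speed \<gamma> s"
    by eventually_elim (rule speed_chart[OF c(1) \<gamma>, symmetric])
  with 1 show "(speed \<gamma> \<longlongrightarrow> speed \<gamma> t) (at t within {0..1})"
    unfolding speed_chart[OF c(1) \<gamma> t c(2)] by (rule Lim_transform_eventually)
qed

lemma curve_length_speed: "curve_length M \<gamma> = integral {0..1} (speed \<gamma>)"
  unfolding curve_length_def speed_def ..

lemma speed_integrable:
  assumes "Ck_curve (Suc 0) M \<gamma>" "{a..b} \<subseteq> {0..1}"
  shows "speed \<gamma> integrable_on {a..b}"
  by (rule integrable_continuous_interval[OF continuous_on_subset[OF continuous_on_speed[OF assms(1)] assms(2)]])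

section \<open>Affine reparametrization, including reversal and constant curves\<close>

lemma Ck_curve_affine:
  assumes "Ck_curve k M \<gamma>" and ab: "a \<in> {0..1}" "a + b \<in> {0..1}"
  shows "Ck_curve k M (\<lambda>s. \<gamma> (a + b * s))"
  unfolding Ck_curve_def
proof (intro conjI ballI)
  have aff: "(\<lambda>s. a + b * s) ` {0..1} \<subseteq> {0..1}" using affine_01[OF ab] by blast
  show cont: "continuous_on {0..1} (\<lambda>s. \<gamma> (a + b * s))"
    by (rule continuous_on_compose2[OF Ck_curve_continuous[OF assms(1)] _ aff]) (intro continuous_intros)
  fix c assume c: "c \<in> atlas M"
  have "Ck_on k {s \<in> {0..1}. \<gamma> (a + b * s) \<in> cdom c} (\<lambda>s. (cmap c \<circ> \<gamma>) (a + b * s))"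
  proof (rule Ck_on_affine)
    show "Ck_on k {t \<in> {0..1}. \<gamma> t \<in> cdom c} (cmap c \<circ> \<gamma>)"
      using assms(1) c by (simp add: Ck_curve_def)
    show "openin (top_of_set {0..1}) {s \<in> {0..1}. \<gamma> (a + b * s) \<in> cdom c}"
      by (rule openin_curve_dom[OF c cont])
  qed (auto intro: affine_01[OF ab] simp del: atLeastAtMost_iff)
  then show "Ck_on k {s \<in> {0..1}. \<gamma> (a + b * s) \<in> cdom c} (cmap c \<circ> (\<lambda>s. \<gamma> (a + b * s)))"
    by (simp add: comp_def)
qed

lemma velocity_in_affine:
  assumes c: "c \<in> atlas M" and \<gamma>: "Ck_curve (Suc 0) M \<gamma>" and ab: "a \<in> {0..1}" "a + b \<in> {0..1}"
    and s: "s \<in> {0..1}" "\<gamma> (a + b * s) \<in> cdom c"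
  shows "velocity_in c (\<lambda>s. \<gamma> (a + b * s)) s = b *\<^sub>R velocity_in c \<gamma> (a + b * s)"
proof -
  have aff: "(\<lambda>s. a + b * s) ` {0..1} \<subseteq> {0..1}" using affine_01[OF ab] by blast
  have "((cmap c \<circ> \<gamma>) has_vector_derivative velocity_in c \<gamma> (a + b * s))
      (at (a + b * s) within (\<lambda>s. a + b * s) ` {0..1})"
    using coord_has_vector_derivative[OF c \<gamma> _ s(2)] aff s(1) has_vector_derivative_within_subset by blast
  moreover have "((\<lambda>s. a + b * s) has_vector_derivative b) (at s within {0..1})"
    by (auto intro!: derivative_eq_intros)
  ultimately have "((cmap c \<circ> \<gamma>) \<circ> (\<lambda>s. a + b * s) has_vector_derivative b *\<^sub>R velocity_in c \<gamma> (a + b * s)) (at s within {0..1})"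
    by (rule vector_diff_chain_within[rotated])
  then show ?thesis
    unfolding velocity_in_def[of c "\<lambda>s. \<gamma> (a + b * s)"]
    using vector_derivative_within[OF within_01_not_bot[OF s(1)]] by (simp add: comp_def)
qed

lemma velocity_affine:
  assumes "Ck_curve (Suc 0) M \<gamma>" "a \<in> {0..1}" "a + b \<in> {0..1}" "s \<in> {0..1}"
  shows "velocity M (\<lambda>s. \<gamma> (a + b * s)) s = b *\<^sub>R velocity M \<gamma> (a + b * s)"
  unfolding velocity_def by (rule velocity_in_affine[OF chart_at(1) assms chart_at(2)])

lemma tnorm_scale: "tnorm M x (b *\<^sub>R v) = \<bar>b\<bar> * tnorm M x v"
proof -
  have "bilinear (rmetric M x)" using inner_product_rmetric by (auto simp: inner_product_def)
  then have "rmetric M x (b *\<^sub>R v) (b *\<^sub>R v) = b\<^sup>2 * rmetric M x v v"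
    by (simp add: bilinear_lmul bilinear_rmul power2_eq_square)
  then show ?thesis by (simp add: tnorm_def real_sqrt_mult)
qed

lemma speed_affine:
  assumes "Ck_curve (Suc 0) M \<gamma>" "a \<in> {0..1}" "a + b \<in> {0..1}" "s \<in> {0..1}"
  shows "speed (\<lambda>s. \<gamma> (a + b * s)) s = \<bar>b\<bar> * speed \<gamma> (a + b * s)"
  unfolding speed_def velocity_affine[OF assms] tnorm_scale ..

lemma curve_length_affine:
  assumes \<gamma>: "Ck_curve (Suc 0) M \<gamma>" and ab: "a \<in> {0..1}" "a + b \<in> {0..1}" "b \<ge> 0"
  shows "curve_length M (\<lambda>s. \<gamma> (a + b * s)) = integral {a..a + b} (speed \<gamma>)"
proof -
  have eq: "curve_length M (\<lambda>s. \<gamma> (a + b * s)) = integral {0..1} (\<lambda>s. b * speed \<gamma> (a + b * s))"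
    unfolding curve_length_speed
    by (rule integral_cong) (use speed_affine[OF \<gamma> ab(1,2)] ab(3) in auto)
  show ?thesis
  proof (cases "b = 0")
    case False
    then have b: "b > 0" using ab by simp
    have "(speed \<gamma> has_integral integral {a..a + b} (speed \<gamma>)) (cbox a (a + b))"
      using speed_integrable[OF \<gamma>, of a "a + b"] ab by (simp add: integrable_integral)
    from has_integral_affinity[OF this, of b a] b
    have "((\<lambda>s. speed \<gamma> (b * s + a)) has_integral inverse b * integral {a..a + b} (speed \<gamma>))
        ((\<lambda>x. (1 / b) * x + - ((1 / b) * a)) ` {a..a + b})"
      by (simp add: divide_inverse)
    moreover have "(\<lambda>x. (1 / b) * x + - ((1 / b) * a)) ` {a..a + b} = {0..1}"
      using b by (subst image_affinity_atLeastAtMost) (simp add: field_simps)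
    ultimately have "((\<lambda>s. b * speed \<gamma> (a + b * s)) has_integral b * (inverse b * integral {a..a + b} (speed \<gamma>))) {0..1}"
      by (intro has_integral_mult_right) (simp add: add.commute)
    from integral_unique[OF this] show ?thesis
      unfolding eq using b by (simp only: mult.assoc[symmetric]) simp
  next
    case True
    then show ?thesis unfolding eq by simp
  qed
qed

section \<open>Independence of the values outside the unit interval\<close>

lemma Ck_curve_cong:
  assumes "\<And>t. t \<in> {0..1} \<Longrightarrow> \<gamma> t = \<gamma>' t" "Ck_curve k M \<gamma>"
  shows "Ck_curve k M \<gamma>'"
  unfolding Ck_curve_def
proof (intro conjI ballI)
  show "continuous_on {0..1} \<gamma>'"
    by (rule continuous_on_eq[OF Ck_curve_continuous[OF assms(2)] assms(1)])
  fix c assume "c \<in> atlas M"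
  then have "Ck_on k {t \<in> {0..1}. \<gamma> t \<in> cdom c} (cmap c \<circ> \<gamma>)"
    using assms(2) by (simp add: Ck_curve_def)
  moreover have "{t \<in> {0..1}. \<gamma> t \<in> cdom c} = {t \<in> {0..1}. \<gamma>' t \<in> cdom c}" using assms(1) by auto
  ultimately have "Ck_on k {t \<in> {0..1}. \<gamma>' t \<in> cdom c} (cmap c \<circ> \<gamma>)" by simp
  then show "Ck_on k {t \<in> {0..1}. \<gamma>' t \<in> cdom c} (cmap c \<circ> \<gamma>')"
    by (rule Ck_on_cong[THEN iffD1, rotated]) (use assms(1) in auto)
qed

lemma velocity_in_cong:
  assumes "\<And>t. t \<in> {0..1} \<Longrightarrow> \<gamma> t = \<gamma>' t" "t \<in> {0..1}"
  shows "velocity_in c \<gamma> t = velocity_in c \<gamma>' t"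
  unfolding velocity_in_def by (rule vector_derivative_within_cong) (use assms in auto)

lemma velocity_cong:
  assumes "\<And>t. t \<in> {0..1} \<Longrightarrow> \<gamma> t = \<gamma>' t" "t \<in> {0..1}"
  shows "velocity M \<gamma> t = velocity M \<gamma>' t"
  unfolding velocity_def assms(1)[OF assms(2)] by (rule velocity_in_cong[OF assms])

lemma curve_length_cong:
  assumes "\<And>t. t \<in> {0..1} \<Longrightarrow> \<gamma> t = \<gamma>' t"
  shows "curve_length M \<gamma> = curve_length M \<gamma>'"
  unfolding curve_length_def
  by (rule integral_cong) (simp only: velocity_cong[of \<gamma> \<gamma>', OF assms] assms)

lemma geodesic_cong:
  assumes eq: "\<And>t. t \<in> {0..1} \<Longrightarrow> \<gamma> t = \<gamma>' t" and \<gamma>: "geodesic M \<gamma>"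
  shows "geodesic M \<gamma>'"
  unfolding geodesic_def
proof (intro conjI ballI impI)
  show "smooth_curve M \<gamma>'"
    using \<gamma> Ck_curve_cong[OF eq] by (auto simp: geodesic_def smooth_curve_def)
  fix c and t :: real assume c: "c \<in> atlas M" and t: "t \<in> {0..1}" "\<gamma>' t \<in> cdom c"
  have "covariant_acceleration_in M c \<gamma>' t = covariant_acceleration_in M c \<gamma> t"
    unfolding covariant_acceleration_in_def eq[OF t(1)]
    using vector_derivative_within_cong[of "{0..1}" "velocity_in c \<gamma>" "velocity_in c \<gamma>'" t,
      OF velocity_in_cong[of \<gamma> \<gamma>', OF eq] t(1)] velocity_in_cong[of \<gamma> \<gamma>' t c, OF eq t(1)] by simp
  then show "covariant_acceleration_in M c \<gamma>' t = 0"
    using \<gamma> c t eq by (simp add: geodesic_def)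
qed

section \<open>Geodesics: reparametrization, equation in weak form, constant speed\<close>

lemma geodesic_Ck_curve: "geodesic M \<gamma> \<Longrightarrow> Ck_curve k M \<gamma>"
  by (simp add: geodesic_def smooth_curve_def)

lemma geodesic_affine:
  assumes \<gamma>: "geodesic M \<gamma>" and ab: "a \<in> {0..1}" "a + b \<in> {0..1}"
  shows "geodesic M (\<lambda>s. \<gamma> (a + b * s))"
  unfolding geodesic_def
proof (intro conjI ballI impI)
  note C = geodesic_Ck_curve[OF \<gamma>]
  let ?\<gamma> = "\<lambda>s. \<gamma> (a + b * s)"
  show "smooth_curve M ?\<gamma>"
    using Ck_curve_affine[OF C ab] by (simp add: smooth_curve_def)
  fix c and s :: real assume c: "c \<in> atlas M" and s: "s \<in> {0..1}" "\<gamma> (a + b * s) \<in> cdom c"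
  let ?S = "{s \<in> {0..1}. \<gamma> (a + b * s) \<in> cdom c}"
  let ?t = "a + b * s"
  have aff: "(\<lambda>s. a + b * s) ` {0..1} \<subseteq> {0..1}" using affine_01[OF ab] by blast
  have t: "?t \<in> {0..1}" using affine_01[OF ab s(1)] .
  define w where "w = vector_derivative (velocity_in c \<gamma>) (at ?t within {0..1})"
  have "(velocity_in c \<gamma> has_vector_derivative w) (at ?t within (\<lambda>s. a + b * s) ` {0..1})"
    using velocity_in_has_vector_derivative[OF c C C t s(2)] aff has_vector_derivative_within_subset
    unfolding w_def by blast
  moreover have "((\<lambda>s. a + b * s) has_vector_derivative b) (at s within {0..1})"
    by (auto intro!: derivative_eq_intros)
  ultimately have "(velocity_in c \<gamma> \<circ> (\<lambda>s. a + b * s) has_vector_derivative b *\<^sub>R w) (at s within {0..1})"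
    by (rule vector_diff_chain_within[rotated])
  then have "((\<lambda>s. b *\<^sub>R velocity_in c \<gamma> (a + b * s)) has_vector_derivative b *\<^sub>R b *\<^sub>R w) (at s within {0..1})"
    by (intro has_vector_derivative_scaleR[OF DERIV_const, THEN has_vector_derivative_eq_rhs]) (auto simp: comp_def)
  \<comment> \<open>The formula for the velocity of \<open>?\<gamma>\<close> is available only at
    times in the chart domain, hence the passage to \<open>?S\<close> and back.\<close>
  then have "((\<lambda>s. b *\<^sub>R velocity_in c \<gamma> (a + b * s)) has_vector_derivative b *\<^sub>R b *\<^sub>R w) (at s within ?S)"
    by (rule has_vector_derivative_within_subset) auto
  then have "(velocity_in c ?\<gamma> has_vector_derivative b *\<^sub>R b *\<^sub>R w) (at s within ?S)"
    by (rule has_vector_derivative_transform[rotated 2])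
      (use s velocity_in_affine[OF c C ab] in auto)
  then have "(velocity_in c ?\<gamma> has_vector_derivative b *\<^sub>R b *\<^sub>R w) (at s within {0..1})"
    using within_curve_dom[OF c Ck_curve_affine[OF C ab] s] by simp
  then have vd: "vector_derivative (velocity_in c ?\<gamma>) (at s within {0..1}) = b\<^sup>2 *\<^sub>R w"
    using vector_derivative_within[OF within_01_not_bot[OF s(1)]] by (simp add: power2_eq_square)
  have "w + christoffel M c (cmap c (\<gamma> ?t)) (velocity_in c \<gamma> ?t) (velocity_in c \<gamma> ?t) = 0"
    using \<gamma> c t s(2) unfolding geodesic_def covariant_acceleration_in_def w_def by blast
  then have "b\<^sup>2 *\<^sub>R w + b\<^sup>2 *\<^sub>R christoffel M c (cmap c (\<gamma> ?t)) (velocity_in c \<gamma> ?t) (velocity_in c \<gamma> ?t) = 0"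
    by (metis scaleR_add_right scaleR_zero_right)
  then show "covariant_acceleration_in M c ?\<gamma> s = 0"
    unfolding covariant_acceleration_in_def vd velocity_in_affine[OF c C ab s]
    using christoffel_scale[OF c, of "cmap c (\<gamma> ?t)"] s(2) by simp
qed

text \<open>The equation tested against a vector \<open>z\<close>: the Christoffel vector disappears
  in favour of the Koszul form, for which estimates are at hand.\<close>

lemma geodesic_equation:
  assumes \<gamma>: "geodesic M \<gamma>" and c: "c \<in> atlas M" and t: "t \<in> {0..1}" "\<gamma> t \<in> cdom c"
  shows "metric_in M c (cmap c (\<gamma> t)) (vector_derivative (velocity_in c \<gamma>) (at t within {0..1})) z
    = - koszul c (cmap c (\<gamma> t)) (velocity_in c \<gamma> t) (velocity_in c \<gamma> t) z"
proof -
  let ?u = "cmap c (\<gamma> t)" and ?v = "velocity_in c \<gamma> t"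
  have u: "?u \<in> cmap c ` cdom c" using t by auto
  have "vector_derivative (velocity_in c \<gamma>) (at t within {0..1}) + christoffel M c ?u ?v ?v = 0"
    using \<gamma> c t unfolding geodesic_def covariant_acceleration_in_def by blast
  then have "vector_derivative (velocity_in c \<gamma>) (at t within {0..1}) = - christoffel M c ?u ?v ?v"
    by (simp add: eq_neg_iff_add_eq_0)
  moreover have "metric_in M c ?u (christoffel M c ?u ?v ?v) z = koszul c ?u ?v ?v z"
    using metric_in_christoffel_iff[OF c u] by blast
  ultimately show ?thesis
    using bilinear_lneg[OF bilinear_metric_in[OF c u]] by simp
qed

text \<open>Metric compatibility in coordinates. The squared speed has derivative twice the product
  of acceleration and velocity plus the derivative of the metric along the velocity; with all three
  arguments equal the Koszul form is half of the latter, so the geodesic equation cancels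
  everything.\<close>

lemma geodesic_speed_derivative:
  assumes \<gamma>: "geodesic M \<gamma>" and t: "t \<in> {0..1}"
  shows "((\<lambda>s. (speed \<gamma> s)\<^sup>2) has_vector_derivative 0) (at t within {0..1})"
proof -
  note C = geodesic_Ck_curve[OF \<gamma>]
  define c where "c = chart_at M (\<gamma> t)"
  have c: "c \<in> atlas M" "\<gamma> t \<in> cdom c" using chart_at by (auto simp: c_def)
  let ?S = "{s \<in> {0..1}. \<gamma> s \<in> cdom c}"
  define u where "u = cmap c \<circ> \<gamma>"
  define v where "v = velocity_in c \<gamma>"
  define w where "w = vector_derivative v (at t within {0..1})"
  have du: "(u has_vector_derivative v t) (at t within ?S)"
    using coord_has_vector_derivative[OF c(1) C t c(2)] within_curve_dom[OF c(1) C t c(2)]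
    by (simp add: u_def v_def)
  have dv: "(v has_vector_derivative w) (at t within ?S)"
    using velocity_in_has_vector_derivative[OF c(1) C C t c(2)] within_curve_dom[OF c(1) C t c(2)]
    by (simp add: w_def v_def)
  have ut: "u t \<in> cmap c ` cdom c" using c by (auto simp: u_def)
  have dg: "((\<lambda>s. metric_in M c (u s) i j) has_real_derivative dmetric c (u t) i j (v t)) (at t within ?S)" for i j
  proof -
    have "((\<lambda>p. metric_in M c p i j) has_derivative dmetric c (u t) i j) (at (u t) within u ` ?S)"
      using metric_in_has_derivative[OF c(1) ut] has_derivative_at_withinI by blast
    from diff_chain_within[OF du[unfolded has_vector_derivative_def] this]
    show ?thesis
      unfolding has_field_derivative_def comp_def linear_scale[OF linear_dmetric[OF c(1) ut]]
      by (simp add: mult.commute[of _ "dmetric c (u t) i j (v t)"])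
  qed
  have di: "((\<lambda>s. v s \<bullet> i) has_real_derivative w \<bullet> i) (at t within ?S)" for i
    unfolding has_real_derivative_iff_has_vector_derivative
    by (rule bounded_linear.has_vector_derivative[OF bounded_linear_inner_left dv])
  have "((\<lambda>s. \<Sum>i\<in>Basis. \<Sum>j\<in>Basis. (v s \<bullet> i) * (v s \<bullet> j) * metric_in M c (u s) i j) has_real_derivative
     (\<Sum>i\<in>Basis. \<Sum>j\<in>Basis. (w \<bullet> i) * (v t \<bullet> j) * metric_in M c (u t) i j
       + (v t \<bullet> i) * (w \<bullet> j) * metric_in M c (u t) i j
       + (v t \<bullet> i) * (v t \<bullet> j) * dmetric c (u t) i j (v t))) (at t within ?S)"
    by (intro DERIV_sum) (rule derivative_eq_intros dg di refl | simp add: algebra_simps)+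
  moreover have "(\<Sum>i\<in>Basis. \<Sum>j\<in>Basis. (w \<bullet> i) * (v t \<bullet> j) * metric_in M c (u t) i j
       + (v t \<bullet> i) * (w \<bullet> j) * metric_in M c (u t) i j
       + (v t \<bullet> i) * (v t \<bullet> j) * dmetric c (u t) i j (v t))
     = metric_in M c (u t) w (v t) + metric_in M c (u t) (v t) w + dmetric c (u t) (v t) (v t) (v t)"
    unfolding sum.distrib bilinear_basis_expansion[OF bilinear_metric_in[OF c(1) ut], of w "v t"]
      bilinear_basis_expansion[OF bilinear_metric_in[OF c(1) ut], of "v t" w]
      dmetric_expand[OF c(1) ut, of "v t" "v t"] ..
  moreover have "metric_in M c (u t) w (v t) + metric_in M c (u t) (v t) w + dmetric c (u t) (v t) (v t) (v t) = 0"
    using geodesic_equation[OF \<gamma> c(1) t c(2), of "v t"] metric_in_commute[of c "u t" w "v t"]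
    by (simp add: koszul_def w_def v_def u_def)
  ultimately have "((\<lambda>s. \<Sum>i\<in>Basis. \<Sum>j\<in>Basis. (v s \<bullet> i) * (v s \<bullet> j) * metric_in M c (u s) i j) has_vector_derivative 0) (at t within ?S)"
    by (simp add: has_real_derivative_iff_has_vector_derivative)
  then have "((\<lambda>s. (speed \<gamma> s)\<^sup>2) has_vector_derivative 0) (at t within ?S)"
  proof (rule has_vector_derivative_transform[rotated 2])
    fix s assume s: "s \<in> ?S"
    then have us: "u s \<in> cmap c ` cdom c" by (auto simp: u_def)
    have "(speed \<gamma> s)\<^sup>2 = metric_in M c (u s) (v s) (v s)"
      using speed_chart[OF c(1) C, of s] s metric_in_nonneg by (simp add: u_def v_def)
    then show "(speed \<gamma> s)\<^sup>2 = (\<Sum>i\<in>Basis. \<Sum>j\<in>Basis. (v s \<bullet> i) * (v s \<bullet> j) * metric_in M c (u s) i j)"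
      using bilinear_basis_expansion[OF bilinear_metric_in[OF c(1) us], of "v s" "v s"] by simp
  qed (use t c in auto)
  then show ?thesis unfolding within_curve_dom[OF c(1) C t c(2)] .
qed

lemma geodesic_speed_const:
  assumes \<gamma>: "geodesic M \<gamma>" and t: "t \<in> {0..1}" "s \<in> {0..1}"
  shows "speed \<gamma> t = speed \<gamma> s"
proof -
  have "\<exists>k. \<forall>x\<in>{0..1}. (speed \<gamma> x)\<^sup>2 = k"
    by (rule has_vector_derivative_zero_constant[of "{0..1}" "\<lambda>s. (speed \<gamma> s)\<^sup>2"])
      (use geodesic_speed_derivative[OF \<gamma>] in auto)
  then have "(speed \<gamma> t)\<^sup>2 = (speed \<gamma> s)\<^sup>2" using t by auto
  then show ?thesis using speed_nonneg by (metis power2_eq_iff_nonneg)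
qed

lemma geodesic_length: "geodesic M \<gamma> \<Longrightarrow> t \<in> {0..1} \<Longrightarrow> curve_length M \<gamma> = speed \<gamma> t"
proof -
  assume \<gamma>: "geodesic M \<gamma>" and t: "t \<in> {0..1}"
  have "integral {0..1} (speed \<gamma>) = integral {0..1} (\<lambda>_::real. speed \<gamma> t)"
    by (rule integral_cong) (use geodesic_speed_const[OF \<gamma> _ t] in auto)
  then show ?thesis unfolding curve_length_speed by simp
qed

text \<open>As long as the curve stays in the coordinate ball, its coordinate speed is at most \<open>1 / m\<close>
  times its Riemannian speed.\<close>

lemma length_escaping_ball:
  assumes \<gamma>: "Ck_curve (Suc 0) M \<gamma>" and c: "c \<in> atlas M"
    and \<rho>: "cball u0 \<rho> \<subseteq> cmap c ` cdom c" and m: "m > 0"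
    and low: "\<And>u a. u \<in> cball u0 \<rho> \<Longrightarrow> m\<^sup>2 * (norm a)\<^sup>2 \<le> metric_in M c u a a"
    and ab: "0 \<le> a" "a \<le> b" "b \<le> 1"
    and start: "\<gamma> a \<in> cdom c" "cmap c (\<gamma> a) \<in> ball u0 \<rho>"
    and stop: "\<not> (\<gamma> b \<in> cdom c \<and> cmap c (\<gamma> b) \<in> ball u0 \<rho>)"
  shows "m * (\<rho> - dist u0 (cmap c (\<gamma> a))) \<le> integral {a..b} (speed \<gamma>)"
proof -
  define U where "U = {x \<in> cdom c. cmap c x \<in> ball u0 \<rho>}"
  have U: "open U" unfolding U_def by (rule open_chart_preimage[OF c open_ball])
  have cont: "continuous_on {a..b} \<gamma>"
    by (rule continuous_on_subset[OF Ck_curve_continuous[OF \<gamma>]]) (use ab in auto)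
  have "closedin (top_of_set {a..b}) ({a..b} \<inter> \<gamma> -` (- U))"
    by (rule continuous_closedin_preimage[OF cont]) (use U in auto)
  then have clT: "closed ({a..b} \<inter> \<gamma> -` (- U))"
    using closedin_closed_trans closed_real_atLeastAtMost by blast
  define T where "T = {a..b} \<inter> \<gamma> -` (- U)"
  \<comment> \<open>First time outside the coordinate ball, attained because \<open>T\<close> is
    closed.\<close>
  define s where "s = Inf T"
  have T: "b \<in> T" "bdd_below T" using stop ab by (auto simp: T_def U_def)
  have s: "s \<in> T" unfolding s_def
    by (rule closed_contains_Inf) (use T clT in \<open>auto simp: T_def\<close>)
  have before: "\<gamma> t \<in> U" if "a \<le> t" "t < s" for t
  proof (rule ccontr)
    assume "\<gamma> t \<notin> U"
    then have "t \<in> T" using that s by (auto simp: T_def)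
    then have "s \<le> t" unfolding s_def using T(2) by (rule cInf_lower)
    then show False using that by simp
  qed
  have as: "a < s" using s start by (cases "s = a") (auto simp: T_def U_def)
  have sb: "s \<le> b" using s by (auto simp: T_def)
  define I where "I = integral {a..b} (speed \<gamma>)"
  have move: "m * norm (cmap c (\<gamma> t) - cmap c (\<gamma> a)) \<le> I" if t: "a \<le> t" "t < s" for t
  proof -
    have sub: "{a..t} \<subseteq> {0..1}" using t ab sb by auto
    have inU: "\<gamma> x \<in> U" if "x \<in> {a..t}" for x using before[of x] that t by auto
    have "(velocity_in c \<gamma> has_integral (cmap c \<circ> \<gamma>) t - (cmap c \<circ> \<gamma>) a) {a..t}"
    proof (rule fundamental_theorem_of_calculus[OF t(1)])
      fix x assume x: "x \<in> {a..t}"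
      have "((cmap c \<circ> \<gamma>) has_vector_derivative velocity_in c \<gamma> x) (at x within {0..1})"
        by (rule coord_has_vector_derivative[OF c \<gamma>]) (use x sub inU[OF x] in \<open>auto simp: U_def\<close>)
      then show "((cmap c \<circ> \<gamma>) has_vector_derivative velocity_in c \<gamma> x) (at x within {a..t})"
        using sub has_vector_derivative_within_subset by blast
    qed
    then have FTC: "velocity_in c \<gamma> integrable_on {a..t}"
      "integral {a..t} (velocity_in c \<gamma>) = cmap c (\<gamma> t) - cmap c (\<gamma> a)"
      by (auto simp: has_integral_integrable_integral)
    have pt: "norm (velocity_in c \<gamma> x) \<le> speed \<gamma> x / m" if x: "x \<in> {a..t}" for x
    proof -
      have xU: "\<gamma> x \<in> cdom c" "cmap c (\<gamma> x) \<in> cball u0 \<rho>" using inU[OF x] by (auto simp: U_def)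
      have "(m * norm (velocity_in c \<gamma> x))\<^sup>2 \<le> (speed \<gamma> x)\<^sup>2"
        using low[OF xU(2), of "velocity_in c \<gamma> x"] speed_chart[OF c \<gamma> _ xU(1)] x sub metric_in_nonneg
        by (auto simp: power_mult_distrib)
      then have "m * norm (velocity_in c \<gamma> x) \<le> speed \<gamma> x"
        using speed_nonneg by (rule power2_le_imp_le)
      then show ?thesis using m by (simp add: field_simps)
    qed
    have "(\<lambda>x. speed \<gamma> x / m) integrable_on {a..t}"
      by (rule integrable_on_divide[OF speed_integrable[OF \<gamma> sub]])
    from integral_norm_bound_integral[OF FTC(1) this pt]
    have "norm (cmap c (\<gamma> t) - cmap c (\<gamma> a)) \<le> integral {a..t} (speed \<gamma>) / m"
      unfolding FTC(2) by simp
    then have "m * norm (cmap c (\<gamma> t) - cmap c (\<gamma> a)) \<le> integral {a..t} (speed \<gamma>)"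
      using m by (simp add: field_simps)
    also have "\<dots> \<le> I" unfolding I_def
      by (rule integral_subset_le) (use speed_integrable[OF \<gamma>] speed_nonneg ab sub t sb in auto)
    finally show ?thesis .
  qed
  show ?thesis
  proof (rule ccontr)
    assume "\<not> ?thesis"
    then have neg: "I < m * (\<rho> - dist u0 (cmap c (\<gamma> a)))" by (simp add: I_def)
    \<comment> \<open>The exit point \<open>\<gamma> s\<close> may lie outside the chart, where
      coordinates carry no information. A curve that is too short stays, before \<open>s\<close>, in
      the preimage \<open>K\<close> of a strictly smaller closed ball; \<open>K\<close> is compact,
      hence closed in the Hausdorff space, so it contains \<open>\<gamma> s\<close> as well.\<close>
    define r where "r = dist u0 (cmap c (\<gamma> a)) + I / m"
    have r: "r < \<rho>" using neg m unfolding r_def by (simp add: field_simps)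
    define K where "K = cinv c ` cball u0 r"
    have rim: "cball u0 r \<subseteq> cmap c ` cdom c" using \<rho> r by auto
    have "compact K"
      unfolding K_def
      by (intro compact_continuous_image continuous_on_subset[OF continuous_cinv[OF c] rim]) simp
    then have "closed K" by (rule compact_imp_closed)
    have inK: "\<gamma> t \<in> K" if "t \<in> {a..<s}" for t
    proof -
      have t: "\<gamma> t \<in> cdom c" "m * norm (cmap c (\<gamma> t) - cmap c (\<gamma> a)) \<le> I"
        using before[of t] move[of t] that by (auto simp: U_def)
      then have "dist (cmap c (\<gamma> a)) (cmap c (\<gamma> t)) \<le> I / m"
        using m by (simp add: dist_norm norm_minus_commute field_simps)
      then have "cmap c (\<gamma> t) \<in> cball u0 r"
        using dist_triangle[of u0 "cmap c (\<gamma> t)" "cmap c (\<gamma> a)"] by (simp add: r_def)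
      then show ?thesis unfolding K_def using cinv_cmap[OF c t(1)] by (metis imageI)
    qed
    have "\<gamma> s \<in> K"
    proof -
      have "closure {a..<s} = {a..s}" using as by (rule closure_atLeastLessThan)
      moreover have "\<gamma> ` closure {a..<s} \<subseteq> K"
      proof (rule image_closure_subset)
        show "continuous_on (closure {a..<s}) \<gamma>"
          using calculation by (simp add: continuous_on_subset[OF cont] sb)
      qed (use inK \<open>closed K\<close> in auto)
      ultimately show ?thesis using as by auto
    qed
    moreover have "K \<subseteq> U"
      unfolding K_def U_def using rim r cinv_in[OF c] cmap_cinv[OF c] by auto
    ultimately show False using s by (auto simp: T_def)
  qed
qed

end

section \<open>Continuous dependence of geodesics and the exponential map\<close>

context riemannian_mfd
begin

text \<open>Constant speed turns the length bound into a bound on time. For \<open>t2\<close> before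
  \<open>t1\<close> the argument is run on the reversed geodesic.\<close>

lemma geodesic_stays_in_ball:
  assumes \<gamma>: "geodesic M \<gamma>" and c: "c \<in> atlas M"
    and \<rho>: "cball u0 \<rho> \<subseteq> cmap c ` cdom c" and m: "m > 0"
    and low: "\<And>u a. u \<in> cball u0 \<rho> \<Longrightarrow> m\<^sup>2 * (norm a)\<^sup>2 \<le> metric_in M c u a a"
    and t: "t1 \<in> {0..1}" "t2 \<in> {0..1}"
    and start: "\<gamma> t1 \<in> cdom c" "cmap c (\<gamma> t1) \<in> ball u0 \<rho>"
    and short: "speed \<gamma> t1 * \<bar>t2 - t1\<bar> < m * (\<rho> - dist u0 (cmap c (\<gamma> t1)))"
  shows "\<gamma> t2 \<in> cdom c \<and> cmap c (\<gamma> t2) \<in> ball u0 \<rho>"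
proof (rule ccontr)
  assume stop: "\<not> ?thesis"
  have len: "integral {a..b} (speed \<sigma>) = speed \<sigma> t * (b - a)"
    if "geodesic M \<sigma>" "0 \<le> a" "a \<le> b" "b \<le> 1" "t \<in> {0..1}" for \<sigma> a b t
  proof -
    have "integral {a..b} (speed \<sigma>) = integral {a..b} (\<lambda>_. speed \<sigma> t)"
      by (rule integral_cong) (rule geodesic_speed_const[OF that(1)], use that in auto)
    then show ?thesis using that by simp
  qed
  show False
  proof (cases "t1 \<le> t2")
    case True
    have "m * (\<rho> - dist u0 (cmap c (\<gamma> t1))) \<le> integral {t1..t2} (speed \<gamma>)"
      by (rule length_escaping_ball[OF geodesic_Ck_curve[OF \<gamma>] c \<rho> m low _ True _ start stop]) (use t in auto)
    also have "\<dots> = speed \<gamma> t1 * \<bar>t2 - t1\<bar>"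
      using len[OF \<gamma>, of t1 t2 t1] t True by simp
    finally show False using short by simp
  next
    case False
    define \<sigma> where "\<sigma> = (\<lambda>s. \<gamma> (1 + (- 1) * s))"
    have \<sigma>: "geodesic M \<sigma>" unfolding \<sigma>_def by (rule geodesic_affine[OF \<gamma>]) auto
    have e: "\<sigma> (1 - t1) = \<gamma> t1" "\<sigma> (1 - t2) = \<gamma> t2" by (auto simp: \<sigma>_def)
    have "m * (\<rho> - dist u0 (cmap c (\<sigma> (1 - t1)))) \<le> integral {1 - t1..1 - t2} (speed \<sigma>)"
      by (rule length_escaping_ball[OF geodesic_Ck_curve[OF \<sigma>] c \<rho> m low])
        (use t False start stop in \<open>simp_all only: e, auto\<close>)
    also have "\<dots> = speed \<sigma> (1 - t1) * (t1 - t2)"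
      using len[OF \<sigma>, of "1 - t1" "1 - t2" "1 - t1"] t False by simp
    also have "speed \<sigma> (1 - t1) = speed \<gamma> t1"
      unfolding \<sigma>_def using speed_affine[OF geodesic_Ck_curve[OF \<gamma>], of 1 "- 1" "1 - t1"] t by simp
    finally show False using short False by (simp add: e)
  qed
qed

text \<open>A Lipschitz bound in phase space for the accelerations of two geodesics, obtained from
  the tested equation so that only the lower bound \<open>m\<close> replaces inversion of the
  metric. It supplies the constant for Gronwall.\<close>

lemma acceleration_diff_bound:
  assumes c: "c \<in> atlas M" and im: "u1 \<in> cmap c ` cdom c" "u2 \<in> cmap c ` cdom c"
    and m: "m > 0" and B: "B \<ge> 0"
    and low: "\<And>a. m * (norm a)\<^sup>2 \<le> metric_in M c u1 a a" "\<And>a. m * (norm a)\<^sup>2 \<le> metric_in M c u2 a a"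
    and g: "\<And>a b. \<bar>metric_in M c u2 a b - metric_in M c u1 a b\<bar> \<le> B * norm (u1 - u2) * norm a * norm b"
    and kd: "\<And>a b z. \<bar>koszul c u2 a b z - koszul c u1 a b z\<bar> \<le> B * norm (u1 - u2) * norm a * norm b * norm z"
    and k: "\<And>a b z. \<bar>koszul c u1 a b z\<bar> \<le> B * norm a * norm b * norm z"
      "\<And>a b z. \<bar>koszul c u2 a b z\<bar> \<le> B * norm a * norm b * norm z"
    and v: "norm v1 \<le> V" "norm v2 \<le> V"
    and w: "\<And>z. metric_in M c u1 w1 z = - koszul c u1 v1 v1 z" "\<And>z. metric_in M c u2 w2 z = - koszul c u2 v2 v2 z"
  shows "norm (w1 - w2) \<le> (B * V\<^sup>2 + 2 * B * V + B * (B * V\<^sup>2 / m)) / m * (norm (u1 - u2) + norm (v1 - v2))"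
proof -
  have V: "V \<ge> 0" using v(1) norm_ge_zero order_trans by blast
  have cancel: "x \<le> k" if "x * x \<le> k * x" "x \<ge> 0" "k \<ge> 0" for x k :: real
    using that by (cases "x = 0") auto
  have w2: "norm w2 \<le> B * V\<^sup>2 / m"
  proof -
    have "m * (norm w2)\<^sup>2 \<le> \<bar>koszul c u2 v2 v2 w2\<bar>" using low(2)[of w2] w(2)[of w2] by simp
    also have "\<dots> \<le> B * norm v2 * norm v2 * norm w2" by (rule k)
    also have "\<dots> \<le> B * V * V * norm w2"
      by (intro mult_mono mult_left_mono v B mult_nonneg_nonneg V) auto
    finally have "norm w2 * norm w2 \<le> (B * V\<^sup>2 / m) * norm w2"
      using m by (simp add: field_simps power2_eq_square)
    then show ?thesis by (rule cancel) (use B m in auto)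
  qed
  define \<Delta> where "\<Delta> = w1 - w2"
  \<comment> \<open>The difference is tested against itself at \<open>u1\<close>. Since
    \<open>w2\<close> satisfies its equation at \<open>u2\<close>, moving it to \<open>u1\<close>
    costs the last term, controlled by the size of \<open>w2\<close> and the variation of the
    metric.\<close>
  have "metric_in M c u1 \<Delta> \<Delta> = metric_in M c u1 w1 \<Delta> - metric_in M c u1 w2 \<Delta>"
    unfolding \<Delta>_def by (rule bilinear_lsub[OF bilinear_metric_in[OF c im(1)]])
  also have "\<dots> = (koszul c u2 v2 v2 \<Delta> - koszul c u1 v2 v2 \<Delta>) + (koszul c u1 v2 v2 \<Delta> - koszul c u1 v1 v1 \<Delta>)
      + (metric_in M c u2 w2 \<Delta> - metric_in M c u1 w2 \<Delta>)"
    by (simp add: w)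
  also have "koszul c u1 v2 v2 \<Delta> - koszul c u1 v1 v1 \<Delta> = koszul c u1 (v2 - v1) v2 \<Delta> + koszul c u1 v1 (v2 - v1) \<Delta>"
    using koszul_add(1)[OF c im(1), of "v2 - v1" v1 v2 \<Delta>] koszul_add(2)[OF c im(1), of v1 "v2 - v1" v1 \<Delta>] by simp
  finally have "m * (norm \<Delta>)\<^sup>2 \<le> \<bar>koszul c u2 v2 v2 \<Delta> - koszul c u1 v2 v2 \<Delta>\<bar>
      + \<bar>koszul c u1 (v2 - v1) v2 \<Delta>\<bar> + \<bar>koszul c u1 v1 (v2 - v1) \<Delta>\<bar>
      + \<bar>metric_in M c u2 w2 \<Delta> - metric_in M c u1 w2 \<Delta>\<bar>"
    using low(1)[of \<Delta>] by linarith
  also have "\<dots> \<le> B * norm (u1 - u2) * V * V * norm \<Delta> + B * norm (v1 - v2) * V * norm \<Delta>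
      + B * V * norm (v1 - v2) * norm \<Delta> + B * norm (u1 - u2) * (B * V\<^sup>2 / m) * norm \<Delta>"
  proof (intro add_mono)
    show "\<bar>koszul c u2 v2 v2 \<Delta> - koszul c u1 v2 v2 \<Delta>\<bar> \<le> B * norm (u1 - u2) * V * V * norm \<Delta>"
      by (rule order_trans[OF kd]) (intro mult_mono mult_left_mono v B mult_nonneg_nonneg V, auto)
    show "\<bar>koszul c u1 (v2 - v1) v2 \<Delta>\<bar> \<le> B * norm (v1 - v2) * V * norm \<Delta>"
      by (rule order_trans[OF k(1)], subst norm_minus_commute)
        (intro mult_mono mult_left_mono v B mult_nonneg_nonneg V, auto)
    show "\<bar>koszul c u1 v1 (v2 - v1) \<Delta>\<bar> \<le> B * V * norm (v1 - v2) * norm \<Delta>"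
      by (rule order_trans[OF k(1)], subst norm_minus_commute)
        (intro mult_mono mult_left_mono v B mult_nonneg_nonneg V, auto)
    show "\<bar>metric_in M c u2 w2 \<Delta> - metric_in M c u1 w2 \<Delta>\<bar> \<le> B * norm (u1 - u2) * (B * V\<^sup>2 / m) * norm \<Delta>"
      by (rule order_trans[OF g]) (intro mult_mono mult_left_mono w2 B mult_nonneg_nonneg, auto simp: B m less_imp_le)
  qed
  also have "\<dots> = (B * V\<^sup>2 * norm (u1 - u2) + 2 * B * V * norm (v1 - v2) + B * (B * V\<^sup>2 / m) * norm (u1 - u2)) * norm \<Delta>"
    by (simp add: power2_eq_square algebra_simps)
  also have "\<dots> \<le> ((B * V\<^sup>2 + 2 * B * V + B * (B * V\<^sup>2 / m)) * (norm (u1 - u2) + norm (v1 - v2))) * norm \<Delta>"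
  proof (rule mult_right_mono)
    have "0 \<le> B * V\<^sup>2 * norm (v1 - v2)" "0 \<le> 2 * B * V * norm (u1 - u2)" "0 \<le> B * (B * V\<^sup>2 / m) * norm (v1 - v2)"
      using B V m by auto
    then show "B * V\<^sup>2 * norm (u1 - u2) + 2 * B * V * norm (v1 - v2) + B * (B * V\<^sup>2 / m) * norm (u1 - u2)
        \<le> (B * V\<^sup>2 + 2 * B * V + B * (B * V\<^sup>2 / m)) * (norm (u1 - u2) + norm (v1 - v2))"
      by (simp only: distrib_left distrib_right)
  qed simp
  finally have "norm \<Delta> * norm \<Delta> \<le> ((B * V\<^sup>2 + 2 * B * V + B * (B * V\<^sup>2 / m)) / m * (norm (u1 - u2) + norm (v1 - v2))) * norm \<Delta>"
    using m by (simp add: power2_eq_square pos_le_divide_eq mult_ac)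
  then show ?thesis
    unfolding \<Delta>_def by (rule cancel) (use B V m in auto)
qed

text \<open>Convergence in the tangent bundle at the single time \<open>t\<close>. Asking for it in
  every chart around \<open>\<gamma> t\<close> lets it be handed from one chart to the next along
  the curve.\<close>

definition C1_converges :: "('i \<Rightarrow> real \<Rightarrow> 'm) \<Rightarrow> 'i filter \<Rightarrow> (real \<Rightarrow> 'm) \<Rightarrow> real \<Rightarrow> bool" where
  "C1_converges \<Gamma> F \<gamma> t \<longleftrightarrow> ((\<lambda>i. \<Gamma> i t) \<longlongrightarrow> \<gamma> t) F \<and>
    (\<forall>c\<in>atlas M. \<gamma> t \<in> cdom c \<longrightarrow> ((\<lambda>i. velocity_in c (\<Gamma> i) t) \<longlongrightarrow> velocity_in c \<gamma> t) F)"

lemma C1_convergesI: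
  assumes \<gamma>: "geodesic M \<gamma>" and \<Gamma>: "\<forall>\<^sub>F i in F. geodesic M (\<Gamma> i)"
    and t: "t \<in> {0..1}" and lim: "((\<lambda>i. \<Gamma> i t) \<longlongrightarrow> \<gamma> t) F"
    and c: "c \<in> atlas M" "\<gamma> t \<in> cdom c"
    and vel: "((\<lambda>i. velocity_in c (\<Gamma> i) t) \<longlongrightarrow> velocity_in c \<gamma> t) F"
  shows "C1_converges \<Gamma> F \<gamma> t"
  unfolding C1_converges_def
proof (intro conjI ballI impI lim)
  fix c' assume c': "c' \<in> atlas M" "\<gamma> t \<in> cdom c'"
  have 1: "((\<lambda>i. coord_change c c' (\<Gamma> i t) (velocity_in c (\<Gamma> i) t)) \<longlongrightarrow>
      coord_change c c' (\<gamma> t) (velocity_in c \<gamma> t)) F"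
    by (rule tendsto_coord_change[OF c(1) c'(1) c(2) c'(2) lim vel])
  have "\<forall>\<^sub>F i in F. \<Gamma> i t \<in> cdom c" "\<forall>\<^sub>F i in F. \<Gamma> i t \<in> cdom c'"
    by (rule topological_tendstoD[OF lim], use c c' open_cdom in auto)+
  with \<Gamma> have 2: "\<forall>\<^sub>F i in F. coord_change c c' (\<Gamma> i t) (velocity_in c (\<Gamma> i) t) = velocity_in c' (\<Gamma> i) t"
  proof eventually_elim
    case (elim i)
    then show ?case
      using velocity_in_change[OF c(1) geodesic_Ck_curve[OF elim(1)] c'(1) t] by simp
  qed
  show "((\<lambda>i. velocity_in c' (\<Gamma> i) t) \<longlongrightarrow> velocity_in c' \<gamma> t) F"
    using Lim_transform_eventually[OF 1 2]
      velocity_in_change[OF c(1) geodesic_Ck_curve[OF \<gamma>] c'(1) t c(2) c'(2)] by simp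
qed

text \<open>Gronwall in a coordinate ball around \<open>\<gamma> t0\<close>. Convergence passes
  between any two times of \<open>T\<close> in either direction, which is the form that induction
  over a connected set requires.\<close>

lemma geodesic_dependence_local:
  assumes \<gamma>: "geodesic M \<gamma>" and \<Gamma>: "\<forall>\<^sub>F i in F. geodesic M (\<Gamma> i)" and t0: "t0 \<in> {0..1}"
  shows "\<exists>T. openin (top_of_set {0..1}) T \<and> t0 \<in> T \<and>
    (\<forall>t1\<in>T. \<forall>t2\<in>T. C1_converges \<Gamma> F \<gamma> t1 \<longrightarrow> C1_converges \<Gamma> F \<gamma> t2)"
proof -
  define c where "c = chart_at M (\<gamma> t0)"
  define u0 where "u0 = cmap c (\<gamma> t0)"
  have c: "c \<in> atlas M" "\<gamma> t0 \<in> cdom c" using chart_at by (auto simp: c_def)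
  have u0: "u0 \<in> cmap c ` cdom c" using c by (auto simp: u0_def)
  obtain \<rho> m B where est: "\<rho> > 0" "m > 0" "B \<ge> 0" "cball u0 \<rho> \<subseteq> cmap c ` cdom c"
    and low: "\<And>u a. u \<in> cball u0 \<rho> \<Longrightarrow> m * (norm a)\<^sup>2 \<le> metric_in M c u a a"
    and g: "\<And>u u' a b. u \<in> cball u0 \<rho> \<Longrightarrow> u' \<in> cball u0 \<rho> \<Longrightarrow>
      \<bar>metric_in M c u a b - metric_in M c u' a b\<bar> \<le> B * norm (u - u') * norm a * norm b"
    and kd: "\<And>u u' a b z. u \<in> cball u0 \<rho> \<Longrightarrow> u' \<in> cball u0 \<rho> \<Longrightarrow>
      \<bar>koszul c u a b z - koszul c u' a b z\<bar> \<le> B * norm (u - u') * norm a * norm b * norm z"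
    and k: "\<And>u a b z. u \<in> cball u0 \<rho> \<Longrightarrow> \<bar>koszul c u a b z\<bar> \<le> B * norm a * norm b * norm z"
    by (rule chart_estimates[OF c(1) u0]) (rule that)
  define n where "n = sqrt m"
  have n: "n > 0" "n\<^sup>2 = m" using est by (auto simp: n_def)
  \<comment> \<open>The extra 1 makes the speed bound strict for \<open>\<gamma>\<close>, so it
    eventually holds for the converging geodesics too, and keeps \<open>V0\<close> positive when
    \<open>\<gamma>\<close> is constant.\<close>
  define V0 where "V0 = speed \<gamma> t0 + 1"
  have V0: "V0 \<ge> 1" using speed_nonneg[of \<gamma> t0] by (simp add: V0_def)
  have sp: "speed \<gamma> t < V0" if "t \<in> {0..1}" for t
    using geodesic_speed_const[OF \<gamma> that t0] by (simp add: V0_def)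
  define V where "V = V0 / n"
  define K where "K = (B * V\<^sup>2 + 2 * B * V + B * (B * V\<^sup>2 / m)) / m"
  have K: "K \<ge> 0" unfolding K_def V_def using est n V0 by simp
  \<comment> \<open>Times in \<open>T\<close> differ by at most \<open>2 * \<tau>\<close>, in which
    a geodesic of speed below \<open>V0\<close> covers length at most \<open>n * \<rho> / 4\<close>.
    So \<open>\<gamma>\<close> stays in the ball of radius \<open>\<rho> / 4\<close>, and
    \<open>\<Gamma> i\<close>, which eventually starts in that ball at time \<open>t1\<close>, stays
    in the ball of radius \<open>\<rho>\<close>.\<close>
  define \<tau> where "\<tau> = n * \<rho> / (8 * V0)"
  have \<tau>: "\<tau> > 0" "V0 * \<tau> = n * \<rho> / 8" unfolding \<tau>_def using est n V0 by auto
  define T where "T = {0..1} \<inter> ball t0 \<tau>"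
  have stay: "\<gamma> t \<in> cdom c \<and> cmap c (\<gamma> t) \<in> ball u0 (\<rho> / 4)" if t: "t \<in> T" for t
  proof (rule geodesic_stays_in_ball[OF \<gamma> c(1) _ n(1) _ t0])
    have "speed \<gamma> t0 * \<bar>t - t0\<bar> \<le> V0 * \<tau>"
      by (rule mult_mono) (use sp[OF t0] V0 t in \<open>auto simp: T_def dist_real_def\<close>)
    also have "\<dots> < n * (\<rho> / 4)" using \<tau>(2) mult_pos_pos[OF n(1) est(1)] by simp
    finally show "speed \<gamma> t0 * \<bar>t - t0\<bar> < n * (\<rho> / 4 - dist u0 (cmap c (\<gamma> t0)))"
      by (simp add: u0_def)
    show "cball u0 (\<rho> / 4) \<subseteq> cmap c ` cdom c" using est by auto
    show "n\<^sup>2 * (norm a)\<^sup>2 \<le> metric_in M c u a a" if "u \<in> cball u0 (\<rho> / 4)" for u a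
      unfolding n by (rule low) (use that est in auto)
  qed (use t c est in \<open>auto simp: T_def u0_def\<close>)
  have vbound: "norm (velocity_in c \<sigma> t) \<le> V" if \<sigma>: "geodesic M \<sigma>" "speed \<sigma> t \<le> V0" "t \<in> {0..1}"
      "\<sigma> t \<in> cdom c" "cmap c (\<sigma> t) \<in> cball u0 \<rho>" for \<sigma> t
  proof -
    have "(n * norm (velocity_in c \<sigma> t))\<^sup>2 \<le> (speed \<sigma> t)\<^sup>2"
      using low[OF \<sigma>(5), of "velocity_in c \<sigma> t"]
      unfolding speed_chart[OF c(1) geodesic_Ck_curve[OF \<sigma>(1)] \<sigma>(3,4)] power_mult_distrib n
      by (simp add: metric_in_nonneg)
    then have "n * norm (velocity_in c \<sigma> t) \<le> speed \<sigma> t"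
      using speed_nonneg by (rule power2_le_imp_le)
    then show ?thesis using \<sigma>(2) n unfolding V_def by (simp add: field_simps)
  qed
  have main: "C1_converges \<Gamma> F \<gamma> t2" if t: "t1 \<in> T" "t2 \<in> T" and conv: "C1_converges \<Gamma> F \<gamma> t1" for t1 t2
  proof -
    have t01: "t1 \<in> {0..1}" "t2 \<in> {0..1}" using t by (auto simp: T_def)
    note st = stay[OF t(1)] stay[OF t(2)]
    have limP: "((\<lambda>i. \<Gamma> i t1) \<longlongrightarrow> \<gamma> t1) F" and limV: "((\<lambda>i. velocity_in c (\<Gamma> i) t1) \<longlongrightarrow> velocity_in c \<gamma> t1) F"
      using conv c(1) st unfolding C1_converges_def by auto
    have limU: "((\<lambda>i. cmap c (\<Gamma> i t1)) \<longlongrightarrow> cmap c (\<gamma> t1)) F"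
      by (rule tendsto_cmap[OF c(1) limP]) (use st in auto)
    have ev1: "\<forall>\<^sub>F i in F. \<Gamma> i t1 \<in> cdom c"
      by (rule topological_tendstoD[OF limP]) (use c open_cdom st in auto)
    have ev2: "\<forall>\<^sub>F i in F. cmap c (\<Gamma> i t1) \<in> ball u0 (\<rho> / 4)"
      by (rule topological_tendstoD[OF limU]) (use st in auto)
    have "((\<lambda>i. sqrt (metric_in M c (cmap c (\<Gamma> i t1)) (velocity_in c (\<Gamma> i) t1) (velocity_in c (\<Gamma> i) t1)))
        \<longlongrightarrow> sqrt (metric_in M c (cmap c (\<gamma> t1)) (velocity_in c \<gamma> t1) (velocity_in c \<gamma> t1))) F"
      by (intro tendsto_real_sqrt tendsto_metric_in c limU limV) (use st in auto)
    moreover have "sqrt (metric_in M c (cmap c (\<gamma> t1)) (velocity_in c \<gamma> t1) (velocity_in c \<gamma> t1)) < V0"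
      using sp[OF t01(1)] speed_chart[OF c(1) geodesic_Ck_curve[OF \<gamma>] t01(1)] st by simp
    ultimately have ev3: "\<forall>\<^sub>F i in F. sqrt (metric_in M c (cmap c (\<Gamma> i t1)) (velocity_in c (\<Gamma> i) t1) (velocity_in c (\<Gamma> i) t1)) < V0"
      by (rule order_tendstoD(2))
    define p where "p = min t1 t2"
    define q where "q = max t1 t2"
    have pq: "{p..q} \<subseteq> T"
      unfolding p_def q_def using t by (auto simp: T_def dist_real_def)
    have pq01: "{p..q} \<subseteq> {0..1}" using pq by (auto simp: T_def)
    have tpq: "t1 \<in> {p..q}" "t2 \<in> {p..q}" by (auto simp: p_def q_def)
    define E where "E i t = (norm (cmap c (\<Gamma> i t) - cmap c (\<gamma> t)))\<^sup>2 + (norm (velocity_in c (\<Gamma> i) t - velocity_in c \<gamma> t))\<^sup>2" for i t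
    \<comment> \<open>Membership in the chart domain is recorded along with the estimate:
      coordinates of a point outside it would not determine the point.\<close>
    have ev: "\<forall>\<^sub>F i in F. E i t2 \<le> exp ((1 + 3 * K) * \<bar>t2 - t1\<bar>) * E i t1 \<and> \<Gamma> i t2 \<in> cdom c"
      using \<Gamma> ev1 ev2 ev3
    proof eventually_elim
      case (elim i)
      note C = geodesic_Ck_curve[OF elim(1)] and C0 = geodesic_Ck_curve[OF \<gamma>]
      have spi: "speed (\<Gamma> i) t < V0" if "t \<in> {0..1}" for t
        using geodesic_speed_const[OF elim(1) that t01(1)] speed_chart[OF c(1) C t01(1) elim(2)] elim(4) by simp
      have stayi: "\<Gamma> i t \<in> cdom c \<and> cmap c (\<Gamma> i t) \<in> ball u0 \<rho>" if s: "t \<in> {p..q}" for t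
      proof (rule geodesic_stays_in_ball[OF elim(1) c(1) est(4) n(1) _ t01(1)])
        have "\<bar>t - t1\<bar> \<le> 2 * \<tau>" using s pq t by (auto simp: T_def dist_real_def)
        then have "speed (\<Gamma> i) t1 * \<bar>t - t1\<bar> \<le> V0 * (2 * \<tau>)"
          by (intro mult_mono) (use spi[OF t01(1)] V0 in auto)
        also have "\<dots> = n * \<rho> / 4" using \<tau> by simp
        also have "\<dots> < n * (\<rho> - \<rho> / 4)" using n est by simp
        also have "\<dots> \<le> n * (\<rho> - dist u0 (cmap c (\<Gamma> i t1)))"
          using n elim(3) by (intro mult_left_mono) auto
        finally show "speed (\<Gamma> i) t1 * \<bar>t - t1\<bar> < n * (\<rho> - dist u0 (cmap c (\<Gamma> i t1)))" .
      qed (use elim low n est s pq01 in auto)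
      have stay': "\<gamma> t \<in> cdom c" "cmap c (\<gamma> t) \<in> cball u0 \<rho>" if "t \<in> {p..q}" for t
        using stay[of t] that pq est by auto
      have sub: "(f has_vector_derivative f') (at t within {p..q})"
        if "(f has_vector_derivative f') (at t within {0..1})" for f :: "real \<Rightarrow> 'e" and f' t
        using that pq01 has_vector_derivative_within_subset by blast
      have "E i t2 \<le> exp ((1 + 3 * K) * \<bar>t2 - t1\<bar>) * E i t1"
        unfolding E_def
      proof (rule gronwall_second_order[where p=p and q=q and K=K
            and ?u1.0="\<lambda>t. cmap c (\<Gamma> i t)" and ?u2.0="\<lambda>t. cmap c (\<gamma> t)"
            and ?w1.0="\<lambda>t. vector_derivative (velocity_in c (\<Gamma> i)) (at t within {0..1})"
            and ?w2.0="\<lambda>t. vector_derivative (velocity_in c \<gamma>) (at t within {0..1})"])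
        fix t assume s: "t \<in> {p..q}"
        have s01: "t \<in> {0..1}" using s pq01 by auto
        have i: "\<Gamma> i t \<in> cdom c" "cmap c (\<Gamma> i t) \<in> cball u0 \<rho>" using stayi[OF s] by auto
        note j = stay'[OF s]
        show "((\<lambda>t. cmap c (\<Gamma> i t)) has_vector_derivative velocity_in c (\<Gamma> i) t) (at t within {p..q})"
          using sub[OF coord_has_vector_derivative[OF c(1) C s01 i(1)]] by (simp add: comp_def)
        show "((\<lambda>t. cmap c (\<gamma> t)) has_vector_derivative velocity_in c \<gamma> t) (at t within {p..q})"
          using sub[OF coord_has_vector_derivative[OF c(1) C0 s01 j(1)]] by (simp add: comp_def)
        show "(velocity_in c (\<Gamma> i) has_vector_derivative vector_derivative (velocity_in c (\<Gamma> i)) (at t within {0..1})) (at t within {p..q})"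
          by (rule sub[OF velocity_in_has_vector_derivative[OF c(1) C C s01 i(1)]])
        show "(velocity_in c \<gamma> has_vector_derivative vector_derivative (velocity_in c \<gamma>) (at t within {0..1})) (at t within {p..q})"
          by (rule sub[OF velocity_in_has_vector_derivative[OF c(1) C0 C0 s01 j(1)]])
        have vb: "norm (velocity_in c (\<Gamma> i) t) \<le> V" "norm (velocity_in c \<gamma> t) \<le> V"
          using vbound[OF elim(1) less_imp_le[OF spi[OF s01]] s01 i] vbound[OF \<gamma> less_imp_le[OF sp[OF s01]] s01 j] by auto
        show "norm (vector_derivative (velocity_in c (\<Gamma> i)) (at t within {0..1}) - vector_derivative (velocity_in c \<gamma>) (at t within {0..1}))
          \<le> K * (norm (cmap c (\<Gamma> i t) - cmap c (\<gamma> t)) + norm (velocity_in c (\<Gamma> i) t - velocity_in c \<gamma> t))"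
          unfolding K_def
        proof (rule acceleration_diff_bound[OF c(1) _ _ est(2,3) low[OF i(2)] low[OF j(2)] _ _ k[OF i(2)] k[OF j(2)] vb
              geodesic_equation[OF elim(1) c(1) s01 i(1)] geodesic_equation[OF \<gamma> c(1) s01 j(1)]])
          show "\<bar>metric_in M c (cmap c (\<gamma> t)) a b - metric_in M c (cmap c (\<Gamma> i t)) a b\<bar>
              \<le> B * norm (cmap c (\<Gamma> i t) - cmap c (\<gamma> t)) * norm a * norm b" for a b
            using g[OF j(2) i(2), of a b] by (simp add: norm_minus_commute)
          show "\<bar>koszul c (cmap c (\<gamma> t)) a b z - koszul c (cmap c (\<Gamma> i t)) a b z\<bar>
              \<le> B * norm (cmap c (\<Gamma> i t) - cmap c (\<gamma> t)) * norm a * norm b * norm z" for a b z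
            using kd[OF j(2) i(2), of a b z] by (simp add: norm_minus_commute)
        qed (use i j in auto)
      qed (use K tpq in auto)
      then show ?case using stayi[OF tpq(2)] by blast
    qed
    have "((\<lambda>i. (norm (cmap c (\<Gamma> i t1) - cmap c (\<gamma> t1)))\<^sup>2 + (norm (velocity_in c (\<Gamma> i) t1 - velocity_in c \<gamma> t1))\<^sup>2) \<longlongrightarrow>
        (norm (cmap c (\<gamma> t1) - cmap c (\<gamma> t1)))\<^sup>2 + (norm (velocity_in c \<gamma> t1 - velocity_in c \<gamma> t1))\<^sup>2) F"
      by (intro tendsto_intros limU limV)
    then have "((\<lambda>i. E i t1) \<longlongrightarrow> 0) F" by (simp add: E_def)
    then have "((\<lambda>i. sqrt (exp ((1 + 3 * K) * \<bar>t2 - t1\<bar>) * E i t1)) \<longlongrightarrow> sqrt (exp ((1 + 3 * K) * \<bar>t2 - t1\<bar>) * 0)) F"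
      by (intro tendsto_intros)
    then have lim0: "((\<lambda>i. sqrt (exp ((1 + 3 * K) * \<bar>t2 - t1\<bar>) * E i t1)) \<longlongrightarrow> 0) F" by simp
    have evn: "\<forall>\<^sub>F i in F. norm (cmap c (\<Gamma> i t2) - cmap c (\<gamma> t2)) \<le> sqrt (exp ((1 + 3 * K) * \<bar>t2 - t1\<bar>) * E i t1)"
      "\<forall>\<^sub>F i in F. norm (velocity_in c (\<Gamma> i) t2 - velocity_in c \<gamma> t2) \<le> sqrt (exp ((1 + 3 * K) * \<bar>t2 - t1\<bar>) * E i t1)"
      using ev by (eventually_elim, intro real_le_rsqrt, auto simp: E_def intro: order_trans[rotated])+
    have U2: "((\<lambda>i. cmap c (\<Gamma> i t2)) \<longlongrightarrow> cmap c (\<gamma> t2)) F"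
      by (rule Lim_null[THEN iffD2]) (rule Lim_null_comparison[OF evn(1) lim0])
    have V2: "((\<lambda>i. velocity_in c (\<Gamma> i) t2) \<longlongrightarrow> velocity_in c \<gamma> t2) F"
      by (rule Lim_null[THEN iffD2]) (rule Lim_null_comparison[OF evn(2) lim0])
    have st2: "\<gamma> t2 \<in> cdom c" using st by simp
    have "((\<lambda>i. cinv c (cmap c (\<Gamma> i t2))) \<longlongrightarrow> cinv c (cmap c (\<gamma> t2))) F"
      by (rule tendsto_cinv[OF c(1) U2]) (use st2 in auto)
    moreover have "\<forall>\<^sub>F i in F. cinv c (cmap c (\<Gamma> i t2)) = \<Gamma> i t2"
      using ev by eventually_elim (simp add: cinv_cmap[OF c(1)])
    ultimately have P2: "((\<lambda>i. \<Gamma> i t2) \<longlongrightarrow> \<gamma> t2) F"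
      unfolding cinv_cmap[OF c(1) st2] by (rule Lim_transform_eventually)
    show ?thesis
      by (rule C1_convergesI[OF \<gamma> \<Gamma> t01(2) P2 c(1) st2 V2])
  qed
  have "openin (top_of_set {0..1}) T" unfolding T_def by (auto simp: openin_open)
  moreover have "t0 \<in> T" using t0 \<tau> by (simp add: T_def)
  ultimately show ?thesis using main by blast
qed

text \<open>Convergence of position and velocity holds at time 0 and propagates locally both ways,
  so by connectedness of the interval it holds at all times.\<close>

lemma geodesic_dependence:
  assumes \<gamma>: "geodesic M \<gamma>" and \<Gamma>: "\<forall>\<^sub>F i in F. geodesic M (\<Gamma> i) \<and> \<Gamma> i 0 = \<gamma> 0"
    and vel: "((\<lambda>i. velocity M (\<Gamma> i) 0) \<longlongrightarrow> velocity M \<gamma> 0) F" and t: "t \<in> {0..1}"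
  shows "((\<lambda>i. \<Gamma> i t) \<longlongrightarrow> \<gamma> t) F"
proof -
  have \<Gamma>': "\<forall>\<^sub>F i in F. geodesic M (\<Gamma> i)" using \<Gamma> by eventually_elim simp
  let ?c = "chart_at M (\<gamma> 0)"
  have "C1_converges \<Gamma> F \<gamma> 0"
  proof (rule C1_convergesI[OF \<gamma> \<Gamma>' _ _ chart_at])
    show "((\<lambda>i. \<Gamma> i 0) \<longlongrightarrow> \<gamma> 0) F"
      by (rule tendsto_eventually) (use \<Gamma> in eventually_elim, simp)
    have "\<forall>\<^sub>F i in F. velocity M (\<Gamma> i) 0 = velocity_in ?c (\<Gamma> i) 0"
      using \<Gamma> by eventually_elim (simp add: velocity_def)
    with vel show "((\<lambda>i. velocity_in ?c (\<Gamma> i) 0) \<longlongrightarrow> velocity_in ?c \<gamma> 0) F"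
      unfolding velocity_def[of M \<gamma>] by (rule Lim_transform_eventually)
  qed simp
  then have "C1_converges \<Gamma> F \<gamma> t"
    by (rule connected_induction_simple[OF connected_Icc[of 0 "1::real"] _ t, rotated])
      (use geodesic_dependence_local[OF \<gamma> \<Gamma>'] in auto)
  then show ?thesis by (simp add: C1_converges_def)
qed

text \<open>Continuous dependence for a constant sequence: its limit in a Hausdorff space is its
  value.\<close>

lemma geodesic_unique:
  assumes "geodesic M \<gamma>" "geodesic M \<gamma>'" "\<gamma>' 0 = \<gamma> 0" "velocity M \<gamma>' 0 = velocity M \<gamma> 0" "t \<in> {0..1}"
  shows "\<gamma>' t = \<gamma> t"
proof -
  have "((\<lambda>_::nat. \<gamma>' t) \<longlongrightarrow> \<gamma> t) sequentially"
    by (rule geodesic_dependence[OF assms(1) _ _ assms(5)]) (use assms in auto)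
  then show ?thesis by (simp add: tendsto_const_iff)
qed

section \<open>The exponential map\<close>

lemma Exp_eq:
  assumes "geodesic M \<gamma>" "\<gamma> 0 = x" "velocity M \<gamma> 0 = v"
  shows "Exp M x v = \<gamma> 1"
  unfolding Exp_def
proof (rule the_equality)
  show "\<exists>\<sigma>. geodesic M \<sigma> \<and> \<sigma> 0 = x \<and> velocity M \<sigma> 0 = v \<and> \<sigma> 1 = \<gamma> 1" using assms by blast
  fix y assume "\<exists>\<sigma>. geodesic M \<sigma> \<and> \<sigma> 0 = x \<and> velocity M \<sigma> 0 = v \<and> \<sigma> 1 = y"
  then obtain \<sigma> where "geodesic M \<sigma>" "\<sigma> 0 = x" "velocity M \<sigma> 0 = v" "\<sigma> 1 = y" by blast
  then show "y = \<gamma> 1" using geodesic_unique[OF assms(1), of \<sigma> 1] assms by simp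
qed

lemma Exp_scale:
  assumes \<gamma>: "geodesic M \<gamma>" "\<gamma> 0 = x" "velocity M \<gamma> 0 = v" and s: "s \<in> {0..1}"
  shows "Exp M x (s *\<^sub>R v) = \<gamma> s"
proof -
  have "Exp M x (s *\<^sub>R v) = \<gamma> (0 + s * 1)"
  proof (rule Exp_eq)
    show "geodesic M (\<lambda>t. \<gamma> (0 + s * t))" by (rule geodesic_affine[OF \<gamma>(1)]) (use s in auto)
    show "velocity M (\<lambda>t. \<gamma> (0 + s * t)) 0 = s *\<^sub>R v"
      using velocity_affine[OF geodesic_Ck_curve[OF \<gamma>(1)], of 0 s 0] s \<gamma> by simp
  qed (use \<gamma> in simp)
  then show ?thesis by simp
qed

lemma geodesic_Exp:
  assumes "v \<in> exp_domain M x"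
  shows "geodesic M (\<lambda>t. Exp M x (t *\<^sub>R v))" "Exp M x 0 = x" "velocity M (\<lambda>t. Exp M x (t *\<^sub>R v)) 0 = v"
proof -
  obtain \<gamma> where \<gamma>: "geodesic M \<gamma>" "\<gamma> 0 = x" "velocity M \<gamma> 0 = v"
    using assms unfolding exp_domain_def by blast
  have eq: "\<gamma> t = Exp M x (t *\<^sub>R v)" if "t \<in> {0..1}" for t
    using Exp_scale[OF \<gamma> that] by simp
  show "geodesic M (\<lambda>t. Exp M x (t *\<^sub>R v))" by (rule geodesic_cong[OF eq \<gamma>(1)])
  show "Exp M x 0 = x" using eq[of 0] \<gamma> by simp
  have "velocity M \<gamma> 0 = velocity M (\<lambda>t. Exp M x (t *\<^sub>R v)) 0"
    by (rule velocity_cong) (use eq in auto)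
  then show "velocity M (\<lambda>t. Exp M x (t *\<^sub>R v)) 0 = v" using \<gamma> by simp
qed

text \<open>Continuity is relative to \<open>exp_domain\<close>, whatever its shape; openness will
  come from a tangent ball contained in it.\<close>

lemma continuous_on_Exp: "continuous_on (exp_domain M x) (Exp M x)"
  unfolding continuous_on_def
proof
  fix v assume v: "v \<in> exp_domain M x"
  let ?F = "at v within exp_domain M x"
  have "\<forall>\<^sub>F w in ?F. w \<in> exp_domain M x" by (auto simp: eventually_at_filter)
  then have ev: "\<forall>\<^sub>F w in ?F. geodesic M (\<lambda>t. Exp M x (t *\<^sub>R w)) \<and> Exp M x (0 *\<^sub>R w) = Exp M x (0 *\<^sub>R v)"
    and ev': "\<forall>\<^sub>F w in ?F. w = velocity M (\<lambda>t. Exp M x (t *\<^sub>R w)) 0"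
    by (eventually_elim, simp add: geodesic_Exp)+
  have "((\<lambda>w. w) \<longlongrightarrow> v) ?F" by (rule tendsto_ident_at)
  from Lim_transform_eventually[OF this ev']
  have "((\<lambda>w. velocity M (\<lambda>t. Exp M x (t *\<^sub>R w)) 0) \<longlongrightarrow> velocity M (\<lambda>t. Exp M x (t *\<^sub>R v)) 0) ?F"
    by (simp add: geodesic_Exp(3)[OF v])
  from geodesic_dependence[OF geodesic_Exp(1)[OF v] ev this, of 1]
  show "(Exp M x \<longlongrightarrow> Exp M x v) ?F" by simp
qed

section \<open>Logarithms and Riemannian distance\<close>

lemma tnorm_eq_0_iff: "tnorm M x v = 0 \<longleftrightarrow> v = 0"
  using inner_product_rmetric[of x] bilinear_lzero[of "rmetric M x" v]
  unfolding inner_product_def tnorm_def by (cases "v = 0") force+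

text \<open>A geodesic has constant speed, so its length is the norm of its initial
  velocity.\<close>

lemma log_range_dist:
  assumes "v \<in> log_range M C x"
  shows "ennreal (tnorm M x v) = riem_dist M x (Exp M x v)"
proof -
  let ?\<gamma> = "\<lambda>t. Exp M x (t *\<^sub>R v)"
  have v: "v \<in> exp_domain M x" "minimizing_geodesic M ?\<gamma>" using assms by (auto simp: log_range_def)
  have "curve_length M ?\<gamma> = speed ?\<gamma> 0"
    by (rule geodesic_length[OF geodesic_Exp(1)[OF v(1)]]) simp
  also have "\<dots> = tnorm M x v"
    unfolding speed_def geodesic_Exp(3)[OF v(1)] by (simp add: geodesic_Exp(2)[OF v(1)])
  finally show ?thesis
    using v(2) unfolding minimizing_geodesic_def by (simp add: geodesic_Exp(2)[OF v(1)])
qed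

text \<open>Supplies elements of \<open>log_range\<close>; only on endpoints reached by such
  elements does the \<open>inv_into\<close> behind \<open>Exp_inv\<close> invert anything.\<close>

lemma velocity_in_log_range:
  assumes \<gamma>: "minimizing_geodesic M \<gamma>" "\<gamma> 0 = x" "\<gamma> 1 \<in> C"
  shows "velocity M \<gamma> 0 \<in> log_range M C x" "Exp M x (velocity M \<gamma> 0) = \<gamma> 1"
proof -
  let ?v = "velocity M \<gamma> 0"
  have g: "geodesic M \<gamma>" using \<gamma> by (simp add: minimizing_geodesic_def)
  have eq: "\<gamma> t = Exp M x (t *\<^sub>R ?v)" if "t \<in> {0..1}" for t
    using Exp_scale[OF g \<gamma>(2) refl that] by simp
  show e: "Exp M x ?v = \<gamma> 1" using eq[of 1] by simp
  have dom: "?v \<in> exp_domain M x" using g \<gamma>(2) by (auto simp: exp_domain_def)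
  have "curve_length M \<gamma> = curve_length M (\<lambda>t. Exp M x (t *\<^sub>R ?v))"
    by (rule curve_length_cong[OF eq])
  then have "minimizing_geodesic M (\<lambda>t. Exp M x (t *\<^sub>R ?v))"
    using \<gamma>(1,2) geodesic_Exp[OF dom] e by (simp add: minimizing_geodesic_def)
  then show "?v \<in> log_range M C x"
    using dom e \<gamma>(3) by (simp add: log_range_def)
qed

end

section \<open>Riemannian balls inside a strongly convex set\<close>

context riemannian_mfd
begin

section \<open>Lower bounds for lengths, and interior points\<close>

lemma curve_length_reverse:
  assumes \<gamma>: "Ck_curve (Suc 0) M \<gamma>"
  shows "curve_length M (\<lambda>s. \<gamma> (1 + (- 1) * s)) = curve_length M \<gamma>"
proof -
  have "(speed \<gamma> has_integral curve_length M \<gamma>) (cbox 0 1)"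
    using speed_integrable[OF \<gamma>, of 0 1] unfolding curve_length_speed by (simp add: integrable_integral)
  from has_integral_affinity[OF this, of "- 1" 1]
  have "((\<lambda>s. speed \<gamma> (1 + (- 1) * s)) has_integral curve_length M \<gamma>) {0..1}"
    by (simp add: algebra_simps)
  then have "integral {0..1} (\<lambda>s. speed \<gamma> (1 + (- 1) * s)) = curve_length M \<gamma>"
    by (rule integral_unique)
  moreover have "curve_length M (\<lambda>s. \<gamma> (1 + (- 1) * s)) = integral {0..1} (\<lambda>s. speed \<gamma> (1 + (- 1) * s))"
    unfolding curve_length_speed
    by (rule integral_cong) (use speed_affine[OF \<gamma>, of 1 "- 1"] in auto)
  ultimately show ?thesis by simp
qed

lemma curve_length_nonneg: "Ck_curve (Suc 0) M \<gamma> \<Longrightarrow> 0 \<le> curve_length M \<gamma>"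
  unfolding curve_length_speed by (rule integral_nonneg) (use speed_integrable[of \<gamma> 0 1] speed_nonneg in auto)

lemma riem_dist_le_length:
  "Ck_curve (Suc 0) M \<gamma> \<Longrightarrow> riem_dist M (\<gamma> 0) (\<gamma> 1) \<le> ennreal (curve_length M \<gamma>)"
  unfolding riem_dist_def by (rule INF_lower) simp

text \<open>The curve has to cross a coordinate ball around \<open>z\<close> contained in
  \<open>U\<close>. It is reversed so that it starts at the centre and escapes.\<close>

lemma length_ending_outside_nhd:
  assumes U: "open U" "z \<in> U"
  obtains \<delta> where "\<delta> > 0"
    "\<And>\<gamma>. Ck_curve (Suc 0) M \<gamma> \<Longrightarrow> \<gamma> 0 \<notin> U \<Longrightarrow> \<gamma> 1 = z \<Longrightarrow> \<delta> \<le> curve_length M \<gamma>"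
proof -
  define c where "c = chart_at M z"
  define u0 where "u0 = cmap c z"
  have c: "c \<in> atlas M" "z \<in> cdom c" using chart_at by (auto simp: c_def)
  have u0: "u0 \<in> cmap c ` cdom c" using c by (auto simp: u0_def)
  obtain \<rho> m where est: "\<rho> > 0" "m > 0" "cball u0 \<rho> \<subseteq> cmap c ` cdom c"
    and low: "\<And>u a. u \<in> cball u0 \<rho> \<Longrightarrow> m * (norm a)\<^sup>2 \<le> metric_in M c u a a"
    by (rule chart_estimates[OF c(1) u0]) (rule that)
  have "open (cmap c ` (cdom c \<inter> U))" "u0 \<in> cmap c ` (cdom c \<inter> U)"
    using open_cmap_Int[OF c(1) U(1)] c U by (auto simp: u0_def)
  then obtain \<rho>' where \<rho>': "\<rho>' > 0" "cball u0 \<rho>' \<subseteq> cmap c ` (cdom c \<inter> U)"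
    using open_contains_cball[of "cmap c ` (cdom c \<inter> U)"] by blast
  define r where "r = min \<rho> \<rho>'"
  have r: "r > 0" "cball u0 r \<subseteq> cball u0 \<rho>" "cball u0 r \<subseteq> cball u0 \<rho>'" using est \<rho>' by (auto simp: r_def)
  show ?thesis
  proof (rule that[of "sqrt m * r"])
    show "sqrt m * r > 0" using est r by simp
    fix \<gamma> assume \<gamma>: "Ck_curve (Suc 0) M \<gamma>" "\<gamma> 0 \<notin> U" "\<gamma> 1 = z"
    define \<sigma> where "\<sigma> = (\<lambda>s. \<gamma> (1 + (- 1) * s))"
    have \<sigma>: "Ck_curve (Suc 0) M \<sigma>" unfolding \<sigma>_def by (rule Ck_curve_affine[OF \<gamma>(1)]) auto
    have e: "\<sigma> 0 = z" "\<sigma> 1 = \<gamma> 0" using \<gamma> by (auto simp: \<sigma>_def)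
    have "sqrt m * (r - dist u0 (cmap c (\<sigma> 0))) \<le> integral {0..1} (speed \<sigma>)"
    proof (rule length_escaping_ball[OF \<sigma> c(1)])
      show "(sqrt m)\<^sup>2 * (norm a)\<^sup>2 \<le> metric_in M c u a a" if "u \<in> cball u0 r" for u a
        using low[of u a] that r est by auto
      show "\<not> (\<sigma> 1 \<in> cdom c \<and> cmap c (\<sigma> 1) \<in> ball u0 r)"
      proof
        assume *: "\<sigma> 1 \<in> cdom c \<and> cmap c (\<sigma> 1) \<in> ball u0 r"
        then have "cmap c (\<sigma> 1) \<in> cball u0 r" by simp
        then have "cmap c (\<sigma> 1) \<in> cmap c ` (cdom c \<inter> U)" using r(3) \<rho>'(2) by blast
        then obtain y where "y \<in> cdom c" "y \<in> U" "cmap c (\<sigma> 1) = cmap c y" by auto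
        then have "\<sigma> 1 = y" using * cinv_cmap[OF c(1)] by metis
        then show False using \<open>y \<in> U\<close> \<gamma> e by simp
      qed
    qed (use r est c in \<open>auto simp: e u0_def\<close>)
    then show "sqrt m * r \<le> curve_length M \<gamma>"
      using curve_length_reverse[OF \<gamma>(1)] unfolding \<sigma>_def[symmetric] curve_length_speed[of \<sigma>]
      by (simp add: e u0_def)
  qed
qed

lemma open_tnorm_ball: "open {v. tnorm M x v < r}"
proof -
  have bil: "bilinear (rmetric M x)" using inner_product_rmetric by (auto simp: inner_product_def)
  have "continuous_on UNIV (\<lambda>v. rmetric M x v v)"
    unfolding bilinear_basis_expansion[OF bil, of v v for v] by (intro continuous_intros)
  then have "continuous_on UNIV (tnorm M x)"
    unfolding tnorm_def[abs_def] by (intro continuous_intros)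
  then show ?thesis
    by (intro open_Collect_less continuous_intros)
qed

text \<open>Invariance of domain concerns maps of a Euclidean space, so \<open>W\<close> is cut down
  to the vectors whose image lies in the chart around \<open>Exp M x v\<close>. Tangent spaces and
  charts share the model \<open>'e\<close>, hence the dimensions agree.\<close>

lemma interior_Exp_image:
  assumes W: "open W" "W \<subseteq> exp_domain M x" "inj_on (Exp M x) W" "Exp M x ` W \<subseteq> C" and v: "v \<in> W"
  shows "Exp M x v \<in> interior C"
proof -
  define c where "c = chart_at M (Exp M x v)"
  have c: "c \<in> atlas M" "Exp M x v \<in> cdom c" using chart_at by (auto simp: c_def)
  have cont: "continuous_on W (Exp M x)" by (rule continuous_on_subset[OF continuous_on_Exp W(2)])
  define W' where "W' = W \<inter> Exp M x -` cdom c"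
  have W': "open W'" unfolding W'_def by (rule continuous_open_preimage[OF cont W(1) open_cdom[OF c(1)]])
  have "open ((cmap c \<circ> Exp M x) ` W')"
  proof (rule invariance_of_domain[OF _ W'])
    show "continuous_on W' (cmap c \<circ> Exp M x)"
      by (intro continuous_on_compose continuous_on_subset[OF cont] continuous_on_subset[OF continuous_cmap[OF c(1)]])
        (auto simp: W'_def)
    show "inj_on (cmap c \<circ> Exp M x) W'"
    proof (rule comp_inj_on)
      show "inj_on (Exp M x) W'" using W(3) by (rule inj_on_subset) (auto simp: W'_def)
      show "inj_on (cmap c) (Exp M x ` W')"
        by (rule inj_on_inverseI[where g="cinv c"]) (use cinv_cmap[OF c(1)] in \<open>auto simp: W'_def\<close>)
    qed
  qed
  then have "open {y \<in> cdom c. cmap c y \<in> (cmap c \<circ> Exp M x) ` W'}"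
    by (rule open_chart_preimage[OF c(1)])
  moreover have "{y \<in> cdom c. cmap c y \<in> (cmap c \<circ> Exp M x) ` W'} \<subseteq> C"
  proof
    fix y assume "y \<in> {y \<in> cdom c. cmap c y \<in> (cmap c \<circ> Exp M x) ` W'}"
    then obtain v' where "y \<in> cdom c" "v' \<in> W" "Exp M x v' \<in> cdom c" "cmap c y = cmap c (Exp M x v')"
      by (auto simp: W'_def)
    then show "y \<in> C" using cinv_cmap[OF c(1)] W(4) by (metis image_subset_iff)
  qed
  moreover have "Exp M x v \<in> {y \<in> cdom c. cmap c y \<in> (cmap c \<circ> Exp M x) ` W'}"
    using v c by (auto simp: W'_def)
  ultimately show ?thesis using interiorI by metis
qed

text \<open>A curve leaving \<open>C\<close> for good does so at a non-interior point, hence at distance at least \<open>r\<close>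
  from \<open>x\<close>; the remaining piece has length bounded below because \<open>z\<close> has a neighbourhood avoiding \<open>C\<close>.
  This replaces the Hopf-Rinow theorem.\<close>

lemma riem_ball_subset:
  assumes C: "closed C" "x \<in> C" and r: "r > 0"
    and int: "\<And>u. u \<in> C \<Longrightarrow> riem_dist M x u < ennreal r \<Longrightarrow> u \<in> interior C"
    and z: "riem_dist M x z \<le> ennreal r"
  shows "z \<in> C"
proof (rule ccontr)
  assume zC: "z \<notin> C"
  obtain \<delta> where \<delta>: "\<delta> > 0"
    "\<And>\<gamma>. Ck_curve (Suc 0) M \<gamma> \<Longrightarrow> \<gamma> 0 \<notin> - C \<Longrightarrow> \<gamma> 1 = z \<Longrightarrow> \<delta> \<le> curve_length M \<gamma>"
    using length_ending_outside_nhd[of "- C" z] C zC by auto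
  \<comment> \<open>A gain \<open>\<delta>\<close> common to all curves survives the infimum; a
    strict inequality for each curve separately would not.\<close>
  have "ennreal (r + \<delta>) \<le> riem_dist M x z"
    unfolding riem_dist_def
  proof (rule INF_greatest)
    fix \<gamma> assume "\<gamma> \<in> {\<gamma>. Ck_curve 1 M \<gamma> \<and> \<gamma> 0 = x \<and> \<gamma> 1 = z}"
    then have \<gamma>: "Ck_curve (Suc 0) M \<gamma>" "\<gamma> 0 = x" "\<gamma> 1 = z" by auto
    note cont = Ck_curve_continuous[OF \<gamma>(1)]
    define T where "T = {0..1} \<inter> \<gamma> -` C"
    have "closedin (top_of_set {0..1}) T"
      unfolding T_def by (rule continuous_closedin_preimage[OF cont C(1)])
    then have clT: "closed T" using closedin_closed_trans closed_real_atLeastAtMost by blast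
    \<comment> \<open>The last time in \<open>C\<close>. At an interior point of \<open>C\<close>
      the curve would remain in \<open>C\<close> a little longer, contradicting this choice.\<close>
    define s where "s = Sup T"
    have T: "0 \<in> T" "bdd_above T" using \<gamma> C by (auto simp: T_def)
    have sT: "s \<in> T" unfolding s_def by (rule closed_contains_Sup) (use T clT in auto)
    have s: "0 \<le> s" "s \<le> 1" "\<gamma> s \<in> C" using sT by (auto simp: T_def)
    have s1: "s < 1" using s zC \<gamma> by (cases "s = 1") auto
    have "\<gamma> s \<notin> interior C"
    proof
      assume i: "\<gamma> s \<in> interior C"
      have "(\<gamma> \<longlongrightarrow> \<gamma> s) (at s within {0..1})" using cont s by (auto simp: continuous_on_def)
      then have "\<forall>\<^sub>F t in at s within {0..1}. \<gamma> t \<in> interior C"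
        by (rule topological_tendstoD) (use i in auto)
      then obtain e where e: "e > 0" "\<And>t. t \<in> {0..1} \<Longrightarrow> t \<noteq> s \<Longrightarrow> dist t s < e \<Longrightarrow> \<gamma> t \<in> interior C"
        unfolding eventually_at by auto
      define t where "t = min 1 (s + e / 2)"
      have t: "t \<in> {0..1}" "s < t" "dist t s < e" using s s1 e(1) by (auto simp: t_def dist_real_def min_def)
      then have "\<gamma> t \<in> interior C" by (intro e(2)) auto
      then have "t \<in> T" using interior_subset[of C] t by (auto simp: T_def)
      then have "t \<le> s" unfolding s_def using T(2) by (rule cSup_upper)
      then show False using t by simp
    qed
    then have far: "ennreal r \<le> riem_dist M x (\<gamma> s)"
      using int[OF s(3)] by (meson not_le)
    define \<gamma>1 where "\<gamma>1 = (\<lambda>\<tau>. \<gamma> (0 + s * \<tau>))"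
    define \<gamma>2 where "\<gamma>2 = (\<lambda>\<tau>. \<gamma> (s + (1 - s) * \<tau>))"
    have len1: "curve_length M \<gamma>1 = integral {0..s} (speed \<gamma>)"
      unfolding \<gamma>1_def using curve_length_affine[OF \<gamma>(1), of 0 s] s by simp
    have len2: "curve_length M \<gamma>2 = integral {s..1} (speed \<gamma>)"
      unfolding \<gamma>2_def using curve_length_affine[OF \<gamma>(1), of s "1 - s"] s by simp
    have C1: "Ck_curve (Suc 0) M \<gamma>1" unfolding \<gamma>1_def by (rule Ck_curve_affine[OF \<gamma>(1)]) (use s in auto)
    have C2: "Ck_curve (Suc 0) M \<gamma>2" unfolding \<gamma>2_def by (rule Ck_curve_affine[OF \<gamma>(1)]) (use s in auto)
    have "ennreal r \<le> ennreal (curve_length M \<gamma>1)"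
      using far riem_dist_le_length[OF C1] \<gamma> by (simp add: \<gamma>1_def)
    then have "r \<le> curve_length M \<gamma>1"
      using curve_length_nonneg[OF C1] by simp
    moreover have "\<delta> \<le> curve_length M \<gamma>2"
      by (rule \<delta>(2)[OF C2]) (use s \<gamma> in \<open>auto simp: \<gamma>2_def\<close>)
    moreover have "integral {0..s} (speed \<gamma>) + integral {s..1} (speed \<gamma>) = curve_length M \<gamma>"
      unfolding curve_length_speed using s speed_integrable[OF \<gamma>(1), of 0 1]
      by (intro Henstock_Kurzweil_Integration.integral_combine) auto
    ultimately show "ennreal (r + \<delta>) \<le> ennreal (curve_length M \<gamma>)"
      using len1 len2 by (intro ennreal_leI) simp
  qed
  then have "ennreal (r + \<delta>) \<le> ennreal r" using z by (rule order_trans)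
  then show False using \<delta>(1) r by simp
qed

section \<open>A strongly convex set seen from its own points\<close>

context
  fixes C \<alpha>
  assumes conv: "uniquely_geodesically_convex M C" and str: "riemannian_strongly_convex M \<alpha> C"
begin

lemma minimizing_in:
  assumes "x \<in> C" "y \<in> C"
  obtains \<gamma> where "minimizing_geodesic M \<gamma>" "geodesic_in M C x y \<gamma>"
  using conv assms unfolding uniquely_geodesically_convex_def geodesically_convex_def by blast

lemma geodesic_in_unique:
  assumes "x \<in> C" "y \<in> C" "geodesic_in M C x y \<gamma>" "geodesic_in M C x y \<gamma>'" "t \<in> {0..1}"
  shows "\<gamma> t = \<gamma>' t"
proof -
  obtain \<sigma> where \<sigma>: "\<And>\<gamma>' t. geodesic_in M C x y \<gamma>' \<Longrightarrow> t \<in> {0..1} \<Longrightarrow> \<gamma>' t = \<sigma> t"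
    using conv assms(1,2) unfolding uniquely_geodesically_convex_def uniquely_geodesic_def by blast
  show ?thesis using \<sigma>[OF assms(3,5)] \<sigma>[OF assms(4,5)] by simp
qed

text \<open>Uniqueness within \<open>C\<close> identifies the given geodesic with the minimizing one
  that convexity provides.\<close>

lemma geodesic_in_length:
  assumes "x \<in> C" "y \<in> C" "geodesic_in M C x y \<gamma>"
  shows "ennreal (curve_length M \<gamma>) = riem_dist M x y"
proof -
  obtain \<sigma> where \<sigma>: "minimizing_geodesic M \<sigma>" "geodesic_in M C x y \<sigma>"
    by (rule minimizing_in[OF assms(1,2)])
  have "curve_length M \<gamma> = curve_length M \<sigma>"
    by (rule curve_length_cong) (rule geodesic_in_unique[OF assms \<sigma>(2)])
  then show ?thesis using \<sigma> by (simp add: minimizing_geodesic_def geodesic_in_def)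
qed

lemma Exp_inv_works:
  assumes "x \<in> C" "z \<in> C"
  shows "Exp_inv M C x z \<in> log_range M C x" "Exp M x (Exp_inv M C x z) = z"
proof -
  obtain \<sigma> where \<sigma>: "minimizing_geodesic M \<sigma>" "geodesic_in M C x z \<sigma>"
    by (rule minimizing_in[OF assms])
  have "z \<in> Exp M x ` log_range M C x"
    using velocity_in_log_range[OF \<sigma>(1), of x C] \<sigma>(2) assms by (force simp: geodesic_in_def)
  then show "Exp_inv M C x z \<in> log_range M C x" "Exp M x (Exp_inv M C x z) = z"
    unfolding Exp_inv_def by (auto intro: inv_into_into f_inv_into_f)
qed

text \<open>The constant curve, a reparametrization with factor 0, shows that \<open>x\<close> has
  distance zero from itself, and the norm of a logarithm is that distance.\<close>

lemma Exp_inv_self: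
  assumes "x \<in> C"
  shows "Exp_inv M C x x = 0"
proof -
  obtain \<sigma> where \<sigma>: "minimizing_geodesic M \<sigma>" "geodesic_in M C x x \<sigma>"
    by (rule minimizing_in[OF assms assms])
  have g: "Ck_curve (Suc 0) M \<sigma>" "\<sigma> 0 = x"
    using \<sigma> geodesic_Ck_curve by (auto simp: geodesic_in_def)
  have "Ck_curve (Suc 0) M (\<lambda>s. \<sigma> (0 + 0 * s))" by (rule Ck_curve_affine[OF g(1)]) auto
  from riem_dist_le_length[OF this] have "riem_dist M x x \<le> 0"
    using curve_length_affine[OF g(1), of 0 0] g(2) by simp
  moreover have "ennreal (tnorm M x (Exp_inv M C x x)) = riem_dist M x x"
    using log_range_dist[OF Exp_inv_works(1)[OF assms assms]] Exp_inv_works(2)[OF assms assms] by simp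
  ultimately have "tnorm M x (Exp_inv M C x x) \<le> 0" by (simp add: ennreal_eq_0_iff)
  then have "tnorm M x (Exp_inv M C x x) = 0"
    using rmetric_nonneg by (simp add: tnorm_def order_antisym)
  then show ?thesis by (simp add: tnorm_eq_0_iff)
qed

text \<open>\<open>Exp_inv\<close> chooses among all minimizing geodesics of \<open>M\<close>, including those that leave \<open>C\<close>;
  star-shapedness of its image about \<open>0\<close> forces the chosen geodesic to stay in \<open>C\<close>.\<close>

lemma geodesic_in_Exp:
  assumes x: "x \<in> C" and v: "v \<in> Exp_inv M C x ` C"
  shows "geodesic_in M C x (Exp M x v) (\<lambda>t. Exp M x (t *\<^sub>R v))"
proof -
  have dom: "v \<in> exp_domain M x" using v Exp_inv_works(1)[OF x] by (auto simp: log_range_def)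
  have K: "convex (Exp_inv M C x ` C)" "0 \<in> Exp_inv M C x ` C"
    using str x Exp_inv_self[OF x] unfolding riemannian_strongly_convex_def strongly_convex_set_def
    by (auto intro: rev_image_eqI)
  have "Exp M x (t *\<^sub>R v) \<in> C" if "t \<in> {0..1}" for t
  proof -
    have "t *\<^sub>R v \<in> Exp_inv M C x ` C"
      using convexD_alt[OF K(1) K(2) v, of t] that by simp
    then show ?thesis using Exp_inv_works(2)[OF x] by auto
  qed
  then show ?thesis
    using geodesic_Exp[OF dom] by (auto simp: geodesic_in_def simp del: atLeastAtMost_iff)
qed

text \<open>Both sides are initial velocities of geodesics from \<open>x\<close> to \<open>y\<close>
  inside \<open>C\<close>. This ties the choice made by \<open>Exp_inv\<close> to the given
  curve.\<close>

lemma velocity_eq_Exp_inv: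
  assumes x: "x \<in> C" and y: "y \<in> C" and \<gamma>: "geodesic_in M C x y \<gamma>"
  shows "velocity M \<gamma> 0 = Exp_inv M C x y"
proof -
  let ?v = "Exp_inv M C x y"
  have dom: "?v \<in> exp_domain M x" using Exp_inv_works(1)[OF x y] by (auto simp: log_range_def)
  have "geodesic_in M C x y (\<lambda>t. Exp M x (t *\<^sub>R ?v))"
    using geodesic_in_Exp[OF x, of ?v] Exp_inv_works(2)[OF x y] y by auto
  then have "velocity M \<gamma> 0 = velocity M (\<lambda>t. Exp M x (t *\<^sub>R ?v)) 0"
    by (intro velocity_cong geodesic_in_unique[OF x y \<gamma>]) auto
  then show ?thesis by (simp add: geodesic_Exp(3)[OF dom])
qed

lemma tangent_ball_subset_Exp_inv:
  assumes x: "x \<in> C" and y: "y \<in> C" and \<gamma>: "geodesic_in M C x y \<gamma>" and t: "t \<in> {0..1}"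
    and v: "tnorm M (\<gamma> t) v < \<alpha> * t * (1 - t) * (curve_length M \<gamma>)\<^sup>2"
  shows "v \<in> Exp_inv M C (\<gamma> t) ` C"
proof -
  let ?w = "\<gamma> t"
  let ?K = "Exp_inv M C ?w ` C"
  let ?g = "velocity M \<gamma> t"
  define r where "r = \<alpha> * t * (1 - t) * (curve_length M \<gamma>)\<^sup>2"
  have geo: "geodesic M \<gamma>" "\<gamma> 0 = x" "\<gamma> 1 = y" "\<gamma> ` {0..1} \<subseteq> C"
    using \<gamma> by (auto simp: geodesic_in_def)
  have w: "?w \<in> C" using geo t by blast
  \<comment> \<open>Used with \<open>b = - t\<close> and \<open>b = 1 - t\<close>, the pieces
    running from \<open>\<gamma> t\<close> back to \<open>x\<close> and on to
    \<open>y\<close>.\<close>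
  have piece: "b *\<^sub>R ?g \<in> ?K" if b: "t + b \<in> {0..1}" for b
  proof -
    have "(\<lambda>s. \<gamma> (t + b * s)) ` {0..1} \<subseteq> C"
      using geo(4) affine_01[OF t b] by blast
    then have "geodesic_in M C ?w (\<gamma> (t + b)) (\<lambda>s. \<gamma> (t + b * s))"
      using geodesic_affine[OF geo(1) t b] by (simp add: geodesic_in_def)
    moreover have "\<gamma> (t + b) \<in> C" using geo(4) b by blast
    ultimately have "velocity M (\<lambda>s. \<gamma> (t + b * s)) 0 \<in> ?K"
      using velocity_eq_Exp_inv[OF w] by simp
    then show ?thesis
      using velocity_affine[OF geodesic_Ck_curve[OF geo(1)] t b, of 0] by simp
  qed
  have p: "(- t) *\<^sub>R ?g \<in> ?K" and q: "(1 - t) *\<^sub>R ?g \<in> ?K" by (rule piece, use t in simp)+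
  have K: "convex ?K" and S: "\<And>p q t z. p \<in> ?K \<Longrightarrow> q \<in> ?K \<Longrightarrow> t \<in> {0..1} \<Longrightarrow> sqrt (rmetric M ?w z z) = 1 \<Longrightarrow>
      (1 - t) *\<^sub>R p + t *\<^sub>R q + (\<alpha> * t * (1 - t) * (sqrt (rmetric M ?w (p - q) (p - q)))\<^sup>2) *\<^sub>R z \<in> ?K"
    using str w unfolding riemannian_strongly_convex_def strongly_convex_set_def by blast+
  \<comment> \<open>The two logarithms differ by minus the velocity, whose norm is the constant
    speed and thus the length of \<open>\<gamma>\<close>; their combination with weights
    \<open>1 - t\<close> and \<open>t\<close> vanishes.\<close>
  have sphere: "r *\<^sub>R z \<in> ?K" if "tnorm M ?w z = 1" for z
  proof -
    have "(- t) *\<^sub>R ?g - (1 - t) *\<^sub>R ?g = (- 1) *\<^sub>R ?g" by (simp add: algebra_simps)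
    then have "sqrt (rmetric M ?w ((- t) *\<^sub>R ?g - (1 - t) *\<^sub>R ?g) ((- t) *\<^sub>R ?g - (1 - t) *\<^sub>R ?g)) = tnorm M ?w ((- 1) *\<^sub>R ?g)"
      unfolding tnorm_def by simp
    also have "\<dots> = speed \<gamma> t" unfolding tnorm_scale speed_def by simp
    also have "\<dots> = curve_length M \<gamma>" by (rule geodesic_length[OF geo(1) t, symmetric])
    finally have "sqrt (rmetric M ?w ((- t) *\<^sub>R ?g - (1 - t) *\<^sub>R ?g) ((- t) *\<^sub>R ?g - (1 - t) *\<^sub>R ?g)) = curve_length M \<gamma>" .
    moreover have "(1 - t) *\<^sub>R (- t) *\<^sub>R ?g + t *\<^sub>R (1 - t) *\<^sub>R ?g = 0"
      by (simp add: mult.commute[of t])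
    ultimately show ?thesis
      using S[OF p q t, of z] that by (simp only: tnorm_def r_def add_0_left)
  qed
  \<comment> \<open>Strong convexity yields the sphere of radius \<open>r\<close>, because its
    direction \<open>z\<close> is a unit vector. Shorter vectors follow by convexity from the
    origin.\<close>
  have zero: "0 \<in> ?K" using Exp_inv_self[OF w] w by (metis imageI)
  show ?thesis
  proof (cases "v = 0")
    case False
    define n where "n = tnorm M ?w v"
    have n: "n > 0" unfolding n_def using False tnorm_eq_0_iff[of ?w v] rmetric_nonneg
      by (simp add: tnorm_def order_less_le)
    have "tnorm M ?w ((1 / n) *\<^sub>R v) = 1" unfolding tnorm_scale n_def[symmetric] using n by simp
    from sphere[OF this] have "(1 - n / r) *\<^sub>R 0 + (n / r) *\<^sub>R (r *\<^sub>R (1 / n) *\<^sub>R v) \<in> ?K"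
      by (intro convexD_alt[OF K zero]) (use n v in \<open>auto simp: n_def r_def[symmetric]\<close>)
    then show ?thesis using n v by (simp add: n_def r_def[symmetric])
  qed (use zero in simp)
qed

lemma riem_ball_around_geodesic_subset:
  assumes x: "x \<in> C" and y: "y \<in> C" and \<gamma>: "geodesic_in M C x y \<gamma>" and t: "t \<in> {0..1}"
    and pos: "0 < \<alpha> * t * (1 - t) * (curve_length M \<gamma>)\<^sup>2"
    and z: "riem_dist M (\<gamma> t) z \<le> ennreal (\<alpha> * t * (1 - t) * (curve_length M \<gamma>)\<^sup>2)"
  shows "z \<in> C"
proof (rule riem_ball_subset[OF _ _ pos _ z])
  let ?w = "\<gamma> t"
  define r where "r = \<alpha> * t * (1 - t) * (curve_length M \<gamma>)\<^sup>2"
  show "closed C" using conv by (simp add: uniquely_geodesically_convex_def geodesically_convex_def)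
  show w: "?w \<in> C" using \<gamma> t by (auto simp: geodesic_in_def)
  fix u assume u: "u \<in> C" "riem_dist M ?w u < ennreal (\<alpha> * t * (1 - t) * (curve_length M \<gamma>)\<^sup>2)"
  define W where "W = {v. tnorm M ?w v < r}"
  have WK: "W \<subseteq> Exp_inv M C ?w ` C"
    unfolding W_def r_def using tangent_ball_subset_Exp_inv[OF x y \<gamma> t] by blast
  \<comment> \<open>A vector of the form \<open>Exp_inv M C ?w y\<close> is recovered from its
    endpoint \<open>y\<close>. So \<open>Exp_inv\<close> is a left inverse of \<open>Exp\<close> on
    \<open>W\<close>, which gives injectivity there.\<close>
  have inv: "Exp_inv M C ?w (Exp M ?w v) = v" "Exp M ?w v \<in> C" "v \<in> exp_domain M ?w" if "v \<in> W" for v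
    using WK that Exp_inv_works[OF w] by (auto simp: log_range_def)
  have "Exp M ?w (Exp_inv M C ?w u) \<in> interior C"
  proof (rule interior_Exp_image[of W])
    show "open W" unfolding W_def by (rule open_tnorm_ball)
    show "W \<subseteq> exp_domain M ?w" "Exp M ?w ` W \<subseteq> C" using inv by auto
    show "inj_on (Exp M ?w) W" by (rule inj_on_inverseI) (rule inv)
    \<comment> \<open>The logarithm of \<open>u\<close> has norm equal to the distance of
      \<open>u\<close>, which places it in \<open>W\<close>.\<close>
    have "ennreal (tnorm M ?w (Exp_inv M C ?w u)) < ennreal r"
      using log_range_dist[OF Exp_inv_works(1)[OF w u(1)]] Exp_inv_works(2)[OF w u(1)] u(2) by (simp add: r_def)
    then show "Exp_inv M C ?w u \<in> W"
      using rmetric_nonneg by (simp add: W_def tnorm_def ennreal_less_iff)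
  qed
  then show "u \<in> interior C" by (simp add: Exp_inv_works(2)[OF w u(1)])
qed

end

end

section \<open>Transfer from the Riemannian distance to \<open>d\<close>\<close>

theorem proposition4p2:
  fixes M :: "('m::{second_countable_topology, t2_space}, 'e::euclidean_space) riemannian"
    and C :: "'m set" and d :: "'m \<Rightarrow> 'm \<Rightarrow> real" and l L \<alpha> :: real
  assumes "riemannian_manifold M"
    and "compact C"
    and "uniquely_geodesically_convex M C"
    and "Metric_space UNIV d"
    and "0 < l" and "l \<le> L"
    and "\<And>x y. ennreal l * riem_dist M x y \<le> ennreal (d x y)"
    and "\<And>x y. ennreal (d x y) \<le> ennreal L * riem_dist M x y"
    and "0 < \<alpha>"
    and "riemannian_strongly_convex M \<alpha> C"
  shows "geodesically_strongly_convex M d (\<alpha> * l / L\<^sup>2) C"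
proof -
  interpret riemannian_mfd M by unfold_locales (rule assms(1))
  interpret d: Metric_space UNIV d by (rule assms(4))
  have L: "L > 0" using assms(5,6) by simp
  have "z \<in> C" if x: "x \<in> C" and y: "y \<in> C" and \<gamma>: "geodesic_in M C x y \<gamma>" and t: "t \<in> {0..1}"
    and z: "d (\<gamma> t) z \<le> \<alpha> * l / L\<^sup>2 * t * (1 - t) * (d x y)\<^sup>2" for x y \<gamma> t z
  proof -
    define D where "D = curve_length M \<gamma>"
    define r where "r = \<alpha> * t * (1 - t) * D\<^sup>2"
    have D0: "D \<ge> 0"
      unfolding D_def using \<gamma> by (auto simp: geodesic_in_def intro: curve_length_nonneg geodesic_Ck_curve)
    have t': "0 \<le> \<alpha> * t * (1 - t)" using t assms(9) by simp
    have r0: "r \<ge> 0" unfolding r_def using t' by simp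
    have "ennreal (d x y) \<le> ennreal L * ennreal D"
      unfolding D_def geodesic_in_length[OF assms(3,10) x y \<gamma>] by (rule assms(8))
    then have "d x y \<le> L * D" using L D0 by (simp flip: ennreal_mult)
    then have "(d x y)\<^sup>2 \<le> (L * D)\<^sup>2" by (intro power_mono) auto
    \<comment> \<open>The square of \<open>L * D\<close> absorbs \<open>L\<^sup>2\<close>, leaving
      \<open>l * r\<close>; the remaining \<open>l\<close> cancels against the lower bound on
      \<open>d\<close> at \<open>\<gamma> t\<close> and \<open>z\<close>.\<close>
    then have "\<alpha> * t * (1 - t) * (l / L\<^sup>2) * (d x y)\<^sup>2 \<le> \<alpha> * t * (1 - t) * (l / L\<^sup>2) * (L * D)\<^sup>2"
      using assms(5) by (intro mult_left_mono mult_nonneg_nonneg[OF t']) auto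
    also have "\<dots> = l * r" unfolding r_def using L by (simp add: field_simps power2_eq_square)
    finally have dr: "d (\<gamma> t) z \<le> l * r" using z by (simp add: mult_ac)
    show ?thesis
    \<comment> \<open>The radius vanishes at the endpoints or when the length of
      \<open>\<gamma>\<close> is zero. The ball for \<open>d\<close> is then the point
      \<open>\<gamma> t\<close>, by the metric axioms.\<close>
    proof (cases "r = 0")
      case True
      then have "d (\<gamma> t) z = 0" using dr d.nonneg[of "\<gamma> t" z] by simp
      then have "z = \<gamma> t" by simp
      then show ?thesis using \<gamma> t by (auto simp: geodesic_in_def)
    next
      case False
      have "ennreal l * riem_dist M (\<gamma> t) z \<le> ennreal l * ennreal r"
        using order_trans[OF assms(7) ennreal_leI[OF dr]] assms(5) r0 by (simp add: ennreal_mult)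
      then have "riem_dist M (\<gamma> t) z \<le> ennreal r"
        using assms(5) by (subst (asm) ennreal_mult_le_mult_iff) auto
      then show ?thesis
        using riem_ball_around_geodesic_subset[OF assms(3,10) x y \<gamma> t] r0 False
        unfolding r_def D_def by simp
    qed
  qed
  then show ?thesis
    using assms(10) unfolding geodesically_strongly_convex_def riemannian_strongly_convex_def by blast
qed

end
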